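(* Suppose that $f$ satisfies the structural assumption (A) stated in the context for some $\rho>0$, and let $\Delta t>0$ satisfy $\frac{1}{\Delta t}>\kappa_f$. Moreover, suppose that $f$ is continuous on $\overline\Omega\times\mathbb{R}$, and that the energy functional $E$ is weakly coercive, i.e. $E(v)\to+\infty$ whenever $|||v|||_{\lambda}\to\infty$ ($v\in\mathbb{V}$). Then, for the sequence $\{u^n\}_n\subset\mathbb{V}$ generated, from an initial guess $u^0\in\mathbb{V}$, by the iterative scheme \[ B_{\Delta t}(u^{n+1},v)=\ell_{\Delta t}(u^{n};v)\qquad\forall v\in\mathbb{V},\qquad n\ge0, \] there is a subsequence which converges (strongly in $\mathbb{V}$) to a solution $u^\star\in\mathbb{V}$ of \[ \int_\Omega\left(\nabla u^\star\cdot\nabla v-f(\mathbf{x},u^\star)v\right)d\mathbf{x}=0\qquad\forall v\in\mathbb{V}. \]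
   Context: $\Omega\subset\mathbb{R}^d$, $d\in\{1,2,3\}$, is an open bounded polytopal domain with boundary consisting of straight faces. $\mathbb{V}:=H^1_0(\Omega)$. For $\lambda>0$, $|||v|||_\lambda:=(\lambda\|\nabla v\|_{L^2(\Omega)}^2+\|v\|_{L^2(\Omega)}^2)^{1/2}$, $v\in\mathbb{V}$ (these norms are equivalent for all $\lambda>0$). $C_P>0$ is a constant depending only on $\Omega$ such that $\|v\|_{L^2(\Omega)}^2\le C_P\|\nabla v\|_{L^2(\Omega)}^2$ for all $v\in\mathbb{V}$. $f$ is a real-valued reaction function on $\Omega\times\mathbb{R}$. For $\lambda>0$ let $\sigma_f(\lambda):=\operatorname{ess\,sup}_{\mathbf{x}\in\Omega}\sup_{u\in\mathbb{R}}\left|\frac{\partial f}{\partial u}(\mathbf{x},u)+\frac1\lambda\right|$, and for $\rho>0$ let $\Lambda_f(\rho):=\{\lambda>0:\sigma_f(\lambda)<\rho+\frac1\lambda\}$. Assumption (A) for $\rho>0$: (i) $f(\cdot,0)\in L^2(\Omega)$; (ii) $f$ is differentiable in the second variable; (iii) the set $\Lambda_f(\rho)$ is non-empty. Define $\mu_f:=(\sup\Lambda_f(\rho))^{-1}$ if $\sup\Lambda_f(\rho)<\infty$ and $\mu_f:=0$ otherwise, and $\kappa_f:=\max\{\mu_f+\frac{\rho}{2}-\frac{1}{2C_P},0\}$. Energy functional: $E(u)=\frac12\int_\Omega|\nabla u|^2\,d\mathbf{x}-\int_\Omega\int_0^{u(\mathbf{x})}f(\mathbf{x},s)\,ds\,d\mathbf{x}$,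 $u\in\mathbb{V}$. For $\lambda>0$: $B_\lambda(u,v):=\int_\Omega(\lambda\nabla u\cdot\nabla v+uv)\,d\mathbf{x}$ for $u,v\in\mathbb{V}$, and $\ell_\lambda(y;v):=\int_\Omega(y+\lambda f(\mathbf{x},y))v\,d\mathbf{x}$ for $y\in L^2(\Omega)$, $v\in\mathbb{V}$. *)

theory Defs
  imports "HOL-Analysis.Analysis" "HOL-Probability.Essential_Supremum"
begin

(* Conventions.  Elements of L2 and of the Sobolev spaces are represented by functions on the
   whole of real^'d; only their values almost everywhere on \<Omega> matter.  All integrals over \<Omega>
   are Lebesgue integrals with respect to "lebesgue_on \<Omega>".  The reaction function f is curried:
   "f x u" is f(x,u), and only its values for x in \<Omega> (or in the closure of \<Omega>) matter.
   The parameter usually called lambda is written \<tau>. *)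

section \<open>Polytopal domains\<close>

(* "Domain" is read as nonempty, open and connected.  The boundary is a finite union of flat,
   (d-1)-dimensional faces; non-convex faces are subdivided into convex ones, and for d = 1
   the faces are points. *)
definition polytopal_domain :: "(real ^ 'd) set \<Rightarrow> bool" where
  "polytopal_domain \<Omega> \<longleftrightarrow>
     open \<Omega> \<and> connected \<Omega> \<and> \<Omega> \<noteq> {} \<and> bounded \<Omega> \<and>
     (\<exists>\<F>. finite \<F> \<and> (\<forall>F\<in>\<F>. polytope F \<and> aff_dim F = int CARD('d) - 1) \<and>
          frontier \<Omega> = \<Union>\<F>)"

section \<open>Test functions\<close>

definition partial :: "'d \<Rightarrow> (real ^ 'd \<Rightarrow> real) \<Rightarrow> real ^ 'd \<Rightarrow> real" where
  "partial i \<phi> x = frechet_derivative \<phi> (at x) (axis i 1)"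

primrec Ck :: "nat \<Rightarrow> (real ^ 'd \<Rightarrow> real) \<Rightarrow> bool" where
  "Ck 0 \<phi> \<longleftrightarrow> continuous_on UNIV \<phi>"
| "Ck (Suc k) \<phi> \<longleftrightarrow> (\<forall>x. \<phi> differentiable (at x)) \<and> (\<forall>i. Ck k (partial i \<phi>))"

(* Members of C_c^infinity(\<Omega>), extended by zero to the whole space. *)
definition test_function :: "(real ^ 'd) set \<Rightarrow> (real ^ 'd \<Rightarrow> real) \<Rightarrow> bool" where
  "test_function \<Omega> \<phi> \<longleftrightarrow>
     (\<forall>k. Ck k \<phi>) \<and> compact (closure {x. \<phi> x \<noteq> 0}) \<and> closure {x. \<phi> x \<noteq> 0} \<subseteq> \<Omega>"

section \<open>Sobolev spaces\<close>

definition L2 :: "(real ^ 'd) set \<Rightarrow> (real ^ 'd \<Rightarrow> 'b::euclidean_space) set" where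
  "L2 \<Omega> = {u. u \<in> borel_measurable (lebesgue_on \<Omega>) \<and>
               integrable (lebesgue_on \<Omega>) (\<lambda>x. (norm (u x))\<^sup>2)}"

definition L2_norm :: "(real ^ 'd) set \<Rightarrow> (real ^ 'd \<Rightarrow> 'b::euclidean_space) \<Rightarrow> real" where
  "L2_norm \<Omega> u = sqrt (LINT x|lebesgue_on \<Omega>. (norm (u x))\<^sup>2)"

definition is_weak_gradient ::
  "(real ^ 'd) set \<Rightarrow> (real ^ 'd \<Rightarrow> real) \<Rightarrow> (real ^ 'd \<Rightarrow> real ^ 'd) \<Rightarrow> bool" where
  "is_weak_gradient \<Omega> u g \<longleftrightarrow>
     (\<forall>\<phi>. test_function \<Omega> \<phi> \<longrightarrow>
        (\<forall>i. (LINT x|lebesgue_on \<Omega>. u x * partial i \<phi> x) =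
             - (LINT x|lebesgue_on \<Omega>. g x $ i * \<phi> x)))"

definition H1 :: "(real ^ 'd) set \<Rightarrow> (real ^ 'd \<Rightarrow> real) set" where
  "H1 \<Omega> = {u \<in> L2 \<Omega>. \<exists>g \<in> L2 \<Omega>. is_weak_gradient \<Omega> u g}"

(* For u in H1 this is determined almost everywhere on \<Omega>. *)
definition wgrad :: "(real ^ 'd) set \<Rightarrow> (real ^ 'd \<Rightarrow> real) \<Rightarrow> real ^ 'd \<Rightarrow> real ^ 'd" where
  "wgrad \<Omega> u = (SOME g. g \<in> L2 \<Omega> \<and> is_weak_gradient \<Omega> u g)"

definition lam_norm :: "(real ^ 'd) set \<Rightarrow> real \<Rightarrow> (real ^ 'd \<Rightarrow> real) \<Rightarrow> real" where
  "lam_norm \<Omega> \<tau> v = sqrt (\<tau> * (L2_norm \<Omega> (wgrad \<Omega> v))\<^sup>2 + (L2_norm \<Omega> v)\<^sup>2)"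

abbreviation H1_norm :: "(real ^ 'd) set \<Rightarrow> (real ^ 'd \<Rightarrow> real) \<Rightarrow> real" where
  "H1_norm \<Omega> \<equiv> lam_norm \<Omega> 1"

(* The closure of the test functions in H1. *)
definition H10 :: "(real ^ 'd) set \<Rightarrow> (real ^ 'd \<Rightarrow> real) set" where
  "H10 \<Omega> = {u \<in> H1 \<Omega>. \<exists>\<phi> :: nat \<Rightarrow> real ^ 'd \<Rightarrow> real.
              (\<forall>n. test_function \<Omega> (\<phi> n)) \<and>
              (\<lambda>n. H1_norm \<Omega> (\<lambda>x. u x - \<phi> n x)) \<longlonglongrightarrow> 0}"

definition poincare_constant :: "(real ^ 'd) set \<Rightarrow> real \<Rightarrow> bool" where
  "poincare_constant \<Omega> C \<longleftrightarrow>
     C > 0 \<and> (\<forall>v \<in> H10 \<Omega>. (L2_norm \<Omega> v)\<^sup>2 \<le> C * (L2_norm \<Omega> (wgrad \<Omega> v))\<^sup>2)"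

section \<open>The reaction function\<close>

(* Takes values in the extended reals, as the suprema may be infinite. *)
definition sigma_f :: "(real ^ 'd) set \<Rightarrow> (real ^ 'd \<Rightarrow> real \<Rightarrow> real) \<Rightarrow> real \<Rightarrow> ereal" where
  "sigma_f \<Omega> f \<tau> = esssup (lebesgue_on \<Omega>) (\<lambda>x. SUP u. ereal \<bar>deriv (f x) u + 1 / \<tau>\<bar>)"

definition Lambda_f :: "(real ^ 'd) set \<Rightarrow> (real ^ 'd \<Rightarrow> real \<Rightarrow> real) \<Rightarrow> real \<Rightarrow> real set" where
  "Lambda_f \<Omega> f \<rho> = {\<tau>. \<tau> > 0 \<and> sigma_f \<Omega> f \<tau> < ereal (\<rho> + 1 / \<tau>)}"

definition assumption_A :: "(real ^ 'd) set \<Rightarrow> (real ^ 'd \<Rightarrow> real \<Rightarrow> real) \<Rightarrow> real \<Rightarrow> bool" where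
  "assumption_A \<Omega> f \<rho> \<longleftrightarrow>
     (\<lambda>x. f x 0) \<in> L2 \<Omega> \<and>
     (\<forall>x\<in>\<Omega>. \<forall>u. f x differentiable (at u)) \<and>
     Lambda_f \<Omega> f \<rho> \<noteq> {}"

definition mu_f :: "(real ^ 'd) set \<Rightarrow> (real ^ 'd \<Rightarrow> real \<Rightarrow> real) \<Rightarrow> real \<Rightarrow> real" where
  "mu_f \<Omega> f \<rho> = (if bdd_above (Lambda_f \<Omega> f \<rho>) then 1 / Sup (Lambda_f \<Omega> f \<rho>) else 0)"

definition kappa_f ::
  "(real ^ 'd) set \<Rightarrow> real \<Rightarrow> (real ^ 'd \<Rightarrow> real \<Rightarrow> real) \<Rightarrow> real \<Rightarrow> real" where
  "kappa_f \<Omega> C\<^sub>P f \<rho> = max (mu_f \<Omega> f \<rho> + \<rho> / 2 - 1 / (2 * C\<^sub>P)) 0"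

section \<open>Energy, weak form and iteration\<close>

(* The inner integral is the signed (oriented) one, also for u x < 0. *)
definition energy ::
  "(real ^ 'd) set \<Rightarrow> (real ^ 'd \<Rightarrow> real \<Rightarrow> real) \<Rightarrow> (real ^ 'd \<Rightarrow> real) \<Rightarrow> real" where
  "energy \<Omega> f u =
     1 / 2 * (LINT x|lebesgue_on \<Omega>. (norm (wgrad \<Omega> u x))\<^sup>2)
     - (LINT x|lebesgue_on \<Omega>. (LBINT s=ereal 0..ereal (u x). f x s))"

(* E(v) tends to infinity as lam_norm \<Omega> \<tau> v tends to infinity, v ranging over H10 \<Omega>. *)
definition weakly_coercive ::
  "(real ^ 'd) set \<Rightarrow> real \<Rightarrow> ((real ^ 'd \<Rightarrow> real) \<Rightarrow> real) \<Rightarrow> bool" where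
  "weakly_coercive \<Omega> \<tau> E \<longleftrightarrow>
     filterlim E at_top (inf (filtercomap (lam_norm \<Omega> \<tau>) at_top) (principal (H10 \<Omega>)))"

definition B_form ::
  "(real ^ 'd) set \<Rightarrow> real \<Rightarrow> (real ^ 'd \<Rightarrow> real) \<Rightarrow> (real ^ 'd \<Rightarrow> real) \<Rightarrow> real" where
  "B_form \<Omega> \<tau> u v =
     (LINT x|lebesgue_on \<Omega>. \<tau> * (wgrad \<Omega> u x \<bullet> wgrad \<Omega> v x) + u x * v x)"

definition ell_form ::
  "(real ^ 'd) set \<Rightarrow> (real ^ 'd \<Rightarrow> real \<Rightarrow> real) \<Rightarrow> real \<Rightarrow>
   (real ^ 'd \<Rightarrow> real) \<Rightarrow> (real ^ 'd \<Rightarrow> real) \<Rightarrow> real" where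
  "ell_form \<Omega> f \<tau> y v = (LINT x|lebesgue_on \<Omega>. (y x + \<tau> * f x (y x)) * v x)"

definition weak_solution ::
  "(real ^ 'd) set \<Rightarrow> (real ^ 'd \<Rightarrow> real \<Rightarrow> real) \<Rightarrow> (real ^ 'd \<Rightarrow> real) \<Rightarrow> bool" where
  "weak_solution \<Omega> f u \<longleftrightarrow> u \<in> H10 \<Omega> \<and>
     (\<forall>v \<in> H10 \<Omega>. (LINT x|lebesgue_on \<Omega>. wgrad \<Omega> u x \<bullet> wgrad \<Omega> v x - f x (u x) * v x) = 0)"

end

theory Submission
  imports Defs "HOL-Complex_Analysis.Great_Picard" "HOL-Probability.Probability_Measure"
begin

text \<open>Choosing \<open>\<nu> \<in> Lambda_f \<Omega> f \<rho>\<close> close to the supremum makes \<open>f\<close> Lipschitz in the second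
  variable, with a constant \<open>K = \<rho> + 2 / \<nu>\<close> such that \<open>\<gamma> = 1 / \<Delta>t + 1 / (2 * C\<^sub>P) - K / 2\<close> is positive.
  Testing the scheme with the increment gives the energy descent
  \<open>energy (u (n + 1)) + \<gamma> * \<parallel>u (n + 1) - u n\<parallel>\<^sup>2 \<le> energy (u n)\<close> in the \<open>L2\<close> norm.
  By coercivity the iterates are bounded in \<open>H1\<close>, hence the energies are bounded below and the
  increments tend to 0 in \<open>L2\<close>. By Rellich's theorem some subsequence \<open>u (k n)\<close> is Cauchy in \<open>L2\<close>.
  As one step of the scheme is Lipschitz from \<open>L2\<close> to \<open>H1\<close>, the shifted subsequence
  \<open>u (k n + 1)\<close> is Cauchy in \<open>H1\<close>. Both have the same limit in \<open>L2\<close>, so passing to the limit in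
  the scheme gives a weak solution.\<close>

section \<open>The space L2\<close>

text \<open>Each summand of \<open>\<gamma>\<close> has its own source in the tested scheme. The
  zero order part of \<open>B_form\<close> yields \<open>1 / \<Delta>t\<close>, half the squared
  gradient norm of the increment yields \<open>1 / (2 * C\<^sub>P)\<close> by the Poincare
  inequality, and the second order error in the primitive of \<open>f\<close> costs
  \<open>K / 2\<close>. Since \<open>K / 2 = \<rho> / 2 + 1 / \<nu>\<close> and
  \<open>1 / \<nu>\<close> can be brought close to \<open>mu_f\<close>, the step size condition is
  what makes \<open>\<gamma>\<close> positive. Compactness gives closeness in L2 only, without
  gradients. The shift by one step repairs this: \<open>ell_form\<close> contains no gradients, so
  the elliptic solve turns L2 closeness of the inputs into H1 closeness of the outputs. Elements of
  H10 are limits of test functions, which extend smoothly by zero. Compactness is therefore reduced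
  to smooth functions on the whole space, where translation estimates meet no boundary. Functions
  equal almost everywhere are not identified and \<open>wgrad\<close> is a choice, so the gradient
  is linear only almost everywhere. Every such step rests on the uniqueness of weak gradients, hence
  on the fundamental lemma of the calculus of variations.\<close>

lemma L2_measurable: "u \<in> L2 \<Omega> \<Longrightarrow> u \<in> borel_measurable (lebesgue_on \<Omega>)"
  by (simp add: L2_def)

lemma L2_integrable: "u \<in> L2 \<Omega> \<Longrightarrow> integrable (lebesgue_on \<Omega>) (\<lambda>x. (norm (u x))\<^sup>2)"
  by (simp add: L2_def)

lemma L2_dominated:
  assumes "u \<in> borel_measurable (lebesgue_on \<Omega>)" "integrable (lebesgue_on \<Omega>) h"
    and "AE x in lebesgue_on \<Omega>. (norm (u x))\<^sup>2 \<le> h x"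
  shows "u \<in> L2 \<Omega>"
proof -
  have [measurable]: "u \<in> borel_measurable (lebesgue_on \<Omega>)" by fact
  have "integrable (lebesgue_on \<Omega>) (\<lambda>x. (norm (u x))\<^sup>2)"
    by (rule Bochner_Integration.integrable_bound[OF assms(2)]) (use assms(3) in \<open>auto elim!: eventually_mono\<close>)
  then show ?thesis using assms(1) by (simp add: L2_def)
qed

lemma norm_add_sq_le: "(norm (x + y))\<^sup>2 \<le> 2 * (norm x)\<^sup>2 + 2 * (norm (y::'a::real_inner))\<^sup>2"
proof -
  have "(norm (x + y))\<^sup>2 + (norm (x - y))\<^sup>2 = 2 * (norm x)\<^sup>2 + 2 * (norm y)\<^sup>2"
    by (simp add: power2_norm_eq_inner algebra_simps inner_commute)
  then show ?thesis using zero_le_power2[of "norm (x - y)"] by linarith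
qed

lemma L2_add:
  assumes u: "u \<in> L2 \<Omega>" and v: "v \<in> L2 \<Omega>"
  shows "(\<lambda>x. u x + v x) \<in> L2 \<Omega>"
proof (rule L2_dominated)
  show "(\<lambda>x. u x + v x) \<in> borel_measurable (lebesgue_on \<Omega>)"
    using u[THEN L2_measurable] v[THEN L2_measurable] by simp
  show "integrable (lebesgue_on \<Omega>) (\<lambda>x. 2 * (norm (u x))\<^sup>2 + 2 * (norm (v x))\<^sup>2)"
    using u[THEN L2_integrable] v[THEN L2_integrable] by simp
qed (simp add: norm_add_sq_le)

lemma L2_scaleR:
  assumes u: "u \<in> L2 \<Omega>"
  shows "(\<lambda>x. c *\<^sub>R u x) \<in> L2 \<Omega>"
  using u by (auto simp: L2_def power_mult_distrib intro!: borel_measurable_scaleR)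

lemma L2_mult: "u \<in> L2 \<Omega> \<Longrightarrow> (\<lambda>x. c * u x :: real) \<in> L2 \<Omega>"
  using L2_scaleR[of u \<Omega> c] by simp

lemma L2_uminus: "u \<in> L2 \<Omega> \<Longrightarrow> (\<lambda>x. - u x) \<in> L2 \<Omega>"
  using L2_scaleR[of u \<Omega> "-1"] by simp

lemma L2_diff: "u \<in> L2 \<Omega> \<Longrightarrow> v \<in> L2 \<Omega> \<Longrightarrow> (\<lambda>x. u x - v x) \<in> L2 \<Omega>"
  using L2_add[of u \<Omega> "\<lambda>x. - v x"] by (simp add: L2_uminus)

lemma L2_inner_integrable:
  assumes u: "u \<in> L2 \<Omega>" and v: "v \<in> L2 \<Omega>"
  shows "integrable (lebesgue_on \<Omega>) (\<lambda>x. u x \<bullet> v x)"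
proof (rule Bochner_Integration.integrable_bound)
  show "integrable (lebesgue_on \<Omega>) (\<lambda>x. (norm (u x))\<^sup>2 + (norm (v x))\<^sup>2)"
    using u[THEN L2_integrable] v[THEN L2_integrable] by simp
  show "(\<lambda>x. u x \<bullet> v x) \<in> borel_measurable (lebesgue_on \<Omega>)"
    using u[THEN L2_measurable] v[THEN L2_measurable] by simp
  have "norm (a \<bullet> b) \<le> norm ((norm a)\<^sup>2 + (norm b)\<^sup>2)" for a b :: 'b
  proof -
    have "\<bar>a \<bullet> b\<bar> \<le> norm a * norm b" by (rule Cauchy_Schwarz_ineq2)
    also have "\<dots> \<le> (norm a)\<^sup>2 + (norm b)\<^sup>2"
      using sum_squares_bound[of "norm a" "norm b"] mult_nonneg_nonneg[OF norm_ge_zero[of a] norm_ge_zero[of b]]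
      unfolding mult.assoc by linarith
    finally show ?thesis by simp
  qed
  then show "AE x in lebesgue_on \<Omega>. norm (u x \<bullet> v x) \<le> norm ((norm (u x))\<^sup>2 + (norm (v x))\<^sup>2)"
    by simp
qed

lemma L2_mult_integrable:
  "u \<in> L2 \<Omega> \<Longrightarrow> v \<in> L2 \<Omega> \<Longrightarrow> integrable (lebesgue_on \<Omega>) (\<lambda>x. u x * v x :: real)"
  using L2_inner_integrable[of u \<Omega> v] by simp

lemma L2_norm_nonneg [simp]: "0 \<le> L2_norm \<Omega> u"
  by (simp add: L2_norm_def)

lemma L2_norm_power2: "(L2_norm \<Omega> u)\<^sup>2 = (LINT x|lebesgue_on \<Omega>. (norm (u x))\<^sup>2)"
  by (simp add: L2_norm_def)

lemma L2_norm_cong_AE: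
  assumes "AE x in lebesgue_on \<Omega>. u x = v x"
    and "u \<in> borel_measurable (lebesgue_on \<Omega>)" "v \<in> borel_measurable (lebesgue_on \<Omega>)"
  shows "L2_norm \<Omega> u = L2_norm \<Omega> v"
proof -
  have "(LINT x|lebesgue_on \<Omega>. (norm (u x))\<^sup>2) = (LINT x|lebesgue_on \<Omega>. (norm (v x))\<^sup>2)"
    by (rule integral_cong_AE) (use assms in auto)
  then show ?thesis by (simp add: L2_norm_def)
qed

lemma L2_norm_scaleR: "L2_norm \<Omega> (\<lambda>x. c *\<^sub>R u x) = \<bar>c\<bar> * L2_norm \<Omega> u"
  by (simp add: L2_norm_def power_mult_distrib real_sqrt_mult)

lemma L2_norm_minus_commute: "L2_norm \<Omega> (\<lambda>x. u x - v x) = L2_norm \<Omega> (\<lambda>x. v x - u x)"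
  by (simp add: L2_norm_def norm_minus_commute)

lemma L2_norm_add_power2:
  assumes u: "u \<in> L2 \<Omega>" and v: "v \<in> L2 \<Omega>"
  shows "(L2_norm \<Omega> (\<lambda>x. u x + v x))\<^sup>2 =
    (L2_norm \<Omega> u)\<^sup>2 + 2 * (LINT x|lebesgue_on \<Omega>. u x \<bullet> v x) + (L2_norm \<Omega> v)\<^sup>2"
proof -
  have "(norm (a + b))\<^sup>2 = (norm a)\<^sup>2 + 2 * (a \<bullet> b) + (norm b)\<^sup>2" for a b :: 'b
    by (simp add: power2_norm_eq_inner algebra_simps inner_commute)
  then show ?thesis
    using u[THEN L2_integrable] v[THEN L2_integrable] L2_inner_integrable[OF u v]
    by (simp add: L2_norm_power2)
qed

text \<open>The squared norm of \<open>u + t v\<close> is a nonnegative polynomial in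
  \<open>t\<close> of degree at most two, so its discriminant cannot be positive.\<close>

lemma L2_Cauchy_Schwarz:
  assumes u: "u \<in> L2 \<Omega>" and v: "v \<in> L2 \<Omega>"
  shows "\<bar>LINT x|lebesgue_on \<Omega>. u x \<bullet> v x\<bar> \<le> L2_norm \<Omega> u * L2_norm \<Omega> v"
proof -
  define a b c where "a = (L2_norm \<Omega> u)\<^sup>2" and "b = (LINT x|lebesgue_on \<Omega>. u x \<bullet> v x)"
    and "c = (L2_norm \<Omega> v)\<^sup>2"
  have *: "0 \<le> a + 2 * t * b + t\<^sup>2 * c" for t
  proof -
    have "0 \<le> (L2_norm \<Omega> (\<lambda>x. u x + t *\<^sub>R v x))\<^sup>2" by simp
    also have "\<dots> = a + 2 * t * b + t\<^sup>2 * c"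
      by (subst L2_norm_add_power2[OF u L2_scaleR[OF v]])
        (simp add: L2_norm_scaleR a_def b_def c_def power_mult_distrib)
    finally show ?thesis .
  qed
  have "b\<^sup>2 \<le> a * c"
  proof (cases "c = 0")
    case True
    have "b = 0"
    proof (rule ccontr)
      assume "b \<noteq> 0"
      \<comment> \<open>With \<open>c = 0\<close> the polynomial is affine, and at this
        \<open>t\<close> it would take the value -1.\<close>
      then show False using *[of "- (a + 1) / (2 * b)"] True by (simp add: field_simps)
    qed
    then show ?thesis using True by simp
  next
    case False
    then have "c > 0" by (simp add: c_def less_le)
    \<comment> \<open>\<open>- b / c\<close> is the minimiser of the quadratic.\<close>
    then show ?thesis using *[of "- b / c"] by (simp add: field_simps power2_eq_square)
  qed
  also have "a * c = (L2_norm \<Omega> u * L2_norm \<Omega> v)\<^sup>2" by (simp add: a_def c_def power_mult_distrib)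
  finally show ?thesis unfolding b_def by (simp add: abs_le_square_iff[symmetric])
qed

lemma L2_triangle:
  assumes u: "u \<in> L2 \<Omega>" and v: "v \<in> L2 \<Omega>"
  shows "L2_norm \<Omega> (\<lambda>x. u x + v x) \<le> L2_norm \<Omega> u + L2_norm \<Omega> v"
proof (rule power2_le_imp_le)
  show "(L2_norm \<Omega> (\<lambda>x. u x + v x))\<^sup>2 \<le> (L2_norm \<Omega> u + L2_norm \<Omega> v)\<^sup>2"
    using L2_Cauchy_Schwarz[OF u v] unfolding L2_norm_add_power2[OF u v]
    by (simp add: power2_sum)
qed simp

lemma L2_triangle_diff:
  assumes "u \<in> L2 \<Omega>" "v \<in> L2 \<Omega>" "w \<in> L2 \<Omega>"
  shows "L2_norm \<Omega> (\<lambda>x. u x - w x) \<le> L2_norm \<Omega> (\<lambda>x. u x - v x) + L2_norm \<Omega> (\<lambda>x. v x - w x)"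
  using L2_triangle[OF L2_diff[OF assms(1,2)] L2_diff[OF assms(2,3)]] by simp

lemma L2_norm_mono:
  assumes "u \<in> borel_measurable (lebesgue_on \<Omega>)" "v \<in> L2 \<Omega>"
    and "AE x in lebesgue_on \<Omega>. norm (u x) \<le> norm (v x)"
  shows "u \<in> L2 \<Omega>" "L2_norm \<Omega> u \<le> L2_norm \<Omega> v"
proof -
  have *: "AE x in lebesgue_on \<Omega>. (norm (u x))\<^sup>2 \<le> (norm (v x))\<^sup>2"
    using assms(3) by (rule eventually_mono) (simp add: power_mono)
  show u: "u \<in> L2 \<Omega>" by (rule L2_dominated[OF assms(1) L2_integrable[OF assms(2)] *])
  show "L2_norm \<Omega> u \<le> L2_norm \<Omega> v"
    unfolding L2_norm_def
    by (intro real_sqrt_le_mono integral_mono_AE L2_integrable u assms(2) *)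
qed

section \<open>Completeness of L2\<close>

lemma L2_norm_nn_integral:
  assumes u: "u \<in> L2 \<Omega>"
  shows "(\<integral>\<^sup>+x. ennreal ((norm (u x))\<^sup>2) \<partial>lebesgue_on \<Omega>) = ennreal ((L2_norm \<Omega> u)\<^sup>2)"
  by (simp add: L2_norm_power2 nn_integral_eq_integral[OF L2_integrable[OF u]])

text \<open>Fatou's lemma and the grid estimates bound extended integrals only; this turns such a
  bound into membership in L2 and a bound on the norm.\<close>

lemma L2_bounded_nn_integral:
  assumes "u \<in> borel_measurable (lebesgue_on \<Omega>)"
    and "(\<integral>\<^sup>+x. ennreal ((norm (u x))\<^sup>2) \<partial>lebesgue_on \<Omega>) \<le> ennreal (c\<^sup>2)" and "0 \<le> c"
  shows "u \<in> L2 \<Omega>" "L2_norm \<Omega> u \<le> c"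
proof -
  have "integrable (lebesgue_on \<Omega>) (\<lambda>x. (norm (u x))\<^sup>2)"
    by (rule integrableI_bounded) (use assms in \<open>auto simp: less_top[symmetric] top_unique\<close>)
  then show u: "u \<in> L2 \<Omega>" using assms(1) by (simp add: L2_def)
  have "(L2_norm \<Omega> u)\<^sup>2 \<le> c\<^sup>2"
    using assms(2) by (simp add: L2_norm_nn_integral[OF u])
  then show "L2_norm \<Omega> u \<le> c" using assms(3) by (rule power2_le_imp_le)
qed

text \<open>With increments \<open>d k\<close> of \<open>L2\<close> norm at most \<open>2\<close> to the power \<open>-k\<close>, the weighted series of
  \<open>2 ^ k * (d k)\<^sup>2\<close> is integrable, hence finite a.e.; by AM-GM the series of \<open>d k\<close> converges a.e.\<close>

lemma L2_fast_Cauchy_AE_convergent: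
  fixes w :: "nat \<Rightarrow> real ^ 'd \<Rightarrow> 'b::euclidean_space"
  assumes w: "\<And>n. w n \<in> L2 \<Omega>"
    and fast: "\<And>k. L2_norm \<Omega> (\<lambda>x. w (Suc k) x - w k x) \<le> (1/2) ^ k"
  shows "AE x in lebesgue_on \<Omega>. convergent (\<lambda>k. w k x)"
proof -
  let ?M = "lebesgue_on \<Omega>"
  have [measurable]: "w n \<in> borel_measurable ?M" for n using w L2_measurable by blast
  have "(\<integral>\<^sup>+x. (\<Sum>k. ennreal (2 ^ k * (norm (w (Suc k) x - w k x))\<^sup>2)) \<partial>?M)
      = (\<Sum>k. \<integral>\<^sup>+x. ennreal (2 ^ k * (norm (w (Suc k) x - w k x))\<^sup>2) \<partial>?M)"
    by (rule nn_integral_suminf) measurable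
  also have "\<dots> = (\<Sum>k. ennreal (2 ^ k * (L2_norm \<Omega> (\<lambda>x. w (Suc k) x - w k x))\<^sup>2))"
    by (simp add: ennreal_mult nn_integral_cmult L2_norm_nn_integral[OF L2_diff[OF w w]])
  also have "\<dots> \<le> (\<Sum>k. ennreal ((1/2) ^ k))"
  proof (intro suminf_le ennreal_leI)
    fix k
    have "2 ^ k * (L2_norm \<Omega> (\<lambda>x. w (Suc k) x - w k x))\<^sup>2 \<le> 2 ^ k * ((1/2) ^ k)\<^sup>2"
      by (intro mult_left_mono power_mono fast) auto
    also have "\<dots> = (1/2::real) ^ k" by (simp add: power2_eq_square power_divide)
    finally show "2 ^ k * (L2_norm \<Omega> (\<lambda>x. w (Suc k) x - w k x))\<^sup>2 \<le> (1/2) ^ k" .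
  qed auto
  also have "\<dots> = ennreal (\<Sum>k. (1/2) ^ k)"
    by (rule suminf_ennreal2) auto
  finally have "(\<integral>\<^sup>+x. (\<Sum>k. ennreal (2 ^ k * (norm (w (Suc k) x - w k x))\<^sup>2)) \<partial>?M) \<noteq> \<infinity>"
    by (auto simp: top_unique)
  then have "AE x in ?M. (\<Sum>k. ennreal (2 ^ k * (norm (w (Suc k) x - w k x))\<^sup>2)) \<noteq> \<infinity>"
    by (intro nn_integral_PInf_AE) auto
  then show ?thesis
  proof (rule eventually_mono)
    fix x assume "(\<Sum>k. ennreal (2 ^ k * (norm (w (Suc k) x - w k x))\<^sup>2)) \<noteq> \<infinity>"
    then have s: "summable (\<lambda>k. 2 ^ k * (norm (w (Suc k) x - w k x))\<^sup>2)"
      by (intro summable_suminf_not_top) auto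
    have "summable (\<lambda>k. norm (w (Suc k) x - w k x))"
    proof (rule summable_comparison_test')
      show "summable (\<lambda>k. 2 ^ k * (norm (w (Suc k) x - w k x))\<^sup>2 + (1/2) ^ k)"
        by (intro summable_add s) (simp add: summable_geometric)
      fix k :: nat
      define a where "a = norm (w (Suc k) x - w k x)"
      define p where "p = (2::real) ^ k"
      have p: "p > 0" by (simp add: p_def)
      have "p * (p * a\<^sup>2 + 1 / p - 2 * a) = (p * a - 1)\<^sup>2"
        using p by (simp add: power2_eq_square algebra_simps)
      then have "0 \<le> p * a\<^sup>2 + 1 / p - 2 * a"
        using p by (metis zero_le_mult_iff zero_le_power2 not_less)
      moreover have "0 \<le> a" by (simp add: a_def)
      ultimately have "a \<le> p * a\<^sup>2 + 1 / p" by linarith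
      then show "norm (norm (w (Suc k) x - w k x)) \<le> 2 ^ k * (norm (w (Suc k) x - w k x))\<^sup>2 + (1/2) ^ k"
        by (simp add: a_def p_def power_divide)
    qed
    then have "summable (\<lambda>k. w (Suc k) x - w k x)" by (rule summable_norm_cancel)
    then have "convergent (\<lambda>n. \<Sum>k<n. w (Suc k) x - w k x)"
      by (simp add: summable_iff_convergent)
    then have "convergent (\<lambda>n. w n x - w 0 x)"
      by (simp add: sum_lessThan_telescope[of "\<lambda>k. w k x"])
    then have "convergent (\<lambda>n. (w n x - w 0 x) + w 0 x)" by (intro convergent_add convergent_const)
    then show "convergent (\<lambda>k. w k x)" by simp
  qed
qed

lemma Cauchy_fast_subseq:
  fixes d :: "nat \<Rightarrow> nat \<Rightarrow> real"
  assumes "\<And>e. e > 0 \<Longrightarrow> \<exists>N. \<forall>m\<ge>N. \<forall>n\<ge>N. d m n < e"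
  obtains r where "strict_mono (r :: nat \<Rightarrow> nat)" "\<And>k. d (r (Suc k)) (r k) \<le> (1/2) ^ k"
proof -
  have "\<forall>k. \<exists>N. \<forall>m\<ge>N. \<forall>n\<ge>N. d m n < (1/2) ^ k" using assms by simp
  then obtain N where N: "\<And>k m n. m \<ge> N k \<Longrightarrow> n \<ge> N k \<Longrightarrow> d m n < (1/2) ^ k" by metis
  \<comment> \<open>Summing the thresholds puts \<open>r k\<close> above \<open>N k\<close>, and the
    summand \<open>k\<close> makes \<open>r\<close> strictly increasing.\<close>
  define r where "r k = (\<Sum>i\<le>k. N i) + k" for k
  have "r k < r (Suc k)" for k by (simp add: r_def)
  then have "strict_mono r" by (rule strict_monoI_Suc)
  moreover have "N k \<le> r k" for k
    unfolding r_def by (metis atMost_iff finite_atMost le_refl member_le_sum trans_le_add1 zero_le)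
  then have "d (r (Suc k)) (r k) \<le> (1/2) ^ k" for k
    using N[of k "r (Suc k)" "r k"] \<open>r k < r (Suc k)\<close> by (meson less_imp_le order_trans)
  ultimately show ?thesis using that by blast
qed

text \<open>The candidate is the almost everywhere limit of a fast subsequence. Fatou's lemma along
  that subsequence carries the Cauchy bound over to the distance of the whole sequence from the
  candidate.\<close>

lemma L2_complete:
  fixes w :: "nat \<Rightarrow> real ^ 'd \<Rightarrow> 'b::euclidean_space"
  assumes w: "\<And>n. w n \<in> L2 \<Omega>"
    and Cauchy: "\<And>e. e > 0 \<Longrightarrow> \<exists>N. \<forall>m\<ge>N. \<forall>n\<ge>N. L2_norm \<Omega> (\<lambda>x. w m x - w n x) < e"
  obtains v where "v \<in> L2 \<Omega>" "(\<lambda>n. L2_norm \<Omega> (\<lambda>x. w n x - v x)) \<longlonglongrightarrow> 0"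
proof -
  let ?M = "lebesgue_on \<Omega>"
  obtain r where r: "strict_mono r"
    "\<And>k. L2_norm \<Omega> (\<lambda>x. w (r (Suc k)) x - w (r k) x) \<le> (1/2) ^ k"
    using Cauchy_fast_subseq[OF Cauchy] by blast
  have conv: "AE x in ?M. convergent (\<lambda>k. w (r k) x)"
    by (rule L2_fast_Cauchy_AE_convergent[of "\<lambda>k. w (r k)"]) (use w r in auto)
  \<comment> \<open>Where the subsequence diverges, \<open>lim\<close> returns some unspecified
    value; this happens on a null set only, and \<open>v\<close> is measurable nevertheless.\<close>
  define v where "v x = lim (\<lambda>k. w (r k) x)" for x
  have [measurable]: "w n \<in> borel_measurable ?M" for n using w L2_measurable by blast
  have [measurable]: "v \<in> borel_measurable ?M"
    unfolding v_def by (rule borel_measurable_lim_metric) simp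
  have lim: "AE x in ?M. (\<lambda>k. w (r k) x) \<longlonglongrightarrow> v x"
    using conv by (rule eventually_mono) (simp add: v_def convergent_LIMSEQ_iff)
  have close: "(\<lambda>x. w n x - v x) \<in> L2 \<Omega> \<and> L2_norm \<Omega> (\<lambda>x. w n x - v x) \<le> e"
    if "e > 0" "n \<ge> N" and N: "\<And>m n. m \<ge> N \<Longrightarrow> n \<ge> N \<Longrightarrow> L2_norm \<Omega> (\<lambda>x. w m x - w n x) < e"
    for e n N
  proof -
    have "(\<integral>\<^sup>+x. ennreal ((norm (w n x - v x))\<^sup>2) \<partial>?M)
        = (\<integral>\<^sup>+x. liminf (\<lambda>k. ennreal ((norm (w n x - w (r k) x))\<^sup>2)) \<partial>?M)"
    proof (rule nn_integral_cong_AE, use lim in \<open>rule eventually_mono\<close>)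
      fix x assume "(\<lambda>k. w (r k) x) \<longlonglongrightarrow> v x"
      then have "(\<lambda>k. ennreal ((norm (w n x - w (r k) x))\<^sup>2)) \<longlonglongrightarrow> ennreal ((norm (w n x - v x))\<^sup>2)"
        by (intro tendsto_intros)
      then show "ennreal ((norm (w n x - v x))\<^sup>2) = liminf (\<lambda>k. ennreal ((norm (w n x - w (r k) x))\<^sup>2))"
        by (metis lim_imp_Liminf sequentially_bot)
    qed
    also have "\<dots> \<le> liminf (\<lambda>k. \<integral>\<^sup>+x. ennreal ((norm (w n x - w (r k) x))\<^sup>2) \<partial>?M)"
      by (rule nn_integral_liminf) measurable
    also have "\<dots> = liminf (\<lambda>k. ennreal ((L2_norm \<Omega> (\<lambda>x. w n x - w (r k) x))\<^sup>2))"
      by (simp add: L2_norm_nn_integral[OF L2_diff[OF w w]])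
    also have "\<dots> \<le> ennreal (e\<^sup>2)"
    proof (rule order_trans[OF Liminf_le_Limsup Limsup_bounded])
      have "L2_norm \<Omega> (\<lambda>x. w n x - w (r k) x) < e" if "k \<ge> N" for k
        by (intro N \<open>n \<ge> N\<close>) (use that seq_suble[OF r(1), of k] in linarith)
      then have "\<forall>k\<ge>N. ennreal ((L2_norm \<Omega> (\<lambda>x. w n x - w (r k) x))\<^sup>2) \<le> ennreal (e\<^sup>2)"
        by (meson L2_norm_nonneg ennreal_leI less_imp_le power_mono)
      then show "\<forall>\<^sub>F k in sequentially. ennreal ((L2_norm \<Omega> (\<lambda>x. w n x - w (r k) x))\<^sup>2) \<le> ennreal (e\<^sup>2)"
        by (auto simp: eventually_sequentially)
    qed simp
    finally have "(\<integral>\<^sup>+x. ennreal ((norm (w n x - v x))\<^sup>2) \<partial>?M) \<le> ennreal (e\<^sup>2)" .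
    then show ?thesis
      using L2_bounded_nn_integral[of "\<lambda>x. w n x - v x" \<Omega> e] \<open>e > 0\<close> by simp
  qed
  obtain N where "\<forall>m\<ge>N. \<forall>n\<ge>N. L2_norm \<Omega> (\<lambda>x. w m x - w n x) < 1"
    using Cauchy[of 1] by auto
  then have "(\<lambda>x. w N x - v x) \<in> L2 \<Omega>" using close[where e=1 and n=N and N=N] by simp
  then have "v \<in> L2 \<Omega>" using L2_diff[OF w, of "\<lambda>x. w N x - v x" N] by simp
  moreover have "(\<lambda>n. L2_norm \<Omega> (\<lambda>x. w n x - v x)) \<longlonglongrightarrow> 0"
  proof (rule LIMSEQ_I)
    fix e :: real assume "e > 0"
    then obtain N where "\<forall>m\<ge>N. \<forall>n\<ge>N. L2_norm \<Omega> (\<lambda>x. w m x - w n x) < e/2"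
      using Cauchy[of "e/2"] by auto
    then have "\<forall>n\<ge>N. L2_norm \<Omega> (\<lambda>x. w n x - v x) \<le> e/2"
      using close[where e="e/2" and N=N] \<open>e > 0\<close> by simp
    then show "\<exists>N. \<forall>n\<ge>N. norm (L2_norm \<Omega> (\<lambda>x. w n x - v x) - 0) < e"
      using \<open>e > 0\<close> by (intro exI[of _ N]) force
  qed
  ultimately show ?thesis using that by blast
qed

section \<open>Smooth functions\<close>

lemma partial_eq: "(\<phi> has_derivative D) (at x) \<Longrightarrow> partial i \<phi> x = D (axis i 1)"
  unfolding partial_def using frechet_derivative_at by metis

lemma Ck_continuous: "Ck k \<phi> \<Longrightarrow> continuous_on UNIV \<phi>"
  by (cases k) (auto simp: continuous_at_imp_continuous_on differentiable_imp_continuous_within)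

text \<open>\<open>Ck (Suc k)\<close> speaks about partial derivatives only, so even lowering the
  order takes an induction; its base is that differentiability implies continuity.\<close>

lemma Ck_SucD: "Ck (Suc k) \<phi> \<Longrightarrow> Ck k \<phi>"
proof (induction k arbitrary: \<phi>)
  case 0
  then show ?case using Ck_continuous by (metis Ck.simps(1))
next
  case (Suc k)
  then show ?case by (metis Ck.simps(2))
qed

lemma Ck_const: "Ck k (\<lambda>x. c)"
proof (induction k arbitrary: c)
  case (Suc k)
  have "partial i (\<lambda>x. c) = (\<lambda>x. 0)" for i :: 'a
    by (rule ext) (simp add: partial_eq[OF has_derivative_const])
  then show ?case using Suc by simp
qed simp

lemma Ck_add: "Ck k \<phi> \<Longrightarrow> Ck k \<psi> \<Longrightarrow> Ck k (\<lambda>x. \<phi> x + \<psi> x)"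
proof (induction k arbitrary: \<phi> \<psi>)
  case 0
  then show ?case by (simp add: continuous_on_add)
next
  case (Suc k)
  then have d: "\<phi> differentiable (at x)" "\<psi> differentiable (at x)" for x by auto
  have "partial i (\<lambda>x. \<phi> x + \<psi> x) = (\<lambda>x. partial i \<phi> x + partial i \<psi> x)" for i
  proof
    fix x
    show "partial i (\<lambda>x. \<phi> x + \<psi> x) x = partial i \<phi> x + partial i \<psi> x"
      using partial_eq[OF has_derivative_add[OF d(1)[of x, unfolded frechet_derivative_works]
          d(2)[of x, unfolded frechet_derivative_works]]]
      by (simp add: partial_def)
  qed
  then show ?case using Suc by (auto intro: differentiable_add)
qed

lemma partial_mult:
  assumes "\<phi> differentiable (at x)" "\<psi> differentiable (at x)"
  shows "partial i (\<lambda>x. \<phi> x * \<psi> x) x = \<phi> x * partial i \<psi> x + partial i \<phi> x * \<psi> x"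
  using partial_eq[OF has_derivative_mult[OF assms[unfolded frechet_derivative_works]]]
  by (simp add: partial_def)

lemma Ck_mult: "Ck k \<phi> \<Longrightarrow> Ck k \<psi> \<Longrightarrow> Ck k (\<lambda>x. \<phi> x * \<psi> x)"
proof (induction k arbitrary: \<phi> \<psi>)
  case 0
  then show ?case by (simp add: continuous_on_mult)
next
  case (Suc k)
  then have d: "\<phi> differentiable (at x)" "\<psi> differentiable (at x)" for x by auto
  \<comment> \<open>The product rule leaves one factor undifferentiated, so both functions are also
    needed at the lower order.\<close>
  have "Ck k \<phi>" "Ck k \<psi>" using Suc.prems Ck_SucD by blast+
  then have "Ck k (\<lambda>x. \<phi> x * partial i \<psi> x + partial i \<phi> x * \<psi> x)" for i
    using Suc by (intro Ck_add) auto
  moreover have "partial i (\<lambda>x. \<phi> x * \<psi> x) = (\<lambda>x. \<phi> x * partial i \<psi> x + partial i \<phi> x * \<psi> x)" for i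
    using partial_mult[OF d] by blast
  ultimately show ?case using Suc by (auto intro: differentiable_mult)
qed

lemma Ck_prod: "finite I \<Longrightarrow> (\<And>i. i \<in> I \<Longrightarrow> Ck k (\<phi> i)) \<Longrightarrow> Ck k (\<lambda>x. \<Prod>i\<in>I. \<phi> i x)"
  by (induction I rule: finite_induct) (auto intro: Ck_const Ck_mult)

section \<open>Flat functions and smooth bumps on boxes\<close>

text \<open>This class of functions of one variable is closed under differentiation and vanishes to
  infinite order at 0. The parameter \<open>c\<close> is kept because \<open>exp (- c / t)\<close> tends to 1 as \<open>c\<close> tends to 0,
  so that products of such functions approximate indicators of boxes.\<close>

definition flat :: "real \<Rightarrow> real poly \<Rightarrow> real \<Rightarrow> real" where
  "flat c p t = (if t \<le> 0 then 0 else poly p (1 / t) * exp (- c / t))"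

text \<open>The substitution \<open>s = 1 / t\<close> turns the right-hand limit of
  \<open>flat c p\<close> at 0 into this limit at infinity.\<close>

lemma poly_times_exp_tendsto_0:
  fixes c :: real
  assumes "c > 0"
  shows "((\<lambda>s. poly p s * exp (- c * s)) \<longlongrightarrow> 0) at_top"
proof -
  have "((\<lambda>s. (\<Sum>i\<le>degree p. coeff p i * (s ^ i * exp (- c * s)))) \<longlongrightarrow> (\<Sum>i\<le>degree p. coeff p i * 0)) at_top"
  proof (intro tendsto_intros)
    fix i
    have "((\<lambda>s. (1 / c) ^ i * ((c * s) ^ i / exp (c * s))) \<longlongrightarrow> (1 / c) ^ i * 0) at_top"
      by (intro tendsto_mult tendsto_const filterlim_compose[OF tendsto_power_div_exp_0]
          filterlim_tendsto_pos_mult_at_top[OF tendsto_const assms filterlim_ident])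
    moreover have "(\<lambda>s. (1 / c) ^ i * ((c * s) ^ i / exp (c * s))) = (\<lambda>s. s ^ i * exp (- c * s))"
      using assms by (auto simp: power_mult_distrib exp_minus field_simps)
    ultimately show "((\<lambda>s. s ^ i * exp (- c * s)) \<longlongrightarrow> 0) at_top" by simp
  qed
  then show ?thesis by (simp add: poly_altdef sum_distrib_right mult.assoc)
qed

text \<open>Differentiating with respect to \<open>t\<close> produces the factor
  \<open>1 / t\<^sup>2\<close>, which is the polynomial \<open>[:0, 0, 1:]\<close> at
  \<open>1 / t\<close>; the exponential contributes \<open>smult c p\<close> and the inner function
  \<open>1 / t\<close> contributes \<open>- pderiv p\<close>.\<close>

lemma flat_deriv:
  assumes "c > 0"
  shows "(flat c p has_real_derivative flat c ([:0, 0, 1:] * (smult c p - pderiv p)) t) (at t)"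
proof -
  consider "t > 0" | "t < 0" | "t = 0" by linarith
  then show ?thesis
  proof cases
    case 1
    have "((\<lambda>t. poly p (1 / t) * exp (- c / t)) has_real_derivative
        flat c ([:0, 0, 1:] * (smult c p - pderiv p)) t) (at t)"
      using 1 by (auto intro!: derivative_eq_intros simp: flat_def field_simps power2_eq_square)
    then show ?thesis
      by (rule DERIV_cong_ev[THEN iffD1, rotated -1])
        (use 1 in \<open>auto simp: flat_def eventually_at_filter intro!: eventually_mono[OF eventually_nhds_in_open[of "{0<..}"]]\<close>)
  next
    case 2
    have "((\<lambda>t. 0) has_real_derivative flat c ([:0, 0, 1:] * (smult c p - pderiv p)) t) (at t)"
      using 2 by (simp add: flat_def)
    then show ?thesis
      by (rule DERIV_cong_ev[THEN iffD1, rotated -1])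
        (use 2 in \<open>auto simp: flat_def intro!: eventually_mono[OF eventually_nhds_in_open[of "{..<0}"]]\<close>)
  next
    case 3
    have "((\<lambda>h. (flat c p (0 + h) - flat c p 0) / h) \<longlongrightarrow> 0) (at 0)"
    proof (rule filterlim_split_at)
      show "((\<lambda>h. (flat c p (0 + h) - flat c p 0) / h) \<longlongrightarrow> 0) (at_left 0)"
        by (rule tendsto_eventually) (auto simp: flat_def eventually_at_filter)
      \<comment> \<open>Dividing by \<open>h\<close> multiplies by \<open>1 / h\<close>, and
        \<open>pCons 0 p\<close> absorbs this factor into the polynomial.\<close>
      have "((\<lambda>h. poly (pCons 0 p) (inverse h) * exp (- c * inverse h)) \<longlongrightarrow> 0) (at_right 0)"
        by (rule filterlim_compose[OF poly_times_exp_tendsto_0[OF assms] filterlim_inverse_at_top_right])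
      then show "((\<lambda>h. (flat c p (0 + h) - flat c p 0) / h) \<longlongrightarrow> 0) (at_right 0)"
        by (rule tendsto_cong[THEN iffD1, rotated]) (auto simp: flat_def eventually_at_filter field_simps)
    qed
    then show ?thesis using 3 by (simp add: DERIV_def flat_def)
  qed
qed

text \<open>The induction runs over all polynomials at once: a partial derivative in direction
  \<open>i\<close> is again of this form, and in any other direction it is the one with polynomial
  0.\<close>

lemma Ck_flat_coordinate:
  assumes "c > 0"
  shows "Ck k (\<lambda>x. flat c p (s * x $ i + a))"
proof (induction k arbitrary: p)
  case 0
  have "continuous_on UNIV (flat c p)"
    by (meson DERIV_continuous_on flat_deriv[OF assms] has_field_derivative_at_within)
  then show ?case
    by (auto intro!: continuous_on_compose2[of UNIV "flat c p"] continuous_intros)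
next
  case (Suc k)
  let ?q = "[:0, 0, 1:] * (smult c p - pderiv p)"
  have d: "((\<lambda>x. flat c p (s * x $ i + a)) has_derivative
      (\<lambda>h. flat c ?q (s * x $ i + a) * (s * h $ i))) (at x)" for x
  proof -
    have "((\<lambda>x. s * x $ i + a) has_derivative (\<lambda>h. s * h $ i)) (at x)"
      by (auto intro!: derivative_eq_intros bounded_linear_imp_has_derivative)
    from has_derivative_compose[OF this flat_deriv[OF assms, unfolded has_field_derivative_def]]
    show ?thesis by simp
  qed
  have "partial j (\<lambda>x. flat c p (s * x $ i + a))
      = (\<lambda>x. flat c (if i = j then smult s ?q else 0) (s * x $ i + a))" for j
    by (rule ext, subst partial_eq[OF d]) (auto simp: axis_def flat_def)
  then show ?case using Suc d by (auto simp: differentiable_def)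
qed

text \<open>The factors are written in the shape \<open>s * x $ i + a\<close> to which \<open>Ck_flat_coordinate\<close> applies.\<close>

definition box_bump :: "real ^ 'd \<Rightarrow> real ^ 'd \<Rightarrow> real \<Rightarrow> real ^ 'd \<Rightarrow> real" where
  "box_bump a b c x = (\<Prod>i\<in>UNIV. flat c 1 (1 * x $ i + (- a $ i)) * flat c 1 ((-1) * x $ i + b $ i))"

lemma box_bump_zero: "x \<notin> box a b \<Longrightarrow> box_bump a b c x = 0"
  unfolding box_bump_def mem_box_cart by (auto simp: flat_def not_less)

lemma box_bump_bounds: "c > 0 \<Longrightarrow> 0 \<le> box_bump a b c x \<and> box_bump a b c x \<le> 1"
  unfolding box_bump_def
  by (intro conjI prod_nonneg prod_le_1 ballI mult_le_one mult_nonneg_nonneg) (auto simp: flat_def)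

lemma test_function_box_bump:
  assumes "c > 0" "cbox a b \<subseteq> \<Omega>"
  shows "test_function \<Omega> (box_bump a b c)"
proof -
  have "Ck k (box_bump a b c)" for k
    unfolding box_bump_def[abs_def] by (intro Ck_prod Ck_mult Ck_flat_coordinate assms finite)
  moreover have sub: "closure {x. box_bump a b c x \<noteq> 0} \<subseteq> cbox a b"
    using box_bump_zero[of _ a b c] box_subset_cbox[of a b]
    by (intro closure_minimal) auto
  moreover have "compact (closure {x. box_bump a b c x \<noteq> 0})"
    using sub bounded_subset[OF bounded_cbox] by (auto simp: compact_eq_bounded_closed)
  ultimately show ?thesis using assms(2) unfolding test_function_def by blast
qed

lemma box_bump_tendsto_indicator:
  "(\<lambda>n. box_bump a b (1 / real (Suc n)) x) \<longlonglongrightarrow> indicator (box a b) x"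
proof (cases "x \<in> box a b")
  case True
  have "(\<lambda>n. flat (1 / real (Suc n)) 1 t) \<longlonglongrightarrow> 1" if "t > 0" for t
  proof -
    have "(\<lambda>n. exp (- (1 / real (Suc n)) / t)) \<longlonglongrightarrow> exp (- 0 / t)"
      by (intro tendsto_intros LIMSEQ_Suc[OF lim_1_over_n]) (use that in auto)
    then show ?thesis using that by (simp add: flat_def)
  qed
  then have "(\<lambda>n. box_bump a b (1 / real (Suc n)) x) \<longlonglongrightarrow> (\<Prod>i\<in>(UNIV::'a set). 1 * 1)"
    unfolding box_bump_def by (intro tendsto_prod tendsto_mult) (use True in \<open>auto simp: mem_box_cart\<close>)
  then show ?thesis using True by simp
qed (simp add: box_bump_zero)

section \<open>Weak gradients\<close>

lemma indicator_L2:
  assumes "A \<in> lmeasurable" "\<Omega> \<in> sets lebesgue"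
  shows "indicator A \<in> (L2 \<Omega> :: (real ^ 'd \<Rightarrow> real) set)"
proof -
  have "integrable lebesgue (\<lambda>x. indicator \<Omega> x *\<^sub>R (indicator A x :: real))"
    by (rule integrable_mult_indicator) (use assms in \<open>auto simp: lmeasurable_iff_integrable\<close>)
  then have "integrable (lebesgue_on \<Omega>) (indicator A :: _ \<Rightarrow> real)"
    using assms(2) by (simp add: integrable_restrict_space)
  moreover have "(\<lambda>x. (norm (indicator A x :: real))\<^sup>2) = indicator A" by (auto simp: indicator_def)
  ultimately show ?thesis by (simp add: L2_def borel_measurable_integrable)
qed

lemma L2_continuous_compact_support:
  fixes \<phi> :: "real ^ 'd \<Rightarrow> 'b::euclidean_space"
  assumes "\<Omega> \<in> sets lebesgue" "continuous_on UNIV \<phi>" "bounded {x. \<phi> x \<noteq> 0}"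
  shows "\<phi> \<in> L2 \<Omega>"
proof -
  obtain c where c: "{x. \<phi> x \<noteq> 0} \<subseteq> cball 0 c"
    using assms(3) unfolding bounded_iff subset_iff mem_cball_0 by blast
  have "compact (\<phi> ` cball 0 c)"
    by (rule compact_continuous_image[OF continuous_on_subset[OF assms(2)]]) auto
  then obtain B where "\<forall>y\<in>\<phi> ` cball 0 c. norm y \<le> B"
    using compact_imp_bounded bounded_iff by blast
  then have B: "norm (\<phi> x) \<le> B" if "x \<in> cball 0 c" for x
    using that by blast
  have "norm (\<phi> x) \<le> norm (B * indicator (cball 0 c) x :: real)" for x
    using c B[of x] by (cases "x \<in> cball 0 c") auto
  moreover have "\<phi> \<in> borel_measurable (lebesgue_on \<Omega>)"
    by (rule continuous_imp_measurable_on_sets_lebesgue[OF continuous_on_subset[OF assms(2)] assms(1)]) simp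
  moreover have "(\<lambda>x. B * indicator (cball 0 c) x) \<in> L2 \<Omega>"
    by (rule L2_mult[OF indicator_L2[OF lmeasurable_cball assms(1)]])
  ultimately show ?thesis by (intro L2_norm_mono(1)[of \<phi> \<Omega> "\<lambda>x. B * indicator (cball 0 c) x"]) auto
qed

section \<open>The fundamental lemma of the calculus of variations\<close>

text \<open>The bumps lie below the indicator of the box and tend to it as their parameter tends to
  0, so dominated convergence passes from test functions to boxes.\<close>

lemma set_integral_box_eq_0:
  fixes g :: "real ^ 'd \<Rightarrow> real"
  assumes \<Omega>: "\<Omega> \<in> sets lebesgue" and g: "g \<in> L2 \<Omega>"
    and zero: "\<And>\<phi>. test_function \<Omega> \<phi> \<Longrightarrow> (LINT x|lebesgue_on \<Omega>. g x * \<phi> x) = 0"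
    and ab: "cbox a b \<subseteq> \<Omega>"
  shows "(LINT x|lebesgue_on \<Omega>. g x * indicator (box a b) x) = 0"
proof -
  have ind: "(indicator (box a b) :: _ \<Rightarrow> real) \<in> L2 \<Omega>"
    by (intro indicator_L2 \<Omega> lmeasurable_box)
  have "(\<lambda>n. LINT x|lebesgue_on \<Omega>. g x * box_bump a b (1 / real (Suc n)) x)
      \<longlonglongrightarrow> (LINT x|lebesgue_on \<Omega>. g x * indicator (box a b) x)"
  proof (rule integral_dominated_convergence)
    show "integrable (lebesgue_on \<Omega>) (\<lambda>x. \<bar>g x * indicator (box a b) x\<bar>)"
      using L2_mult_integrable[OF g ind] by (rule integrable_abs)
    show "(\<lambda>x. g x * indicator (box a b) x) \<in> borel_measurable (lebesgue_on \<Omega>)"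
      using L2_mult_integrable[OF g ind] by (rule borel_measurable_integrable)
    show "(\<lambda>x. g x * box_bump a b (1 / real (Suc n)) x) \<in> borel_measurable (lebesgue_on \<Omega>)" for n
    proof -
      have "continuous_on UNIV (box_bump a b (1 / real (Suc n)))"
        using test_function_box_bump[OF _ ab, of "1 / real (Suc n)"] Ck_continuous
        unfolding test_function_def by auto
      then have "box_bump a b (1 / real (Suc n)) \<in> borel_measurable (lebesgue_on \<Omega>)"
        using continuous_imp_measurable_on_sets_lebesgue[OF continuous_on_subset \<Omega>] by blast
      then show ?thesis using L2_measurable[OF g] by simp
    qed
    show "AE x in lebesgue_on \<Omega>. (\<lambda>n. g x * box_bump a b (1 / real (Suc n)) x) \<longlonglongrightarrow> g x * indicator (box a b) x"
      by (intro always_eventually allI tendsto_intros box_bump_tendsto_indicator)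
    show "AE x in lebesgue_on \<Omega>. norm (g x * box_bump a b (1 / real (Suc n)) x) \<le> \<bar>g x * indicator (box a b) x\<bar>" for n
    proof (intro always_eventually allI)
      fix x
      show "norm (g x * box_bump a b (1 / real (Suc n)) x) \<le> \<bar>g x * indicator (box a b) x\<bar>"
        using box_bump_bounds[of "1 / real (Suc n)" a b x] box_bump_zero[of x a b]
        by (cases "x \<in> box a b") (auto simp: abs_mult intro: mult_left_le)
    qed
  qed
  moreover have "(LINT x|lebesgue_on \<Omega>. g x * box_bump a b (1 / real (Suc n)) x) = 0" for n
    by (intro zero test_function_box_bump ab) simp
  ultimately show ?thesis by (simp add: LIMSEQ_const_iff)
qed

text \<open>Lebesgue differentiation recovers a function almost everywhere from its averages over
  shrinking cubes, and here all of these vanish.\<close>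

lemma negligible_on_cbox:
  fixes g :: "real ^ 'd \<Rightarrow> real"
  assumes \<Omega>: "\<Omega> \<in> sets lebesgue" and g: "g \<in> L2 \<Omega>"
    and zero: "\<And>c d. cbox c d \<subseteq> \<Omega> \<Longrightarrow> (LINT x|lebesgue_on \<Omega>. g x * indicator (box c d) x) = 0"
    and ab: "cbox a b \<subseteq> \<Omega>"
  shows "negligible {x \<in> cbox a b. g x \<noteq> 0}"
proof -
  \<comment> \<open>The truncation lets the cubes of the differentiation theorem leave \<Omega>:
    each meets the fixed box in a box whose closed version lies in \<Omega>, where
    \<open>zero\<close> applies.\<close>
  define f where "f = (\<lambda>x. if x \<in> box a b then g x else 0)"
  have box_int: "integral (box c d) g = 0 \<and> integrable lebesgue (\<lambda>x. if x \<in> box c d then g x else 0)"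
    if "cbox c d \<subseteq> \<Omega>" for c d
  proof -
    have "integrable (lebesgue_on \<Omega>) (\<lambda>x. g x * indicator (box c d) x)"
      by (intro L2_mult_integrable[OF g indicator_L2] \<Omega> lmeasurable_box)
    then have *: "integrable (lebesgue_on \<Omega>) (\<lambda>x. if x \<in> box c d then g x else 0)"
      by (rule Bochner_Integration.integrable_cong[THEN iffD1, rotated 2]) auto
    have sub: "box c d \<inter> \<Omega> = box c d" using that box_subset_cbox by blast
    have "(LINT x|lebesgue_on \<Omega>. g x * indicator (box c d) x)
        = (LINT x|lebesgue_on \<Omega>. (if x \<in> box c d then g x else 0))"
      by (rule Bochner_Integration.integral_cong) auto
    also have "\<dots> = integral \<Omega> (\<lambda>x. if x \<in> box c d then g x else 0)"
      by (rule lebesgue_integral_eq_integral[OF * \<Omega>])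
    also have "\<dots> = integral (box c d) g"
      by (simp add: Henstock_Kurzweil_Integration.integral_restrict_Int sub)
    finally have "integral (box c d) g = 0" using zero[OF that] by simp
    moreover have "integrable lebesgue (\<lambda>x. indicator \<Omega> x *\<^sub>R (if x \<in> box c d then g x else 0))"
      using * \<Omega> by (simp add: integrable_restrict_space)
    then have "integrable lebesgue (\<lambda>x. if x \<in> box c d then g x else 0)"
      by (rule Bochner_Integration.integrable_cong[THEN iffD1, rotated 2])
        (use sub in \<open>auto simp: indicator_def\<close>)
    ultimately show ?thesis by blast
  qed
  have "f integrable_on UNIV"
    unfolding f_def using box_int[OF ab] by (intro integrable_on_lebesgue) simp
  then have int: "f integrable_on cbox c d" for c d
    by (rule integrable_on_subcbox) simp
  have int0: "integral (cbox c d) f = 0" for c d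
  proof -
    obtain p q where pq: "cbox c d \<inter> cbox a b = cbox p q" "box c d \<inter> box a b = box p q"
      by (rule that[OF Int_interval box_Int_box])
    have "integral (cbox c d) f = integral (box c d) f" by (simp add: integral_open_interval)
    also have "\<dots> = integral (box p q) g"
      unfolding f_def by (simp add: Henstock_Kurzweil_Integration.integral_restrict_Int pq(2)[symmetric] Int_commute)
    also have "\<dots> = 0" using box_int[of p q] pq(1) ab by blast
    finally show ?thesis .
  qed
  obtain N where N: "negligible N"
    "\<And>x e. x \<notin> N \<Longrightarrow> 0 < e \<Longrightarrow> \<exists>d>0. \<forall>h. 0 < h \<and> h < d \<longrightarrow>
        norm (integral (cbox x (x + h *\<^sub>R One)) f /\<^sub>R h ^ DIM(real ^ 'd) - f x) < e"
    by (rule integrable_ccontinuous_explicit[OF int], rule that) assumption+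
  have f0: "f x = 0" if x: "x \<notin> N" for x
  proof (rule ccontr)
    assume "f x \<noteq> 0"
    \<comment> \<open>With vanishing averages, the tolerance \<open>\<bar>f x\<bar>\<close> would
      demand \<open>\<bar>f x\<bar> < \<bar>f x\<bar>\<close> for every small positive
      \<open>h\<close>, so no such \<open>h\<close> could exist.\<close>
    then have "\<exists>d>0. \<forall>h. 0 < h \<longrightarrow> \<not> h < (d::real)"
      using N(2)[OF x, of "\<bar>f x\<bar>"] by (simp add: int0)
    then show False using dense by blast
  qed
  have "g x = 0" if "x \<notin> N" "x \<in> box a b" for x
    using f0[OF that(1)] that(2) by (simp add: f_def)
  then have "{x \<in> cbox a b. g x \<noteq> 0} \<subseteq> N \<union> (cbox a b - box a b)"
    by blast
  then show ?thesis
    by (rule negligible_subset[OF negligible_Un[OF N(1) negligible_frontier_interval]])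
qed

text \<open>An open set is a countable union of closed boxes, so the local result on one box
  suffices.\<close>

lemma fundamental_lemma_variations:
  fixes g :: "real ^ 'd \<Rightarrow> real"
  assumes "open \<Omega>" and g: "g \<in> L2 \<Omega>"
    and zero: "\<And>\<phi>. test_function \<Omega> \<phi> \<Longrightarrow> (LINT x|lebesgue_on \<Omega>. g x * \<phi> x) = 0"
  shows "AE x in lebesgue_on \<Omega>. g x = 0"
proof -
  have \<Omega>: "\<Omega> \<in> sets lebesgue" using \<open>open \<Omega>\<close> by simp
  obtain D where D: "countable D" "D \<subseteq> Pow \<Omega>" "\<And>X. X \<in> D \<Longrightarrow> \<exists>a b. X = cbox a b" "\<Union>D = \<Omega>"
    by (rule open_countable_Union_open_cbox[OF \<open>open \<Omega>\<close>], rule that) assumption+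
  have "negligible {x \<in> X. g x \<noteq> 0}" if "X \<in> D" for X
  proof -
    obtain a b where "X = cbox a b" using D(3)[OF \<open>X \<in> D\<close>] by blast
    then show ?thesis
      using negligible_on_cbox[OF \<Omega> g set_integral_box_eq_0[OF \<Omega> g zero]] D(2) that by blast
  qed
  then have "negligible (\<Union>X\<in>D. {x \<in> X. g x \<noteq> 0})"
    by (intro negligible_countable_Union) (use D(1) in auto)
  moreover have "(\<Union>X\<in>D. {x \<in> X. g x \<noteq> 0}) = {x \<in> \<Omega>. g x \<noteq> 0}" using D(4) by blast
  ultimately have "{x \<in> \<Omega>. g x \<noteq> 0} \<in> null_sets lebesgue" by (simp add: negligible_iff_null_sets)
  then have "AE x in lebesgue. x \<in> \<Omega> \<longrightarrow> g x = 0"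
    by (rule AE_I') auto
  then show ?thesis using \<Omega> by (simp add: AE_restrict_space_iff)
qed

lemma L2_component:
  fixes g :: "real ^ 'd \<Rightarrow> real ^ 'n"
  assumes "g \<in> L2 \<Omega>"
  shows "(\<lambda>x. g x $ i) \<in> L2 \<Omega>"
proof (rule L2_norm_mono(1)[OF _ assms])
  have "(\<lambda>x. g x \<bullet> axis i 1) \<in> borel_measurable (lebesgue_on \<Omega>)"
    by (intro borel_measurable_inner L2_measurable[OF assms] borel_measurable_const)
  then show "(\<lambda>x. g x $ i) \<in> borel_measurable (lebesgue_on \<Omega>)"
    by (simp add: inner_axis)
qed (simp add: component_le_norm_cart)

text \<open>Each component of the difference annihilates all test functions. This makes the choice
  in \<open>wgrad\<close> harmless: any weak gradient found by other means agrees with it almost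
  everywhere.\<close>

lemma weak_gradient_unique:
  assumes "open \<Omega>" and g: "g \<in> L2 \<Omega>" "h \<in> L2 \<Omega>"
    and w: "is_weak_gradient \<Omega> u g" "is_weak_gradient \<Omega> u h"
  shows "AE x in lebesgue_on \<Omega>. g x = h x"
proof -
  have \<Omega>: "\<Omega> \<in> sets lebesgue" using \<open>open \<Omega>\<close> by simp
  have "AE x in lebesgue_on \<Omega>. g x $ i - h x $ i = 0" for i
  proof (rule fundamental_lemma_variations[OF \<open>open \<Omega>\<close>])
    show "(\<lambda>x. g x $ i - h x $ i) \<in> L2 \<Omega>" by (intro L2_diff L2_component g)
    fix \<phi> assume \<phi>: "test_function \<Omega> \<phi>"
    have "\<phi> \<in> L2 \<Omega>"
      using \<phi> Ck_continuous unfolding test_function_def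
      by (intro L2_continuous_compact_support \<Omega>) (auto dest!: compact_imp_bounded intro: bounded_subset[OF _ closure_subset])
    then have "integrable (lebesgue_on \<Omega>) (\<lambda>x. g x $ i * \<phi> x)" "integrable (lebesgue_on \<Omega>) (\<lambda>x. h x $ i * \<phi> x)"
      by (intro L2_mult_integrable L2_component g; assumption)+
    then show "(LINT x|lebesgue_on \<Omega>. (g x $ i - h x $ i) * \<phi> x) = 0"
      using w \<phi> unfolding is_weak_gradient_def by (simp add: algebra_simps)
  qed
  then have "AE x in lebesgue_on \<Omega>. \<forall>i\<in>UNIV. g x $ i - h x $ i = 0"
    by (intro AE_finite_allI) auto
  then show ?thesis by (rule eventually_mono) (simp add: vec_eq_iff)
qed

section \<open>Test functions as elements of the Sobolev space\<close>

definition test_grad :: "(real ^ 'd \<Rightarrow> real) \<Rightarrow> real ^ 'd \<Rightarrow> real ^ 'd" where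
  "test_grad \<phi> x = (\<chi> i. partial i \<phi> x)"

lemma has_derivative_test_grad:
  assumes "\<phi> differentiable (at x)"
  shows "(\<phi> has_derivative (\<lambda>h. test_grad \<phi> x \<bullet> h)) (at x)"
proof -
  let ?D = "frechet_derivative \<phi> (at x)"
  have D: "(\<phi> has_derivative ?D) (at x)" using assms frechet_derivative_works by blast
  have lin: "linear ?D" using D has_derivative_linear by blast
  have "?D = (\<lambda>h. test_grad \<phi> x \<bullet> h)"
  proof
    fix h
    have "?D h = ?D (\<Sum>i\<in>UNIV. (h $ i) *\<^sub>R axis i 1)"
      using basis_expansion[of h] by (simp add: scalar_mult_eq_scaleR)
    also have "\<dots> = (\<Sum>i\<in>UNIV. h $ i * partial i \<phi> x)"
      by (simp add: linear_sum[OF lin] linear_scale[OF lin] partial_def)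
    finally show "?D h = test_grad \<phi> x \<bullet> h" by (simp add: inner_vec_def test_grad_def mult.commute)
  qed
  then show ?thesis using D by metis
qed

lemma partial_outside_closed:
  assumes "closed K" "\<And>y. y \<notin> K \<Longrightarrow> \<phi> y = 0" "x \<notin> K"
  shows "partial i \<phi> x = 0"
proof -
  have "(\<phi> has_derivative (\<lambda>h. 0)) (at x)"
    by (rule has_derivative_transform_within_open[OF has_derivative_const[of 0], where s = "- K"])
      (use assms in auto)
  from partial_eq[OF this] show ?thesis .
qed

lemma test_functionD:
  assumes "test_function \<Omega> \<phi>"
  shows "continuous_on UNIV \<phi>" "\<phi> differentiable (at x)" "continuous_on UNIV (partial i \<phi>)"
    "x \<notin> \<Omega> \<Longrightarrow> \<phi> x = 0" "x \<notin> \<Omega> \<Longrightarrow> partial i \<phi> x = 0"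
    "bounded {x. \<phi> x \<noteq> 0}" "bounded {x. partial i \<phi> x \<noteq> 0}" "Ck k \<phi>"
proof -
  let ?K = "closure {x. \<phi> x \<noteq> 0}"
  have C: "Ck 0 \<phi>" "Ck (Suc 0) \<phi>" and K: "compact ?K" "?K \<subseteq> \<Omega>"
    using assms unfolding test_function_def by blast+
  show "continuous_on UNIV \<phi>" "\<phi> differentiable (at x)" "continuous_on UNIV (partial i \<phi>)"
    using C by auto
  show "Ck k \<phi>" using assms unfolding test_function_def by blast
  have out: "\<phi> y = 0" if "y \<notin> ?K" for y using that closure_subset[of "{x. \<phi> x \<noteq> 0}"] by blast
  have outp: "partial i \<phi> y = 0" if "y \<notin> ?K" for y
    by (rule partial_outside_closed[OF closed_closure out that])
  show "x \<notin> \<Omega> \<Longrightarrow> \<phi> x = 0" "x \<notin> \<Omega> \<Longrightarrow> partial i \<phi> x = 0" using out outp K(2) by blast+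
  have "{x. \<phi> x \<noteq> 0} \<subseteq> ?K" "{x. partial i \<phi> x \<noteq> 0} \<subseteq> ?K" using out outp by blast+
  then show "bounded {x. \<phi> x \<noteq> 0}" "bounded {x. partial i \<phi> x \<noteq> 0}"
    using compact_imp_bounded[OF K(1)] bounded_subset by blast+
qed

lemma test_function_diff:
  assumes "test_function \<Omega> \<phi>" "test_function \<Omega> \<psi>"
  shows "test_function \<Omega> (\<lambda>x. \<phi> x - \<psi> x)"
proof -
  have "Ck k (\<lambda>x. \<phi> x + (-1) * \<psi> x)" for k
    by (intro Ck_add Ck_mult Ck_const test_functionD[OF assms(1)] test_functionD[OF assms(2)])
  then have "Ck k (\<lambda>x. \<phi> x - \<psi> x)" for k by simp
  moreover have "{x. \<phi> x - \<psi> x \<noteq> 0} \<subseteq> {x. \<phi> x \<noteq> 0} \<union> {x. \<psi> x \<noteq> 0}" by auto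
  then have sub: "closure {x. \<phi> x - \<psi> x \<noteq> 0} \<subseteq> closure {x. \<phi> x \<noteq> 0} \<union> closure {x. \<psi> x \<noteq> 0}"
    unfolding closure_Un[symmetric] by (rule closure_mono)
  have "compact (closure {x. \<phi> x \<noteq> 0} \<union> closure {x. \<psi> x \<noteq> 0})"
    using assms unfolding test_function_def by (intro compact_Un) blast+
  then have "compact (closure {x. \<phi> x - \<psi> x \<noteq> 0})"
    using bounded_subset[OF compact_imp_bounded sub] by (simp add: compact_eq_bounded_closed)
  moreover have "closure {x. \<phi> x - \<psi> x \<noteq> 0} \<subseteq> \<Omega>"
    using assms sub unfolding test_function_def by blast
  ultimately show ?thesis unfolding test_function_def by blast
qed

lemma test_function_L2:
  assumes "test_function \<Omega> \<phi>" "\<Omega> \<in> sets lebesgue"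
  shows "\<phi> \<in> L2 \<Omega>" "partial i \<phi> \<in> L2 \<Omega>"
  by (intro L2_continuous_compact_support assms test_functionD[OF assms(1)])+

lemma L2_vec:
  fixes g :: "real ^ 'd \<Rightarrow> real ^ 'n"
  assumes "\<And>i. (\<lambda>x. g x $ i) \<in> L2 \<Omega>"
  shows "g \<in> L2 \<Omega>"
proof (rule L2_dominated)
  have "(\<lambda>x. \<Sum>i\<in>UNIV. (g x $ i) *\<^sub>R axis i (1::real)) \<in> borel_measurable (lebesgue_on \<Omega>)"
    by (intro borel_measurable_sum borel_measurable_scaleR borel_measurable_const L2_measurable assms)
  then show "g \<in> borel_measurable (lebesgue_on \<Omega>)"
    using basis_expansion[of "g _"] by (simp add: scalar_mult_eq_scaleR)
  show "integrable (lebesgue_on \<Omega>) (\<lambda>x. \<Sum>i\<in>UNIV. (norm (g x $ i))\<^sup>2)"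
    by (intro Bochner_Integration.integrable_sum L2_integrable assms)
  show "AE x in lebesgue_on \<Omega>. (norm (g x))\<^sup>2 \<le> (\<Sum>i\<in>UNIV. (norm (g x $ i))\<^sup>2)"
    by (simp add: norm_vec_def L2_set_def sum_nonneg)
qed

lemma test_grad_L2: "test_function \<Omega> \<phi> \<Longrightarrow> \<Omega> \<in> sets lebesgue \<Longrightarrow> test_grad \<phi> \<in> L2 \<Omega>"
  by (rule L2_vec) (simp add: test_grad_def test_function_L2)

section \<open>Lebesgue measure on the whole space and integration by parts\<close>

text \<open>Translation invariance and Fubini are applied on \<open>lborel\<close>, so integrals
  over \<Omega> of functions vanishing outside it are moved there.\<close>

lemma integral_lebesgue_on_support:
  fixes g :: "real ^ 'd \<Rightarrow> 'b::euclidean_space"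
  assumes "g \<in> borel_measurable borel" "\<And>x. x \<notin> \<Omega> \<Longrightarrow> g x = 0" "\<Omega> \<in> sets lebesgue"
  shows "(LINT x|lebesgue_on \<Omega>. g x) = (LINT x|lborel. g x)"
proof -
  have "(LINT x|lebesgue_on \<Omega>. g x) = (LINT x|lebesgue. indicator \<Omega> x *\<^sub>R g x)"
    using assms(3) by (simp add: integral_restrict_space)
  also have "\<dots> = (LINT x|lebesgue. g x)"
    by (rule Bochner_Integration.integral_cong) (use assms(2) in \<open>auto simp: indicator_def\<close>)
  also have "\<dots> = (LINT x|lborel. g x)"
    using assms(1) by (intro integral_completion) simp
  finally show ?thesis .
qed

lemma nn_integral_lebesgue_on_support:
  fixes g :: "real ^ 'd \<Rightarrow> ennreal"
  assumes "g \<in> borel_measurable borel" "\<And>x. x \<notin> \<Omega> \<Longrightarrow> g x = 0" "\<Omega> \<in> sets lebesgue"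
  shows "(\<integral>\<^sup>+x. g x \<partial>lebesgue_on \<Omega>) = (\<integral>\<^sup>+x. g x \<partial>lborel)"
proof -
  have "(\<integral>\<^sup>+x. g x \<partial>lebesgue_on \<Omega>) = (\<integral>\<^sup>+x. g x * indicator \<Omega> x \<partial>lebesgue)"
    using assms(3) by (simp add: nn_integral_restrict_space)
  also have "\<dots> = (\<integral>\<^sup>+x. g x \<partial>lebesgue)"
    by (rule nn_integral_cong) (use assms(2) in \<open>auto simp: indicator_def\<close>)
  also have "\<dots> = (\<integral>\<^sup>+x. g x \<partial>lborel)"
    by (rule nn_integral_completion)
  finally show ?thesis .
qed

lemma continuous_compact_support_bounded:
  fixes \<phi> :: "'a::euclidean_space \<Rightarrow> real"
  assumes "continuous_on UNIV \<phi>" "bounded {x. \<phi> x \<noteq> 0}"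
  obtains c C where "c > 0" "C > 0" "\<And>x. \<phi> x \<noteq> 0 \<Longrightarrow> norm x \<le> c" "\<And>x. \<bar>\<phi> x\<bar> \<le> C"
proof -
  obtain c where c: "c > 0" "\<And>x. \<phi> x \<noteq> 0 \<Longrightarrow> norm x \<le> c"
    using assms(2) unfolding bounded_pos by blast
  have "compact (\<phi> ` cball 0 c)"
    by (rule compact_continuous_image[OF continuous_on_subset[OF assms(1)]]) auto
  then have "bounded (\<phi> ` cball 0 c)" by (rule compact_imp_bounded)
  then obtain C where C: "C > 0" "\<And>y. y \<in> \<phi> ` cball 0 c \<Longrightarrow> norm y \<le> C"
    unfolding bounded_pos by blast
  have "\<bar>\<phi> x\<bar> \<le> C" for x
  proof (cases "\<phi> x = 0")
    case False
    then show ?thesis using C(2)[of "\<phi> x"] c(2)[of x] by simp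
  qed (use C(1) in simp)
  then show ?thesis using that c C(1) by blast
qed

lemma integrable_continuous_compact_support:
  fixes \<phi> :: "'a::euclidean_space \<Rightarrow> real"
  assumes "continuous_on UNIV \<phi>" "bounded {x. \<phi> x \<noteq> 0}"
  shows "integrable lborel \<phi>"
proof -
  obtain c C where c: "c > 0" "C > 0" "\<And>x. \<phi> x \<noteq> 0 \<Longrightarrow> norm x \<le> c" "\<And>x. \<bar>\<phi> x\<bar> \<le> C"
    by (rule continuous_compact_support_bounded[OF assms]) blast
  have "integrable lborel (\<lambda>x. indicator (cball 0 c) x *\<^sub>R \<phi> x)"
    by (rule borel_integrable_compact) (auto intro: continuous_on_subset[OF assms(1)])
  moreover have "(\<lambda>x. indicator (cball 0 c) x *\<^sub>R \<phi> x) = \<phi>"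
    by (rule ext) (use c(3) in \<open>force simp: indicator_def\<close>)
  ultimately show ?thesis by simp
qed

lemma lborel_translate:
  fixes F :: "'a::euclidean_space \<Rightarrow> 'b::{banach, second_countable_topology}"
  assumes "F \<in> borel_measurable borel"
  shows "(LINT x|lborel. F (c + x)) = (LINT x|lborel. F x)"
    and "integrable lborel F \<Longrightarrow> integrable lborel (\<lambda>x. F (c + x))"
proof -
  have m: "(+) c \<in> measurable lborel borel" by simp
  show "(LINT x|lborel. F (c + x)) = (LINT x|lborel. F x)"
    using integral_distr[OF m assms] by (simp add: lborel_distr_plus)
  show "integrable lborel F \<Longrightarrow> integrable lborel (\<lambda>x. F (c + x))"
    using integrable_distr_eq[OF m assms] by (simp add: lborel_distr_plus)
qed

lemma nn_integral_lborel_translate: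
  fixes F :: "'a::euclidean_space \<Rightarrow> ennreal"
  assumes "F \<in> borel_measurable borel"
  shows "(\<integral>\<^sup>+x. F (c + x) \<partial>lborel) = (\<integral>\<^sup>+x. F x \<partial>lborel)"
  using nn_integral_distr[of "(+) c" lborel borel F] assms by (simp add: lborel_distr_plus)

lemma DERIV_along_line:
  assumes "\<And>x. F differentiable (at x)"
  shows "((\<lambda>t. F (x + t *\<^sub>R z)) has_real_derivative test_grad F (x + t *\<^sub>R z) \<bullet> z) (at t)"
proof -
  have "((\<lambda>t. x + t *\<^sub>R z) has_derivative (\<lambda>s. s *\<^sub>R z)) (at t)"
    by (auto intro!: derivative_eq_intros)
  from has_derivative_compose[OF this has_derivative_test_grad[OF assms]]
  show ?thesis by (simp add: has_field_derivative_def mult.commute[of _ "inner _ _"])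
qed

text \<open>By translation invariance the difference quotients of \<open>F\<close> have integral 0; they converge
  dominatedly to the partial derivative.\<close>

lemma integral_partial_eq_0:
  fixes F :: "real ^ 'd \<Rightarrow> real"
  assumes d: "\<And>x. F differentiable (at x)" and c: "continuous_on UNIV (partial i F)"
    and b: "bounded {x. F x \<noteq> 0}"
  shows "(LINT x|lborel. partial i F x) = 0"
proof -
  have cF: "continuous_on UNIV F"
    using d by (simp add: continuous_at_imp_continuous_on differentiable_imp_continuous_within)
  have bp: "bounded {x. partial i F x \<noteq> 0}"
  proof (rule bounded_subset[OF bounded_closure[OF b]])
    show "{x. partial i F x \<noteq> 0} \<subseteq> closure {x. F x \<noteq> 0}"
      using partial_outside_closed[OF closed_closure, of "{x. F x \<noteq> 0}" F]
        closure_subset[of "{x. F x \<noteq> 0}"] by blast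
  qed
  obtain r where r: "r > 0" "\<And>x. F x \<noteq> 0 \<Longrightarrow> norm x \<le> r"
    by (rule continuous_compact_support_bounded[OF cF b]) blast
  obtain C where C: "C > 0" "\<And>x. \<bar>partial i F x\<bar> \<le> C"
    by (rule continuous_compact_support_bounded[OF c bp]) blast
  define e where "e = (axis i 1 :: real ^ 'd)"
  define h where "h n = 1 / real (Suc n)" for n
  have h: "h n > 0" "h n \<le> 1" for n by (auto simp: h_def)
  have deriv: "((\<lambda>t. F (x + t *\<^sub>R e)) has_real_derivative partial i F (x + t *\<^sub>R e)) (at t)" for x t
    using DERIV_along_line[OF d, of x e t] by (simp add: e_def test_grad_def inner_axis)
  define D where "D n x = (F (h n *\<^sub>R e + x) - F x) / h n" for n x
  have [measurable]: "F \<in> borel_measurable borel" by (rule borel_measurable_continuous_onI[OF cF])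
  have intF: "integrable lborel F" by (rule integrable_continuous_compact_support[OF cF b])
  have D0: "(LINT x|lborel. D n x) = 0" for n
    unfolding D_def using lborel_translate[of F "h n *\<^sub>R e"] intF by simp
  have "(\<lambda>n. LINT x|lborel. D n x) \<longlonglongrightarrow> (LINT x|lborel. partial i F x)"
  \<comment> \<open>By the mean value theorem a difference quotient is a value of the partial
    derivative, hence at most \<open>C\<close>. Shifts have length at most 1, so its support stays
    in the ball of radius \<open>r + 1\<close>.\<close>
  proof (rule integral_dominated_convergence[where w = "\<lambda>x. C * indicator (cball 0 (r + 1)) x"])
    show "partial i F \<in> borel_measurable lborel"
      using borel_measurable_continuous_onI[OF c] by simp
    show "D n \<in> borel_measurable lborel" for n unfolding D_def by measurable
    show "integrable lborel (\<lambda>x::real^'d. C * indicator (cball 0 (r + 1)) x)"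
      using emeasure_bounded_finite[OF bounded_cball[of "0::real^'d" "r + 1"]] by (simp add: top.not_eq_extremum)
    show "AE x in lborel. (\<lambda>n. D n x) \<longlonglongrightarrow> partial i F x"
    proof (intro always_eventually allI)
      fix x
      have "((\<lambda>k. (F (x + (0 + k) *\<^sub>R e) - F (x + 0 *\<^sub>R e)) / k) \<longlongrightarrow> partial i F x) (at 0)"
        using deriv[of x 0] unfolding DERIV_def by simp
      moreover have "filterlim h (at 0) sequentially"
        unfolding filterlim_at h_def using LIMSEQ_Suc[OF lim_1_over_n] by auto
      ultimately have "(\<lambda>n. (F (x + (0 + h n) *\<^sub>R e) - F (x + 0 *\<^sub>R e)) / h n) \<longlonglongrightarrow> partial i F x"
        by (rule filterlim_compose)
      then show "(\<lambda>n. D n x) \<longlonglongrightarrow> partial i F x" by (simp add: D_def add.commute)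
    qed
    show "AE x in lborel. norm (D n x) \<le> C * indicator (cball 0 (r + 1)) x" for n
    proof (intro always_eventually allI)
      fix x
      obtain t where "F (x + h n *\<^sub>R e) - F (x + 0 *\<^sub>R e) = (h n - 0) * partial i F (x + t *\<^sub>R e)"
        using MVT2[OF h(1) deriv, of n x] by blast
      then have "D n x = partial i F (x + t *\<^sub>R e)" using h(1)[of n] by (simp add: D_def add.commute)
      then have le: "norm (D n x) \<le> C" using C(2) by simp
      show "norm (D n x) \<le> C * indicator (cball 0 (r + 1)) x"
      proof (cases "x \<in> cball 0 (r + 1)")
        case False
        have "norm x \<le> norm (h n *\<^sub>R e + x) + norm (h n *\<^sub>R e)"
          using norm_triangle_ineq4[of "h n *\<^sub>R e + x" "h n *\<^sub>R e"] by simp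
        also have "norm (h n *\<^sub>R e) \<le> 1" using h[of n] by (simp add: e_def)
        finally have "F (h n *\<^sub>R e + x) = 0 \<and> F x = 0" using False r by force
        then show ?thesis by (simp add: D_def C less_imp_le)
      qed (use le in simp)
    qed
  qed
  then show ?thesis unfolding D0 by (simp add: LIMSEQ_const_iff)
qed

text \<open>Integration by parts: the product of the two test functions has compact support, so the
  integral of its partial derivative is 0.\<close>

lemma is_weak_gradient_test_grad:
  assumes "\<Omega> \<in> sets lebesgue" and \<phi>: "test_function \<Omega> \<phi>"
  shows "is_weak_gradient \<Omega> \<phi> (test_grad \<phi>)"
  unfolding is_weak_gradient_def
proof (intro allI impI)
  fix \<psi> i assume \<psi>: "test_function \<Omega> \<psi>"
  note [continuous_intros] = test_functionD(1,3)[OF \<phi>] test_functionD(1,3)[OF \<psi>]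
  have c: "continuous_on UNIV (\<lambda>x. \<phi> x * partial i \<psi> x)" "continuous_on UNIV (\<lambda>x. partial i \<phi> x * \<psi> x)"
    by (intro continuous_intros)+
  have "integrable lborel (\<lambda>x. \<phi> x * partial i \<psi> x)" "integrable lborel (\<lambda>x. partial i \<phi> x * \<psi> x)"
    by (intro integrable_continuous_compact_support c, rule bounded_subset[OF test_functionD(6)[OF \<phi>]], force)
      (intro integrable_continuous_compact_support c, rule bounded_subset[OF test_functionD(6)[OF \<psi>]], force)
  moreover have "partial i (\<lambda>x. \<phi> x * \<psi> x) = (\<lambda>x. \<phi> x * partial i \<psi> x + partial i \<phi> x * \<psi> x)"
    by (rule ext, rule partial_mult[OF test_functionD(2)[OF \<phi>] test_functionD(2)[OF \<psi>]])
  moreover have "(LINT x|lborel. partial i (\<lambda>x. \<phi> x * \<psi> x) x) = 0"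
  proof (rule integral_partial_eq_0)
    show "(\<lambda>x. \<phi> x * \<psi> x) differentiable (at x)" for x
      using test_functionD(2)[OF \<phi>] test_functionD(2)[OF \<psi>] by (rule differentiable_mult)
    show "bounded {x. \<phi> x * \<psi> x \<noteq> 0}" by (rule bounded_subset[OF test_functionD(6)[OF \<phi>]]) auto
    show "continuous_on UNIV (partial i (\<lambda>x. \<phi> x * \<psi> x))"
      unfolding calculation(3) by (intro continuous_on_add c)
  qed
  ultimately have "(LINT x|lborel. \<phi> x * partial i \<psi> x) + (LINT x|lborel. partial i \<phi> x * \<psi> x) = 0"
    by simp
  moreover have "(LINT x|lebesgue_on \<Omega>. \<phi> x * partial i \<psi> x) = (LINT x|lborel. \<phi> x * partial i \<psi> x)"
    by (rule integral_lebesgue_on_support[OF borel_measurable_continuous_onI[OF c(1)] _ assms(1)])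
      (simp add: test_functionD(4)[OF \<phi>])
  moreover have "(LINT x|lebesgue_on \<Omega>. partial i \<phi> x * \<psi> x) = (LINT x|lborel. partial i \<phi> x * \<psi> x)"
    by (rule integral_lebesgue_on_support[OF borel_measurable_continuous_onI[OF c(2)] _ assms(1)])
      (simp add: test_functionD(4)[OF \<psi>])
  ultimately show "(LINT x|lebesgue_on \<Omega>. \<phi> x * partial i \<psi> x) = - (LINT x|lebesgue_on \<Omega>. test_grad \<phi> x $ i * \<psi> x)"
    by (simp add: test_grad_def)
qed

section \<open>The spaces H1 and H10\<close>

lemma L2_Pair:
  assumes "u \<in> L2 \<Omega>" "g \<in> L2 \<Omega>"
  shows "(\<lambda>x. (u x, g x)) \<in> L2 \<Omega>"
    "(L2_norm \<Omega> (\<lambda>x. (u x, g x)))\<^sup>2 = (L2_norm \<Omega> u)\<^sup>2 + (L2_norm \<Omega> g)\<^sup>2"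
proof -
  have *: "(norm (u x, g x))\<^sup>2 = (norm (u x))\<^sup>2 + (norm (g x))\<^sup>2" for x by (simp add: norm_Pair)
  show "(\<lambda>x. (u x, g x)) \<in> L2 \<Omega>"
    using borel_measurable_Pair[OF assms[THEN L2_measurable]] assms[THEN L2_integrable]
    by (simp add: L2_def *)
  show "(L2_norm \<Omega> (\<lambda>x. (u x, g x)))\<^sup>2 = (L2_norm \<Omega> u)\<^sup>2 + (L2_norm \<Omega> g)\<^sup>2"
    unfolding L2_norm_power2 * by (simp add: L2_integrable assms)
qed

lemma L2_fst_snd:
  fixes w :: "real ^ 'd \<Rightarrow> 'b::euclidean_space \<times> 'c::euclidean_space"
  assumes w: "w \<in> L2 \<Omega>"
  shows "(\<lambda>x. fst (w x)) \<in> L2 \<Omega>" "(\<lambda>x. snd (w x)) \<in> L2 \<Omega>"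
proof -
  have le: "norm (fst p) \<le> norm p" "norm (snd p) \<le> norm p" for p :: "'b \<times> 'c"
    using norm_fst_le[of "fst p" "snd p"] norm_snd_le[of "snd p" "fst p"] by simp_all
  have m: "w \<in> borel_measurable (lebesgue_on \<Omega>)" using w by (rule L2_measurable)
  have "(\<lambda>x. fst (w x)) \<in> borel_measurable (lebesgue_on \<Omega>)" "(\<lambda>x. snd (w x)) \<in> borel_measurable (lebesgue_on \<Omega>)"
    by (rule borel_measurable_continuous_on[OF _ m]; intro continuous_intros)+
  then show "(\<lambda>x. fst (w x)) \<in> L2 \<Omega>" "(\<lambda>x. snd (w x)) \<in> L2 \<Omega>"
    by (auto intro!: L2_norm_mono(1)[OF _ w] always_eventually le)
qed

lemma L2_inner_tendsto:
  assumes w: "\<And>n. w n \<in> L2 \<Omega>" "u \<in> L2 \<Omega>" "v \<in> L2 \<Omega>"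
    and lim: "(\<lambda>n. L2_norm \<Omega> (\<lambda>x. w n x - u x)) \<longlonglongrightarrow> 0"
  shows "(\<lambda>n. LINT x|lebesgue_on \<Omega>. w n x \<bullet> v x) \<longlonglongrightarrow> (LINT x|lebesgue_on \<Omega>. u x \<bullet> v x)"
proof (rule LIM_zero_cancel, rule Lim_null_comparison)
  show "\<forall>\<^sub>F n in sequentially. norm ((LINT x|lebesgue_on \<Omega>. w n x \<bullet> v x) - (LINT x|lebesgue_on \<Omega>. u x \<bullet> v x))
      \<le> L2_norm \<Omega> (\<lambda>x. w n x - u x) * L2_norm \<Omega> v"
  proof (intro always_eventually allI)
    fix n
    have "(LINT x|lebesgue_on \<Omega>. w n x \<bullet> v x) - (LINT x|lebesgue_on \<Omega>. u x \<bullet> v x)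
        = (LINT x|lebesgue_on \<Omega>. (w n x - u x) \<bullet> v x)"
      by (simp add: inner_diff_left L2_inner_integrable w)
    then show "norm ((LINT x|lebesgue_on \<Omega>. w n x \<bullet> v x) - (LINT x|lebesgue_on \<Omega>. u x \<bullet> v x))
        \<le> L2_norm \<Omega> (\<lambda>x. w n x - u x) * L2_norm \<Omega> v"
      using L2_Cauchy_Schwarz[OF L2_diff[OF w(1,2)] w(3), of n] by simp
  qed
  show "(\<lambda>n. L2_norm \<Omega> (\<lambda>x. w n x - u x) * L2_norm \<Omega> v) \<longlonglongrightarrow> 0"
    using tendsto_mult_right[OF lim, of "L2_norm \<Omega> v"] by simp
qed

lemma is_weak_gradient_diff:
  assumes \<Omega>: "\<Omega> \<in> sets lebesgue" and u: "u \<in> L2 \<Omega>" "g \<in> L2 \<Omega>" "is_weak_gradient \<Omega> u g"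
    and v: "v \<in> L2 \<Omega>" "h \<in> L2 \<Omega>" "is_weak_gradient \<Omega> v h"
  shows "is_weak_gradient \<Omega> (\<lambda>x. u x - v x) (\<lambda>x. g x - h x)"
  unfolding is_weak_gradient_def
proof (intro allI impI)
  fix \<phi> i assume \<phi>: "test_function \<Omega> \<phi>"
  note int = L2_mult_integrable[OF u(1) test_function_L2(2)[OF \<phi> \<Omega>, of i]]
    L2_mult_integrable[OF v(1) test_function_L2(2)[OF \<phi> \<Omega>, of i]]
    L2_mult_integrable[OF L2_component[OF u(2)] test_function_L2(1)[OF \<phi> \<Omega>], of i]
    L2_mult_integrable[OF L2_component[OF v(2)] test_function_L2(1)[OF \<phi> \<Omega>], of i]
  show "(LINT x|lebesgue_on \<Omega>. (u x - v x) * partial i \<phi> x)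
      = - (LINT x|lebesgue_on \<Omega>. (g x - h x) $ i * \<phi> x)"
    using u(3) v(3) \<phi> int unfolding is_weak_gradient_def by (simp add: left_diff_distrib)
qed

lemma H1_D:
  assumes "u \<in> H1 \<Omega>"
  shows "u \<in> L2 \<Omega>" "wgrad \<Omega> u \<in> L2 \<Omega>" "is_weak_gradient \<Omega> u (wgrad \<Omega> u)"
proof -
  show "u \<in> L2 \<Omega>" using assms by (simp add: H1_def)
  have "\<exists>g. g \<in> L2 \<Omega> \<and> is_weak_gradient \<Omega> u g" using assms by (auto simp: H1_def)
  from someI_ex[OF this] show "wgrad \<Omega> u \<in> L2 \<Omega>" "is_weak_gradient \<Omega> u (wgrad \<Omega> u)"
    unfolding wgrad_def by auto
qed

lemma H1_I:
  assumes "open \<Omega>" "u \<in> L2 \<Omega>" "g \<in> L2 \<Omega>" "is_weak_gradient \<Omega> u g"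
  shows "u \<in> H1 \<Omega>" "AE x in lebesgue_on \<Omega>. wgrad \<Omega> u x = g x"
proof -
  show u: "u \<in> H1 \<Omega>" using assms by (auto simp: H1_def)
  show "AE x in lebesgue_on \<Omega>. wgrad \<Omega> u x = g x"
    by (rule weak_gradient_unique[OF assms(1) H1_D(2)[OF u] assms(3) H1_D(3)[OF u] assms(4)])
qed

lemma H1_diff:
  assumes "open \<Omega>" "u \<in> H1 \<Omega>" "v \<in> H1 \<Omega>"
  shows "(\<lambda>x. u x - v x) \<in> H1 \<Omega>"
    "AE x in lebesgue_on \<Omega>. wgrad \<Omega> (\<lambda>x. u x - v x) x = wgrad \<Omega> u x - wgrad \<Omega> v x"
  using H1_I[OF assms(1) L2_diff[OF H1_D(1)[OF assms(2)] H1_D(1)[OF assms(3)]]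
      L2_diff[OF H1_D(2)[OF assms(2)] H1_D(2)[OF assms(3)]]
      is_weak_gradient_diff[OF _ H1_D[OF assms(2)] H1_D[OF assms(3)]]] assms(1)
  by auto

text \<open>An isometric picture of H1 inside the L2 functions with values in a product space; the
  triangle inequality and completeness are pulled back along it.\<close>

definition jet :: "(real ^ 'd) set \<Rightarrow> (real ^ 'd \<Rightarrow> real) \<Rightarrow> real ^ 'd \<Rightarrow> real \<times> (real ^ 'd)" where
  "jet \<Omega> u x = (u x, wgrad \<Omega> u x)"

lemma jet_L2: "u \<in> H1 \<Omega> \<Longrightarrow> jet \<Omega> u \<in> L2 \<Omega>"
  unfolding jet_def[abs_def] by (intro L2_Pair H1_D)

lemma H1_norm_jet: "u \<in> H1 \<Omega> \<Longrightarrow> H1_norm \<Omega> u = L2_norm \<Omega> (jet \<Omega> u)"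
  unfolding lam_norm_def jet_def[abs_def]
  by (intro real_sqrt_unique[symmetric, THEN sym] real_sqrt_unique) (simp_all add: L2_Pair(2)[OF H1_D(1,2)])

text \<open>\<open>wgrad\<close> of a difference is the difference of the gradients only almost
  everywhere, and the L2 norm does not see the exceptional set.\<close>

lemma H1_norm_diff_jet:
  assumes "open \<Omega>" "u \<in> H1 \<Omega>" "v \<in> H1 \<Omega>"
  shows "H1_norm \<Omega> (\<lambda>x. u x - v x) = L2_norm \<Omega> (\<lambda>x. jet \<Omega> u x - jet \<Omega> v x)"
proof -
  have "H1_norm \<Omega> (\<lambda>x. u x - v x) = L2_norm \<Omega> (jet \<Omega> (\<lambda>x. u x - v x))"
    by (rule H1_norm_jet[OF H1_diff(1)[OF assms]])
  also have "\<dots> = L2_norm \<Omega> (\<lambda>x. jet \<Omega> u x - jet \<Omega> v x)"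
  proof (rule L2_norm_cong_AE)
    show "AE x in lebesgue_on \<Omega>. jet \<Omega> (\<lambda>x. u x - v x) x = jet \<Omega> u x - jet \<Omega> v x"
      using H1_diff(2)[OF assms] by (rule eventually_mono) (simp add: jet_def)
  qed (intro L2_measurable L2_diff jet_L2 H1_diff(1) assms)+
  finally show ?thesis .
qed

lemma H1_norm_power2:
  "(H1_norm \<Omega> u)\<^sup>2 = (L2_norm \<Omega> (wgrad \<Omega> u))\<^sup>2 + (L2_norm \<Omega> u)\<^sup>2"
  by (simp add: lam_norm_def)

lemma H1_norm_nonneg [simp]: "0 \<le> H1_norm \<Omega> u"
  by (simp add: lam_norm_def)

lemma L2_norm_le_H1_norm: "L2_norm \<Omega> u \<le> H1_norm \<Omega> u" "L2_norm \<Omega> (wgrad \<Omega> u) \<le> H1_norm \<Omega> u"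
  by (rule power2_le_imp_le; simp add: H1_norm_power2)+

lemma H1_triangle_diff:
  assumes "open \<Omega>" "u \<in> H1 \<Omega>" "v \<in> H1 \<Omega>" "w \<in> H1 \<Omega>"
  shows "H1_norm \<Omega> (\<lambda>x. u x - w x) \<le> H1_norm \<Omega> (\<lambda>x. u x - v x) + H1_norm \<Omega> (\<lambda>x. v x - w x)"
  unfolding H1_norm_diff_jet[OF assms(1,2,4)] H1_norm_diff_jet[OF assms(1,2,3)] H1_norm_diff_jet[OF assms(1,3,4)]
  by (rule L2_triangle_diff[OF jet_L2 jet_L2 jet_L2]) fact+

lemma H1_norm_minus_commute:
  assumes "open \<Omega>" "u \<in> H1 \<Omega>" "v \<in> H1 \<Omega>"
  shows "H1_norm \<Omega> (\<lambda>x. u x - v x) = H1_norm \<Omega> (\<lambda>x. v x - u x)"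
  unfolding H1_norm_diff_jet[OF assms] H1_norm_diff_jet[OF assms(1,3,2)] by (rule L2_norm_minus_commute)

lemma test_function_H1:
  assumes "open \<Omega>" "test_function \<Omega> \<phi>"
  shows "\<phi> \<in> H1 \<Omega>" "AE x in lebesgue_on \<Omega>. wgrad \<Omega> \<phi> x = test_grad \<phi> x"
  using H1_I[OF assms(1) test_function_L2(1)[OF assms(2)] test_grad_L2[OF assms(2)]
      is_weak_gradient_test_grad[OF _ assms(2)]] assms(1) by auto

section \<open>The closed subspace H10\<close>

lemma H10_H1: "u \<in> H10 \<Omega> \<Longrightarrow> u \<in> H1 \<Omega>"
  by (simp add: H10_def)

lemma H10_approx:
  assumes "u \<in> H10 \<Omega>" "e > 0"
  obtains \<phi> where "test_function \<Omega> \<phi>" "H1_norm \<Omega> (\<lambda>x. u x - \<phi> x) < e"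
proof -
  obtain \<phi> where \<phi>: "\<And>n. test_function \<Omega> (\<phi> n)" "(\<lambda>n. H1_norm \<Omega> (\<lambda>x. u x - \<phi> n x)) \<longlonglongrightarrow> 0"
    using assms(1) by (auto simp: H10_def)
  from LIMSEQ_D[OF this(2) assms(2)] obtain n where "H1_norm \<Omega> (\<lambda>x. u x - \<phi> n x) < e"
    by fastforce
  then show ?thesis using that \<phi>(1) by blast
qed

lemma H10_I:
  assumes "u \<in> H1 \<Omega>" and approx: "\<And>e. e > 0 \<Longrightarrow> \<exists>\<phi>. test_function \<Omega> \<phi> \<and> H1_norm \<Omega> (\<lambda>x. u x - \<phi> x) < e"
  shows "u \<in> H10 \<Omega>"
proof -
  have "\<forall>n. \<exists>\<phi>. test_function \<Omega> \<phi> \<and> H1_norm \<Omega> (\<lambda>x. u x - \<phi> x) < 1 / real (Suc n)"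
    by (intro allI approx) simp
  then obtain \<phi> where \<phi>: "\<And>n. test_function \<Omega> (\<phi> n)" "\<And>n. H1_norm \<Omega> (\<lambda>x. u x - \<phi> n x) < 1 / real (Suc n)"
    by metis
  have "(\<lambda>n. H1_norm \<Omega> (\<lambda>x. u x - \<phi> n x)) \<longlonglongrightarrow> 0"
    by (rule Lim_null_comparison[OF _ LIMSEQ_Suc[OF lim_1_over_n]])
      (use \<phi>(2) in \<open>auto intro!: always_eventually less_imp_le\<close>)
  then show ?thesis using assms(1) \<phi>(1) unfolding H10_def by blast
qed

lemma H10_diff:
  assumes "open \<Omega>" "u \<in> H10 \<Omega>" "v \<in> H10 \<Omega>"
  shows "(\<lambda>x. u x - v x) \<in> H10 \<Omega>"
proof (rule H10_I)
  note H = H10_H1[OF assms(2)] H10_H1[OF assms(3)]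
  show "(\<lambda>x. u x - v x) \<in> H1 \<Omega>" by (rule H1_diff(1)[OF assms(1) H])
  fix e :: real assume "e > 0"
  then have "e / 2 > 0" by simp
  obtain \<phi> where \<phi>: "test_function \<Omega> \<phi>" "H1_norm \<Omega> (\<lambda>x. u x - \<phi> x) < e / 2"
    by (rule H10_approx[OF assms(2) \<open>e / 2 > 0\<close>])
  obtain \<psi> where \<psi>: "test_function \<Omega> \<psi>" "H1_norm \<Omega> (\<lambda>x. v x - \<psi> x) < e / 2"
    by (rule H10_approx[OF assms(3) \<open>e / 2 > 0\<close>])
  note T = test_function_H1(1)[OF assms(1) \<phi>(1)] test_function_H1(1)[OF assms(1) \<psi>(1)]
  have "H1_norm \<Omega> (\<lambda>x. (u x - v x) - (\<phi> x - \<psi> x)) = H1_norm \<Omega> (\<lambda>x. (u x - \<phi> x) - (v x - \<psi> x))"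
    by (simp add: algebra_simps)
  also have "\<dots> = L2_norm \<Omega> (\<lambda>x. jet \<Omega> (\<lambda>x. u x - \<phi> x) x - jet \<Omega> (\<lambda>x. v x - \<psi> x) x)"
    by (intro H1_norm_diff_jet H1_diff(1) assms(1) H T)
  also have "\<dots> \<le> L2_norm \<Omega> (jet \<Omega> (\<lambda>x. u x - \<phi> x)) + L2_norm \<Omega> (jet \<Omega> (\<lambda>x. v x - \<psi> x))"
    using L2_triangle[OF jet_L2[OF H1_diff(1)[OF assms(1) H(1) T(1)]]
        L2_uminus[OF jet_L2[OF H1_diff(1)[OF assms(1) H(2) T(2)]]]]
    by (simp add: L2_norm_def)
  also have "\<dots> < e"
    using \<phi>(2) \<psi>(2) by (simp add: H1_norm_jet H1_diff(1) assms(1) H T)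
  finally show "\<exists>\<phi>. test_function \<Omega> \<phi> \<and> H1_norm \<Omega> (\<lambda>x. (u x - v x) - \<phi> x) < e"
    using test_function_diff[OF \<phi>(1) \<psi>(1)] by blast
qed

lemma H10_closed:
  assumes "open \<Omega>" "\<And>n. u n \<in> H10 \<Omega>" "v \<in> H1 \<Omega>"
    and lim: "(\<lambda>n. H1_norm \<Omega> (\<lambda>x. u n x - v x)) \<longlonglongrightarrow> 0"
  shows "v \<in> H10 \<Omega>"
proof (rule H10_I[OF assms(3)])
  fix e :: real assume "e > 0"
  then have e: "e / 2 > 0" by simp
  from LIMSEQ_D[OF lim e] obtain n where n: "H1_norm \<Omega> (\<lambda>x. u n x - v x) < e / 2"
    by fastforce
  obtain \<phi> where \<phi>: "test_function \<Omega> \<phi>" "H1_norm \<Omega> (\<lambda>x. u n x - \<phi> x) < e / 2"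
    by (rule H10_approx[OF assms(2) e])
  have "H1_norm \<Omega> (\<lambda>x. v x - \<phi> x) \<le> H1_norm \<Omega> (\<lambda>x. v x - u n x) + H1_norm \<Omega> (\<lambda>x. u n x - \<phi> x)"
    by (intro H1_triangle_diff assms H10_H1 test_function_H1[OF assms(1) \<phi>(1)])
  also have "H1_norm \<Omega> (\<lambda>x. v x - u n x) = H1_norm \<Omega> (\<lambda>x. u n x - v x)"
    by (intro H1_norm_minus_commute assms H10_H1)
  finally show "\<exists>\<phi>. test_function \<Omega> \<phi> \<and> H1_norm \<Omega> (\<lambda>x. v x - \<phi> x) < e"
    using n \<phi> by (intro exI[of _ \<phi>]) simp
qed

text \<open>The jets converge in L2 to a pair. For a fixed test function both sides of the weak
  gradient identity are continuous in L2, so the second component of the limit is a weak gradient of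
  the first.\<close>

lemma H10_complete:
  assumes op: "open \<Omega>" and u: "\<And>n. u n \<in> H10 \<Omega>"
    and Cauchy: "\<And>e. e > 0 \<Longrightarrow> \<exists>N. \<forall>m\<ge>N. \<forall>n\<ge>N. H1_norm \<Omega> (\<lambda>x. u m x - u n x) < e"
  obtains v where "v \<in> H10 \<Omega>" "(\<lambda>n. H1_norm \<Omega> (\<lambda>x. u n x - v x)) \<longlonglongrightarrow> 0"
proof -
  have \<Omega>: "\<Omega> \<in> sets lebesgue" using op by simp
  note H = H10_H1[OF u]
  obtain w where w: "w \<in> L2 \<Omega>" "(\<lambda>n. L2_norm \<Omega> (\<lambda>x. jet \<Omega> (u n) x - w x)) \<longlonglongrightarrow> 0"
  proof (rule L2_complete[of "\<lambda>n. jet \<Omega> (u n)" \<Omega>])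
    show "jet \<Omega> (u n) \<in> L2 \<Omega>" for n by (rule jet_L2[OF H])
    show "\<exists>N. \<forall>m\<ge>N. \<forall>n\<ge>N. L2_norm \<Omega> (\<lambda>x. jet \<Omega> (u m) x - jet \<Omega> (u n) x) < e" if "e > 0" for e
      using Cauchy[OF that] by (simp add: H1_norm_diff_jet[OF op H H])
  qed
  define v where "v x = fst (w x)" for x
  define g where "g x = snd (w x)" for x
  have v: "v \<in> L2 \<Omega>" and g: "g \<in> L2 \<Omega>"
    unfolding v_def[abs_def] g_def[abs_def] using L2_fst_snd[OF w(1)] by auto
  have wvg: "jet \<Omega> (u n) x - w x = (u n x - v x, wgrad \<Omega> (u n) x - g x)" for n x
    by (simp add: jet_def v_def g_def prod_eq_iff)
  have le: "L2_norm \<Omega> (\<lambda>x. u n x - v x) \<le> L2_norm \<Omega> (\<lambda>x. jet \<Omega> (u n) x - w x)"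
    "L2_norm \<Omega> (\<lambda>x. wgrad \<Omega> (u n) x - g x) \<le> L2_norm \<Omega> (\<lambda>x. jet \<Omega> (u n) x - w x)" for n
    unfolding wvg
    by (rule power2_le_imp_le; simp add: L2_Pair(2)[OF L2_diff[OF H1_D(1)[OF H] v] L2_diff[OF H1_D(2)[OF H] g]])+
  have lim: "(\<lambda>n. L2_norm \<Omega> (\<lambda>x. u n x - v x)) \<longlonglongrightarrow> 0" "(\<lambda>n. L2_norm \<Omega> (\<lambda>x. wgrad \<Omega> (u n) x - g x)) \<longlonglongrightarrow> 0"
    by (rule Lim_null_comparison[OF _ w(2)], intro always_eventually allI, simp add: le)+
  have wg: "is_weak_gradient \<Omega> v g"
    unfolding is_weak_gradient_def
  proof (intro allI impI)
    fix \<phi> i assume \<phi>: "test_function \<Omega> \<phi>"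
    have 1: "(\<lambda>n. LINT x|lebesgue_on \<Omega>. u n x * partial i \<phi> x) \<longlonglongrightarrow> (LINT x|lebesgue_on \<Omega>. v x * partial i \<phi> x)"
      using L2_inner_tendsto[OF H1_D(1)[OF H] v test_function_L2(2)[OF \<phi> \<Omega>, of i] lim(1)] by simp
    \<comment> \<open>Pairing with this vector field extracts component \<open>i\<close>, so that
      the limit lemma for inner products applies.\<close>
    have "(\<lambda>x. \<phi> x *\<^sub>R axis i (1::real)) \<in> L2 \<Omega>"
    proof (rule L2_norm_mono(1)[OF _ test_function_L2(1)[OF \<phi> \<Omega>]])
      show "(\<lambda>x. \<phi> x *\<^sub>R axis i (1::real)) \<in> borel_measurable (lebesgue_on \<Omega>)"
        by (intro borel_measurable_scaleR borel_measurable_const L2_measurable test_function_L2(1)[OF \<phi> \<Omega>])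
    qed simp
    from L2_inner_tendsto[OF H1_D(2)[OF H] g this lim(2)]
    have 2: "(\<lambda>n. LINT x|lebesgue_on \<Omega>. wgrad \<Omega> (u n) x $ i * \<phi> x) \<longlonglongrightarrow> (LINT x|lebesgue_on \<Omega>. g x $ i * \<phi> x)"
      by (simp add: inner_axis mult.commute)
    have "(LINT x|lebesgue_on \<Omega>. u n x * partial i \<phi> x) = - (LINT x|lebesgue_on \<Omega>. wgrad \<Omega> (u n) x $ i * \<phi> x)" for n
      using H1_D(3)[OF H, of n] \<phi> unfolding is_weak_gradient_def by blast
    then show "(LINT x|lebesgue_on \<Omega>. v x * partial i \<phi> x) = - (LINT x|lebesgue_on \<Omega>. g x $ i * \<phi> x)"
      using LIMSEQ_unique[OF 1] tendsto_minus[OF 2] by simp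
  qed
  note vH = H1_I[OF op v g wg]
  have "L2_norm \<Omega> (\<lambda>x. jet \<Omega> (u n) x - w x) = H1_norm \<Omega> (\<lambda>x. u n x - v x)" for n
    unfolding H1_norm_diff_jet[OF op H vH(1)]
  proof (rule L2_norm_cong_AE)
    show "AE x in lebesgue_on \<Omega>. jet \<Omega> (u n) x - w x = jet \<Omega> (u n) x - jet \<Omega> v x"
      using vH(2) by (rule eventually_mono) (simp add: jet_def v_def g_def prod_eq_iff)
  qed (intro L2_measurable L2_diff jet_L2 H vH(1) w(1))+
  then have *: "(\<lambda>n. H1_norm \<Omega> (\<lambda>x. u n x - v x)) \<longlonglongrightarrow> 0" using w(2) by simp
  show ?thesis by (rule that[OF H10_closed[OF op u vH(1) *] *])
qed

section \<open>Rellich compactness\<close>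

text \<open>The increment \<open>a\<close> is the integral of the directional derivative
  \<open>G\<close> over the unit interval. Integrating
  \<open>2 * a * G t - a\<^sup>2 \<le> (G t)\<^sup>2\<close> gives Jensen's inequality, and
  Cauchy-Schwarz bounds \<open>G\<close>.\<close>

lemma increment_sq_le_integral:
  fixes \<phi> :: "real ^ 'd \<Rightarrow> real"
  assumes d: "\<And>x. \<phi> differentiable (at x)" and c: "continuous_on UNIV (test_grad \<phi>)"
  shows "ennreal ((\<phi> (x + z) - \<phi> x)\<^sup>2)
    \<le> (\<integral>\<^sup>+t\<in>{0..1}. ennreal ((norm z)\<^sup>2 * (norm (test_grad \<phi> (x + t *\<^sub>R z)))\<^sup>2) \<partial>lborel)"
proof -
  define G where "G t = test_grad \<phi> (x + t *\<^sub>R z) \<bullet> z" for t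
  define H where "H t = (norm z)\<^sup>2 * (norm (test_grad \<phi> (x + t *\<^sub>R z)))\<^sup>2" for t
  define a where "a = \<phi> (x + z) - \<phi> x"
  have cont: "continuous_on {0..1} (\<lambda>t. test_grad \<phi> (x + t *\<^sub>R z))"
    by (intro continuous_on_compose2[OF c] continuous_intros) auto
  have G: "(G has_integral a) {0..1}"
    using fundamental_theorem_of_calculus[of 0 1 "\<lambda>t. \<phi> (x + t *\<^sub>R z)" G]
      DERIV_along_line[OF d, of x z]
    by (simp add: a_def G_def has_real_derivative_iff_has_vector_derivative has_vector_derivative_at_within)
  have "H integrable_on {0..1}"
    unfolding H_def[abs_def] by (intro integrable_continuous_interval continuous_intros cont)
  then obtain I where I: "(H has_integral I) {0..1}" by blast
  have "((\<lambda>t. 2 * a * G t - a\<^sup>2) has_integral (2 * a * a - 1 *\<^sub>R a\<^sup>2)) {0..1}"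
    using has_integral_diff[OF has_integral_mult_right[OF G, of "2 * a"] has_integral_const_real[of "a\<^sup>2" 0 1]] by simp
  then have "2 * a * a - 1 *\<^sub>R a\<^sup>2 \<le> I"
  proof (rule has_integral_le[OF _ I])
    fix t
    have "2 * a * G t - a\<^sup>2 \<le> (G t)\<^sup>2"
      using zero_le_power2[of "G t - a"] by (simp add: power2_eq_square algebra_simps)
    also have "\<dots> \<le> (norm (test_grad \<phi> (x + t *\<^sub>R z)) * norm z)\<^sup>2"
      unfolding G_def by (subst abs_le_square_iff[symmetric]) (simp add: Cauchy_Schwarz_ineq2)
    finally show "2 * a * G t - a\<^sup>2 \<le> H t" by (simp add: H_def power_mult_distrib mult.commute)
  qed
  then have "ennreal (a\<^sup>2) \<le> ennreal I" by (intro ennreal_leI) (simp add: power2_eq_square)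
  also have "\<dots> = (\<integral>\<^sup>+t\<in>{0..1}. ennreal (H t) \<partial>lborel)"
    by (rule nn_integral_has_integral_lebesgue'[OF _ I, symmetric]) (simp add: H_def)
  finally show ?thesis by (simp add: a_def H_def)
qed

text \<open>After Fubini the inner integral does not depend on \<open>t\<close>, by translation
  invariance, and the interval of \<open>t\<close> has length 1.\<close>

lemma translation_estimate:
  fixes \<phi> :: "real ^ 'd \<Rightarrow> real"
  assumes d: "\<And>x. \<phi> differentiable (at x)" and c: "continuous_on UNIV (test_grad \<phi>)"
  shows "(\<integral>\<^sup>+x. ennreal ((\<phi> (x + z) - \<phi> x)\<^sup>2) \<partial>lborel)
    \<le> ennreal ((norm z)\<^sup>2) * (\<integral>\<^sup>+x. ennreal ((norm (test_grad \<phi> x))\<^sup>2) \<partial>lborel)"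
proof -
  have [measurable]: "test_grad \<phi> \<in> borel_measurable borel" by (rule borel_measurable_continuous_onI[OF c])
  let ?h = "\<lambda>x. ennreal ((norm z)\<^sup>2 * (norm (test_grad \<phi> x))\<^sup>2)"
  have translate: "(\<integral>\<^sup>+x. ?h (x + v) \<partial>lborel) = (\<integral>\<^sup>+x. ?h x \<partial>lborel)" for v
    using nn_integral_lborel_translate[of ?h v] by (simp add: add.commute[of _ v])
  have "(\<integral>\<^sup>+x. ennreal ((\<phi> (x + z) - \<phi> x)\<^sup>2) \<partial>lborel)
      \<le> (\<integral>\<^sup>+x. (\<integral>\<^sup>+t. ?h (x + t *\<^sub>R z) * indicator {0..1} t \<partial>lborel) \<partial>lborel)"
    by (intro nn_integral_mono increment_sq_le_integral assms)
  also have "\<dots> = (\<integral>\<^sup>+t. (\<integral>\<^sup>+x. ?h (x + t *\<^sub>R z) * indicator {0..1::real} t \<partial>lborel) \<partial>lborel)"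
    by (rule lborel_pair.Fubini'[symmetric]) measurable
  also have "\<dots> = (\<integral>\<^sup>+t. (\<integral>\<^sup>+x. ?h x \<partial>lborel) * indicator {0..1::real} t \<partial>lborel)"
    by (simp add: nn_integral_multc translate)
  also have "\<dots> = (\<integral>\<^sup>+x. ?h x \<partial>lborel)"
    by (simp add: nn_integral_cmult)
  also have "\<dots> = ennreal ((norm z)\<^sup>2) * (\<integral>\<^sup>+x. ennreal ((norm (test_grad \<phi> x))\<^sup>2) \<partial>lborel)"
    by (simp add: ennreal_mult nn_integral_cmult)
  finally show ?thesis .
qed

section \<open>Averages over grid cells\<close>

text \<open>For positive \<open>N\<close>, a half-open cube of side \<open>1 / N\<close>. The floors
  make the cells disjoint and covering, and the index type is countable, as the diagonal argument
  requires.\<close>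

definition cell :: "nat \<Rightarrow> (int ^ 'd) \<Rightarrow> (real ^ 'd) set" where
  "cell N \<kappa> = {y. \<forall>i. \<lfloor>real N * y $ i\<rfloor> = \<kappa> $ i}"

definition cell_index :: "nat \<Rightarrow> real ^ 'd \<Rightarrow> int ^ 'd" where
  "cell_index N x = (\<chi> i. \<lfloor>real N * x $ i\<rfloor>)"

lemma cell_sets [measurable]: "cell N \<kappa> \<in> sets borel"
proof -
  have "(\<lambda>y::real^'a. y $ i) \<in> borel_measurable borel" for i
    by (intro borel_measurable_continuous_onI continuous_intros)
  then have "{y \<in> space borel. \<lfloor>real N * (y::real^'a) $ i\<rfloor> = \<kappa> $ i} \<in> sets borel" for i
    by measurable
  then have "(\<Inter>i\<in>UNIV. {y \<in> space borel. \<lfloor>real N * (y::real^'a) $ i\<rfloor> = \<kappa> $ i}) \<in> sets borel"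
    by (intro sets.finite_INT) auto
  then show ?thesis by (simp add: cell_def Collect_all_eq)
qed

text \<open>A cell is squeezed between an open and a closed box. A lower bound and finiteness of its
  measure are all that averaging needs.\<close>

lemma emeasure_cell:
  fixes \<kappa> :: "int ^ 'd"
  assumes "N > 0"
  shows "ennreal ((1 / real N) ^ CARD('d)) \<le> emeasure lborel (cell N \<kappa>)"
    "emeasure lborel (cell N \<kappa>) < \<infinity>"
proof -
  let ?a = "(\<chi> i. real_of_int (\<kappa> $ i) / real N) :: real ^ 'd"
  let ?b = "(\<chi> i. (real_of_int (\<kappa> $ i) + 1) / real N) :: real ^ 'd"
  have sub: "box ?a ?b \<subseteq> cell N \<kappa>" "cell N \<kappa> \<subseteq> cbox ?a ?b"
    using assms by (auto simp: cell_def mem_box_cart floor_eq_iff field_simps less_imp_le)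
  have side: "(?b - ?a) \<bullet> v = 1 / real N" if "v \<in> Basis" for v
    using that assms by (auto simp: Basis_vec_def inner_axis field_simps)
  have "?a \<bullet> v \<le> ?b \<bullet> v" if "v \<in> Basis" for v
    using side[OF that] assms unfolding inner_diff_left
    by (metis diff_ge_0_iff_ge divide_nonneg_nonneg of_nat_0_le_iff zero_le_one)
  then have "emeasure lborel (box ?a ?b) = ennreal (\<Prod>v\<in>Basis. (?b - ?a) \<bullet> v)"
    by (rule emeasure_lborel_box)
  also have "(\<Prod>v\<in>Basis. (?b - ?a) \<bullet> v) = (\<Prod>v\<in>(Basis :: (real ^ 'd) set). 1 / real N)"
    by (rule prod.cong[OF refl side])
  finally have "emeasure lborel (box ?a ?b) = ennreal (\<Prod>v\<in>(Basis :: (real ^ 'd) set). 1 / real N)" .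
  then show "ennreal ((1 / real N) ^ CARD('d)) \<le> emeasure lborel (cell N \<kappa>)"
    using emeasure_mono[OF sub(1), of lborel] by simp
  show "emeasure lborel (cell N \<kappa>) < \<infinity>"
    using emeasure_mono[OF sub(2), of lborel] emeasure_lborel_cbox_finite order.strict_trans1 by fastforce
qed

text \<open>Written as an expectation, so that Jensen's inequality for squares becomes nonnegativity
  of the variance.\<close>

definition cell_average :: "nat \<Rightarrow> (real ^ 'd \<Rightarrow> real) \<Rightarrow> (int ^ 'd) \<Rightarrow> real" where
  "cell_average N \<phi> \<kappa> = (LINT y|uniform_measure lborel (cell N \<kappa>). \<phi> y)"

lemma (in prob_space) expectation_power2_le:
  fixes X :: "'a \<Rightarrow> real"
  assumes "integrable M X" "integrable M (\<lambda>x. (X x)\<^sup>2)"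
  shows "(expectation X)\<^sup>2 \<le> expectation (\<lambda>x. (X x)\<^sup>2)"
  using variance_positive[of X] variance_eq[OF assms] by simp

text \<open>Jensen's inequality, with \<open>real N ^ CARD('d)\<close> bounding the reciprocal of
  the measure of the cell. The number \<open>a\<close> serves twice: as a value of the function in
  the error estimate, and as 0 in the bound on the averages.\<close>

lemma cell_average_diff_sq_le:
  fixes \<phi> :: "real ^ 'd \<Rightarrow> real"
  assumes N: "N > 0" and m: "\<phi> \<in> borel_measurable borel" and b: "\<And>y. \<bar>\<phi> y\<bar> \<le> C"
  shows "ennreal ((cell_average N \<phi> \<kappa> - a)\<^sup>2)
    \<le> ennreal (real N ^ CARD('d)) * (\<integral>\<^sup>+y. ennreal ((\<phi> y - a)\<^sup>2) * indicator (cell N \<kappa>) y \<partial>lborel)"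
proof -
  let ?U = "uniform_measure lborel (cell N \<kappa>)"
  have pos: "0 < (1 / real N) ^ CARD('d)" using N by simp
  have E: "emeasure lborel (cell N \<kappa>) \<noteq> 0" "emeasure lborel (cell N \<kappa>) \<noteq> \<infinity>"
    using emeasure_cell(2)[OF N, of \<kappa>] less_le_trans[OF _ emeasure_cell(1)[OF N, of \<kappa>], of 0] pos
    by auto
  interpret prob_space ?U by (rule prob_space_uniform_measure[OF E])
  have [measurable]: "\<phi> \<in> borel_measurable borel" by fact
  have i1: "integrable ?U \<phi>"
    by (rule integrable_const_bound[where B = C]) (use b in auto)
  have i2: "integrable ?U (\<lambda>y. (\<phi> y - a)\<^sup>2)"
  proof (rule integrable_const_bound[where B = "(C + \<bar>a\<bar>)\<^sup>2"])
    have "\<bar>\<phi> y - a\<bar> \<le> \<bar>C + \<bar>a\<bar>\<bar>" for y using b[of y] by linarith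
    then show "AE y in ?U. norm ((\<phi> y - a)\<^sup>2) \<le> (C + \<bar>a\<bar>)\<^sup>2"
      by (simp add: abs_le_square_iff)
  qed simp
  have "cell_average N \<phi> \<kappa> - a = expectation (\<lambda>y. \<phi> y - a)"
    unfolding cell_average_def using i1 prob_space by simp
  then have "(cell_average N \<phi> \<kappa> - a)\<^sup>2 \<le> expectation (\<lambda>y. (\<phi> y - a)\<^sup>2)"
    using expectation_power2_le[of "\<lambda>y. \<phi> y - a"] i1 i2 by simp
  then have "ennreal ((cell_average N \<phi> \<kappa> - a)\<^sup>2) \<le> ennreal (expectation (\<lambda>y. (\<phi> y - a)\<^sup>2))"
    by (rule ennreal_leI)
  also have "\<dots> = (\<integral>\<^sup>+y. ennreal ((\<phi> y - a)\<^sup>2) \<partial>?U)"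
    using i2 by (intro nn_integral_eq_integral[symmetric]) auto
  also have "\<dots> = (\<integral>\<^sup>+y. ennreal ((\<phi> y - a)\<^sup>2) * indicator (cell N \<kappa>) y \<partial>lborel) / emeasure lborel (cell N \<kappa>)"
    by (rule nn_integral_uniform_measure) auto
  also have "\<dots> \<le> ennreal (real N ^ CARD('d)) * (\<integral>\<^sup>+y. ennreal ((\<phi> y - a)\<^sup>2) * indicator (cell N \<kappa>) y \<partial>lborel)"
  proof (rule divide_le_posI_ennreal)
    have "1 = ennreal ((1 / real N) ^ CARD('d)) * ennreal (real N ^ CARD('d))"
      using N by (simp add: ennreal_mult[symmetric] power_divide)
    also have "\<dots> \<le> emeasure lborel (cell N \<kappa>) * ennreal (real N ^ CARD('d))"
      by (intro mult_right_mono emeasure_cell(1)[OF N]) simp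
    finally have "1 \<le> emeasure lborel (cell N \<kappa>) * ennreal (real N ^ CARD('d))" .
    from mult_right_mono[OF this, of "\<integral>\<^sup>+y. ennreal ((\<phi> y - a)\<^sup>2) * indicator (cell N \<kappa>) y \<partial>lborel"]
    show "(\<integral>\<^sup>+y. ennreal ((\<phi> y - a)\<^sup>2) * indicator (cell N \<kappa>) y \<partial>lborel) \<le> emeasure lborel (cell N \<kappa>) *
        (ennreal (real N ^ CARD('d)) * (\<integral>\<^sup>+y. ennreal ((\<phi> y - a)\<^sup>2) * indicator (cell N \<kappa>) y \<partial>lborel))"
      by (simp add: mult.assoc)
  qed (use E in \<open>simp add: zero_less_iff_neq_zero\<close>)
  finally show ?thesis .
qed

lemma cell_translate:
  assumes N: "N > 0" and "x + z \<in> cell N (cell_index N x)"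
  shows "z \<in> cbox (\<chi> i. - (1 / real N)) (\<chi> i. 1 / real N)"
proof -
  have "\<bar>z $ i\<bar> \<le> 1 / real N" for i
  proof -
    have "\<lfloor>real N * (x $ i + z $ i)\<rfloor> = \<lfloor>real N * x $ i\<rfloor>"
      using assms(2) by (simp add: cell_def cell_index_def)
    then have "\<bar>real N * z $ i\<bar> < 1" by (simp add: distrib_left) linarith
    then have "real N * \<bar>z $ i\<bar> < 1" by (simp add: abs_mult)
    then show ?thesis using N by (simp add: field_simps)
  qed
  then show ?thesis by (simp add: mem_box_cart abs_le_iff minus_le_iff)
qed

text \<open>A cell of the grid of width \<open>1 / N\<close> containing \<open>x\<close> lies in the cube \<open>x + ?Q\<close>, so the error is
  bounded by an average of translation errors over \<open>?Q\<close>.\<close>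

lemma cell_average_error:
  fixes \<phi> :: "real ^ 'd \<Rightarrow> real"
  assumes N: "N > 0" and d: "\<And>x. \<phi> differentiable (at x)" and c: "continuous_on UNIV (test_grad \<phi>)"
    and b: "\<And>y. \<bar>\<phi> y\<bar> \<le> C"
  shows "(\<integral>\<^sup>+x. ennreal ((cell_average N \<phi> (cell_index N x) - \<phi> x)\<^sup>2) \<partial>lborel)
    \<le> ennreal (2 ^ CARD('d) * (real CARD('d) / real N)\<^sup>2) * (\<integral>\<^sup>+x. ennreal ((norm (test_grad \<phi> x))\<^sup>2) \<partial>lborel)"
proof -
  let ?Q = "cbox (\<chi> i. - (1 / real N)) (\<chi> i. 1 / real N) :: (real ^ 'd) set"
  let ?A = "\<integral>\<^sup>+x. ennreal ((norm (test_grad \<phi> x))\<^sup>2) \<partial>lborel"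
  have "continuous_on UNIV \<phi>"
    using d by (simp add: continuous_at_imp_continuous_on differentiable_imp_continuous_within)
  then have [measurable]: "\<phi> \<in> borel_measurable borel" by (rule borel_measurable_continuous_onI)
  have pt: "ennreal ((cell_average N \<phi> (cell_index N x) - \<phi> x)\<^sup>2)
      \<le> (\<integral>\<^sup>+z. ennreal (real N ^ CARD('d)) * (ennreal ((\<phi> (x + z) - \<phi> x)\<^sup>2) * indicator ?Q z) \<partial>lborel)" for x
  proof -
    have "ennreal ((cell_average N \<phi> (cell_index N x) - \<phi> x)\<^sup>2) \<le> ennreal (real N ^ CARD('d)) *
        (\<integral>\<^sup>+y. ennreal ((\<phi> y - \<phi> x)\<^sup>2) * indicator (cell N (cell_index N x)) y \<partial>lborel)"
      by (rule cell_average_diff_sq_le[OF N _ b]) simp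
    also have "(\<integral>\<^sup>+y. ennreal ((\<phi> y - \<phi> x)\<^sup>2) * indicator (cell N (cell_index N x)) y \<partial>lborel)
        = (\<integral>\<^sup>+z. ennreal ((\<phi> (x + z) - \<phi> x)\<^sup>2) * indicator (cell N (cell_index N x)) (x + z) \<partial>lborel)"
      by (rule nn_integral_lborel_translate[symmetric]) measurable
    also have "\<dots> \<le> (\<integral>\<^sup>+z. ennreal ((\<phi> (x + z) - \<phi> x)\<^sup>2) * indicator ?Q z \<partial>lborel)"
      by (intro nn_integral_mono mult_left_mono) (auto simp: indicator_def dest: cell_translate[OF N])
    also have "ennreal (real N ^ CARD('d)) * \<dots>
        = (\<integral>\<^sup>+z. ennreal (real N ^ CARD('d)) * (ennreal ((\<phi> (x + z) - \<phi> x)\<^sup>2) * indicator ?Q z) \<partial>lborel)"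
      by (rule nn_integral_cmult[symmetric]) measurable
    finally show ?thesis by (simp add: mult_left_mono)
  qed
  have normQ: "norm z \<le> real CARD('d) / real N" if "z \<in> ?Q" for z
  proof -
    have "\<bar>z $ i\<bar> \<le> 1 / real N" for i using that by (auto simp: mem_box_cart abs_le_iff minus_le_iff)
    then have "(\<Sum>i\<in>UNIV. \<bar>z $ i\<bar>) \<le> (\<Sum>i\<in>(UNIV::'d set). 1 / real N)" by (intro sum_mono)
    then show ?thesis using norm_le_l1_cart[of z] by simp
  qed
  have "(\<integral>\<^sup>+x. ennreal ((cell_average N \<phi> (cell_index N x) - \<phi> x)\<^sup>2) \<partial>lborel)
      \<le> (\<integral>\<^sup>+x. \<integral>\<^sup>+z. ennreal (real N ^ CARD('d)) * (ennreal ((\<phi> (x + z) - \<phi> x)\<^sup>2) * indicator ?Q z) \<partial>lborel \<partial>lborel)"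
    by (intro nn_integral_mono pt)
  also have "\<dots> = (\<integral>\<^sup>+z. \<integral>\<^sup>+x. ennreal (real N ^ CARD('d)) * (ennreal ((\<phi> (x + z) - \<phi> x)\<^sup>2) * indicator ?Q z) \<partial>lborel \<partial>lborel)"
    by (rule lborel_pair.Fubini'[symmetric]) measurable
  also have "\<dots> = (\<integral>\<^sup>+z. ennreal (real N ^ CARD('d)) * (\<integral>\<^sup>+x. ennreal ((\<phi> (x + z) - \<phi> x)\<^sup>2) \<partial>lborel) * indicator ?Q z \<partial>lborel)"
    by (simp add: nn_integral_multc nn_integral_cmult mult.assoc)
  also have "\<dots> \<le> (\<integral>\<^sup>+z. ennreal (real N ^ CARD('d)) * (ennreal ((real CARD('d) / real N)\<^sup>2) * ?A) * indicator ?Q z \<partial>lborel)"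
  proof (rule nn_integral_mono)
    fix z
    show "ennreal (real N ^ CARD('d)) * (\<integral>\<^sup>+x. ennreal ((\<phi> (x + z) - \<phi> x)\<^sup>2) \<partial>lborel) * indicator ?Q z
        \<le> ennreal (real N ^ CARD('d)) * (ennreal ((real CARD('d) / real N)\<^sup>2) * ?A) * indicator ?Q z"
    proof (cases "z \<in> ?Q")
      case True
      have "(\<integral>\<^sup>+x. ennreal ((\<phi> (x + z) - \<phi> x)\<^sup>2) \<partial>lborel) \<le> ennreal ((norm z)\<^sup>2) * ?A"
        by (rule translation_estimate[OF d c])
      also have "\<dots> \<le> ennreal ((real CARD('d) / real N)\<^sup>2) * ?A"
        by (intro mult_right_mono ennreal_leI power_mono normQ True) auto
      finally show ?thesis by (intro mult_right_mono mult_left_mono) auto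
    qed simp
  qed
  also have "\<dots> = ennreal (real N ^ CARD('d)) * (ennreal ((real CARD('d) / real N)\<^sup>2) * ?A) * emeasure lborel ?Q"
    by (rule nn_integral_cmult_indicator) simp
  also have "emeasure lborel ?Q = ennreal ((2 / real N) ^ CARD('d))"
  proof -
    have "((\<chi> i. 1 / real N) - (\<chi> i. - (1 / real N)) :: real ^ 'd) \<bullet> v = 2 / real N" if "v \<in> Basis" for v
      using that by (auto simp: Basis_vec_def inner_axis)
    then show ?thesis
      by (subst emeasure_lborel_cbox) (auto simp: inner_diff_left field_simps)
  qed
  also have "ennreal (real N ^ CARD('d)) * (ennreal ((real CARD('d) / real N)\<^sup>2) * ?A) * ennreal ((2 / real N) ^ CARD('d))
      = ennreal (real N ^ CARD('d) * (2 / real N) ^ CARD('d) * (real CARD('d) / real N)\<^sup>2) * ?A"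
    by (simp add: ennreal_mult mult_ac)
  \<comment> \<open>The reciprocal cell volume against the volume of \<open>?Q\<close>, whose side
    is twice that of a cell; hence the power of 2 in the constant.\<close>
  also have "real N ^ CARD('d) * (2 / real N) ^ CARD('d) = 2 ^ CARD('d)"
    using N by (simp add: power_mult_distrib[symmetric])
  finally show ?thesis .
qed

text \<open>Countably many indices occur, and the preimage of each one is a cell.\<close>

lemma measurable_cell_index:
  fixes g :: "int ^ 'd \<Rightarrow> real"
  shows "(\<lambda>x. g (cell_index N x)) \<in> borel_measurable borel"
proof -
  have "cell_index N -` {\<kappa>} = cell N \<kappa>" for \<kappa> :: "int ^ 'd"
    by (auto simp: cell_index_def cell_def vec_eq_iff)
  then have "cell_index N \<in> borel \<rightarrow>\<^sub>M count_space (UNIV :: (int ^ 'd) set)"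
    by (subst measurable_count_space_eq_countable) auto
  then show ?thesis by (rule measurable_compose) simp
qed

lemma continuous_on_test_grad:
  assumes "test_function \<Omega> \<phi>"
  shows "continuous_on UNIV (test_grad \<phi>)"
  unfolding test_grad_def[abs_def] by (intro continuous_on_vec_lambda test_functionD(3)[OF assms])

lemma test_function_bounded:
  assumes "test_function \<Omega> \<phi>"
  obtains C where "\<And>x. \<bar>\<phi> x\<bar> \<le> C"
  using continuous_compact_support_bounded[OF test_functionD(1,6)[OF assms]] by metis

lemma nn_integral_lborel_test_function:
  assumes "open \<Omega>" "test_function \<Omega> \<phi>"
  shows "(\<integral>\<^sup>+x. ennreal ((\<phi> x)\<^sup>2) \<partial>lborel) = ennreal ((L2_norm \<Omega> \<phi>)\<^sup>2)"
    "(\<integral>\<^sup>+x. ennreal ((norm (test_grad \<phi> x))\<^sup>2) \<partial>lborel) = ennreal ((L2_norm \<Omega> (test_grad \<phi>))\<^sup>2)"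
proof -
  have \<Omega>: "\<Omega> \<in> sets lebesgue" using assms(1) by simp
  have [measurable]: "\<phi> \<in> borel_measurable borel" "test_grad \<phi> \<in> borel_measurable borel"
    by (intro borel_measurable_continuous_onI test_functionD(1)[OF assms(2)] continuous_on_test_grad[OF assms(2)])+
  have "(\<integral>\<^sup>+x. ennreal ((\<phi> x)\<^sup>2) \<partial>lborel) = (\<integral>\<^sup>+x. ennreal ((\<phi> x)\<^sup>2) \<partial>lebesgue_on \<Omega>)"
    by (rule nn_integral_lebesgue_on_support[symmetric, OF _ _ \<Omega>]) (simp_all add: test_functionD(4)[OF assms(2)])
  also have "\<dots> = ennreal ((L2_norm \<Omega> \<phi>)\<^sup>2)"
    using L2_norm_nn_integral[OF test_function_L2(1)[OF assms(2) \<Omega>]] by simp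
  finally show "(\<integral>\<^sup>+x. ennreal ((\<phi> x)\<^sup>2) \<partial>lborel) = ennreal ((L2_norm \<Omega> \<phi>)\<^sup>2)" .
  have "test_grad \<phi> x = 0" if "x \<notin> \<Omega>" for x
    using that by (simp add: vec_eq_iff test_grad_def test_functionD(5)[OF assms(2)])
  then have "(\<integral>\<^sup>+x. ennreal ((norm (test_grad \<phi> x))\<^sup>2) \<partial>lborel) = (\<integral>\<^sup>+x. ennreal ((norm (test_grad \<phi> x))\<^sup>2) \<partial>lebesgue_on \<Omega>)"
    by (intro nn_integral_lebesgue_on_support[symmetric, OF _ _ \<Omega>]) simp_all
  also have "\<dots> = ennreal ((L2_norm \<Omega> (test_grad \<phi>))\<^sup>2)"
    by (rule L2_norm_nn_integral[OF test_grad_L2[OF assms(2) \<Omega>]])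
  finally show "(\<integral>\<^sup>+x. ennreal ((norm (test_grad \<phi> x))\<^sup>2) \<partial>lborel) = ennreal ((L2_norm \<Omega> (test_grad \<phi>))\<^sup>2)" .
qed

lemma nn_integral_lebesgue_on_le:
  fixes g :: "real ^ 'd \<Rightarrow> ennreal"
  assumes "\<Omega> \<in> sets lebesgue" and m: "g \<in> borel_measurable borel"
  shows "(\<integral>\<^sup>+x. g x \<partial>lebesgue_on \<Omega>) \<le> (\<integral>\<^sup>+x. g x \<partial>lborel)"
proof -
  have "(\<integral>\<^sup>+x. g x \<partial>lebesgue_on \<Omega>) = (\<integral>\<^sup>+x. g x * indicator \<Omega> x \<partial>lebesgue)"
    using assms(1) by (simp add: nn_integral_restrict_space)
  also have "\<dots> \<le> (\<integral>\<^sup>+x. g x \<partial>lebesgue)"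
    by (rule nn_integral_mono) (auto simp: indicator_def)
  also have "\<dots> = (\<integral>\<^sup>+x. g x \<partial>lborel)" by (rule nn_integral_completion)
  finally show ?thesis .
qed

lemma cell_average_error_L2:
  fixes \<Omega> :: "(real ^ 'd) set"
  assumes "N > 0" "open \<Omega>" and \<phi>: "test_function \<Omega> \<phi>"
  defines "e \<equiv> \<lambda>x. cell_average N \<phi> (cell_index N x) - \<phi> x"
  shows "e \<in> L2 \<Omega>" "L2_norm \<Omega> e \<le> sqrt (2 ^ CARD('d)) * real CARD('d) / real N * L2_norm \<Omega> (test_grad \<phi>)"
proof -
  have \<Omega>: "\<Omega> \<in> sets lebesgue" using assms(2) by simp
  obtain C where C: "\<And>x. \<bar>\<phi> x\<bar> \<le> C" by (rule test_function_bounded[OF \<phi>], rule that)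
  let ?c = "sqrt (2 ^ CARD('d)) * real CARD('d) / real N * L2_norm \<Omega> (test_grad \<phi>)"
  have e: "e \<in> borel_measurable borel"
    unfolding e_def by (intro borel_measurable_diff measurable_cell_index
        borel_measurable_continuous_onI[OF test_functionD(1)[OF \<phi>]])
  have "(\<integral>\<^sup>+x. ennreal ((norm (e x))\<^sup>2) \<partial>lebesgue_on \<Omega>) \<le> (\<integral>\<^sup>+x. ennreal ((e x)\<^sup>2) \<partial>lborel)"
    using nn_integral_lebesgue_on_le[OF \<Omega>, of "\<lambda>x. ennreal ((e x)\<^sup>2)"] e by simp
  also have "\<dots> \<le> ennreal (2 ^ CARD('d) * (real CARD('d) / real N)\<^sup>2) * ennreal ((L2_norm \<Omega> (test_grad \<phi>))\<^sup>2)"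
    unfolding e_def nn_integral_lborel_test_function(2)[OF assms(2) \<phi>, symmetric]
    by (rule cell_average_error[OF assms(1) test_functionD(2)[OF \<phi>] continuous_on_test_grad[OF \<phi>] C])
  also have "\<dots> = ennreal (?c\<^sup>2)"
    by (simp add: ennreal_mult[symmetric] power_mult_distrib power_divide)
  finally have le: "(\<integral>\<^sup>+x. ennreal ((norm (e x))\<^sup>2) \<partial>lebesgue_on \<Omega>) \<le> ennreal (?c\<^sup>2)" .
  have "e \<in> borel_measurable (lebesgue_on \<Omega>)"
    by (rule measurable_restrict_space1) (use measurable_completion[of e lborel borel] e in simp)
  from L2_bounded_nn_integral[OF this le]
  show "e \<in> L2 \<Omega>" "L2_norm \<Omega> e \<le> ?c" by simp_all
qed

lemma cell_average_bound:
  fixes \<Omega> :: "(real ^ 'd) set"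
  assumes "N > 0" "open \<Omega>" and \<phi>: "test_function \<Omega> \<phi>" and "L2_norm \<Omega> \<phi> \<le> M"
  shows "\<bar>cell_average N \<phi> \<kappa>\<bar> \<le> sqrt (real N ^ CARD('d)) * M"
proof -
  obtain C where C: "\<And>x. \<bar>\<phi> x\<bar> \<le> C" by (rule test_function_bounded[OF \<phi>], rule that)
  have M: "0 \<le> M" using assms(4) L2_norm_nonneg order_trans by blast
  have "ennreal ((cell_average N \<phi> \<kappa> - 0)\<^sup>2)
      \<le> ennreal (real N ^ CARD('d)) * (\<integral>\<^sup>+y. ennreal ((\<phi> y - 0)\<^sup>2) * indicator (cell N \<kappa>) y \<partial>lborel)"
    by (rule cell_average_diff_sq_le[OF assms(1) borel_measurable_continuous_onI[OF test_functionD(1)[OF \<phi>]] C])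
  also have "\<dots> \<le> ennreal (real N ^ CARD('d)) * (\<integral>\<^sup>+y. ennreal ((\<phi> y)\<^sup>2) \<partial>lborel)"
    by (intro mult_left_mono nn_integral_mono) (auto simp: indicator_def)
  also have "\<dots> = ennreal (real N ^ CARD('d)) * ennreal ((L2_norm \<Omega> \<phi>)\<^sup>2)"
    by (simp add: nn_integral_lborel_test_function(1)[OF assms(2) \<phi>])
  also have "\<dots> \<le> ennreal (real N ^ CARD('d)) * ennreal (M\<^sup>2)"
    by (intro mult_left_mono ennreal_leI power_mono assms(4)) auto
  also have "\<dots> = ennreal ((sqrt (real N ^ CARD('d)) * M)\<^sup>2)"
    by (simp add: ennreal_mult[symmetric] power_mult_distrib)
  finally have "(cell_average N \<phi> \<kappa>)\<^sup>2 \<le> (sqrt (real N ^ CARD('d)) * M)\<^sup>2" by simp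
  then show ?thesis using M by (simp add: abs_le_square_iff[symmetric] abs_mult)
qed

section \<open>Extraction of the Cauchy subsequence\<close>

lemma L2_bounded_convergence:
  fixes w :: "nat \<Rightarrow> real ^ 'd \<Rightarrow> real"
  assumes \<Omega>: "\<Omega> \<in> lmeasurable" and m: "\<And>n. w n \<in> borel_measurable (lebesgue_on \<Omega>)"
    and b: "\<And>n x. \<bar>w n x\<bar> \<le> B" and lim: "\<And>x. (\<lambda>n. w n x) \<longlonglongrightarrow> v x"
  shows "w n \<in> L2 \<Omega>" "v \<in> L2 \<Omega>" "(\<lambda>n. L2_norm \<Omega> (\<lambda>x. w n x - v x)) \<longlonglongrightarrow> 0"
proof -
  interpret finite_measure "lebesgue_on \<Omega>" by (rule finite_measure_lebesgue_on[OF \<Omega>])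
  have vm: "v \<in> borel_measurable (lebesgue_on \<Omega>)" by (rule borel_measurable_LIMSEQ_metric[OF m lim])
  have vb: "\<bar>v x\<bar> \<le> B" for x
    by (rule Lim_bounded[OF tendsto_rabs[OF lim]]) (use b in auto)
  have B: "0 \<le> B" using b[of 0 undefined] by linarith
  have bL2: "h \<in> L2 \<Omega>" if "h \<in> borel_measurable (lebesgue_on \<Omega>)" "\<And>x. \<bar>h x\<bar> \<le> B" for h :: "real ^ 'd \<Rightarrow> real"
    by (rule L2_dominated[OF that(1), where h = "\<lambda>x. B\<^sup>2"])
      (use that(2) B in \<open>auto simp: abs_le_square_iff[symmetric] intro!: always_eventually\<close>)
  show "w n \<in> L2 \<Omega>" by (rule bL2[OF m b])
  show "v \<in> L2 \<Omega>" by (rule bL2[OF vm vb])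
  have "(\<lambda>n. LINT x|lebesgue_on \<Omega>. (norm (w n x - v x))\<^sup>2) \<longlonglongrightarrow> (LINT x|lebesgue_on \<Omega>. 0)"
  proof (rule integral_dominated_convergence[where w = "\<lambda>x. (2 * B)\<^sup>2"])
    show "(\<lambda>x. (norm (w n x - v x))\<^sup>2) \<in> borel_measurable (lebesgue_on \<Omega>)" for n using m vm by simp
    show "AE x in lebesgue_on \<Omega>. (\<lambda>n. (norm (w n x - v x))\<^sup>2) \<longlonglongrightarrow> 0"
    proof (intro always_eventually allI)
      fix x
      have "(\<lambda>n. (norm (w n x - v x))\<^sup>2) \<longlonglongrightarrow> (norm (v x - v x))\<^sup>2"
        by (intro tendsto_intros lim)
      then show "(\<lambda>n. (norm (w n x - v x))\<^sup>2) \<longlonglongrightarrow> 0" by simp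
    qed
    show "AE x in lebesgue_on \<Omega>. norm ((norm (w n x - v x))\<^sup>2) \<le> (2 * B)\<^sup>2" for n
    proof (intro always_eventually allI)
      fix x
      have "\<bar>w n x - v x\<bar> \<le> \<bar>2 * B\<bar>" using b[of n x] vb[of x] by linarith
      then show "norm ((norm (w n x - v x))\<^sup>2) \<le> (2 * B)\<^sup>2" by (simp add: abs_le_square_iff)
    qed
  qed auto
  from tendsto_real_sqrt[OF this] show "(\<lambda>n. L2_norm \<Omega> (\<lambda>x. w n x - v x)) \<longlonglongrightarrow> 0"
    by (simp add: L2_norm_def)
qed

text \<open>There are only countably many pairs of a grid and a cell, so along a diagonal subsequence all
  cell averages converge, and the error of averaging is uniformly small on a fine grid. Dividing by
  \<open>?s\<close> makes the averages bounded uniformly in the grid.\<close>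

lemma Rellich_test_functions:
  fixes \<Omega> :: "(real ^ 'd) set" and \<phi> :: "nat \<Rightarrow> real ^ 'd \<Rightarrow> real"
  assumes op: "open \<Omega>" and bd: "bounded \<Omega>" and \<phi>: "\<And>n. test_function \<Omega> (\<phi> n)"
    and M: "\<And>n. L2_norm \<Omega> (\<phi> n) \<le> M" "\<And>n. L2_norm \<Omega> (test_grad (\<phi> n)) \<le> M"
  obtains k :: "nat \<Rightarrow> nat" where "strict_mono k"
    "\<And>e. e > 0 \<Longrightarrow> \<exists>P. \<forall>m\<ge>P. \<forall>n\<ge>P. L2_norm \<Omega> (\<lambda>x. \<phi> (k m) x - \<phi> (k n) x) < e"
proof -
  have lm: "\<Omega> \<in> lmeasurable" using op bd by (simp add: lmeasurable_open)
  have \<Omega>: "\<Omega> \<in> sets lebesgue" using op by simp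
  let ?s = "\<lambda>N. sqrt (real (Suc N) ^ CARD('d))"
  define F where "F n p = cell_average (Suc (fst p)) (\<phi> n) (snd p) / ?s (fst p)" for n and p :: "nat \<times> (int ^ 'd)"
  have Fb: "norm (F n p) \<le> M" for n p
    using cell_average_bound[OF _ op \<phi> M(1), of "Suc (fst p)" n "snd p"]
    by (simp add: F_def abs_div pos_divide_le_eq mult.commute)
  obtain k :: "nat \<Rightarrow> nat" where k: "strict_mono k" "\<And>p. p \<in> UNIV \<Longrightarrow> \<exists>l. (\<lambda>n. F (k n) p) \<longlonglongrightarrow> l"
    by (rule function_convergent_subsequence[of "UNIV :: (nat \<times> (int ^ 'd)) set" F M],
        simp, rule Fb, rule that) assumption+
  have conv: "\<exists>l. (\<lambda>n. cell_average (Suc N) (\<phi> (k n)) \<kappa>) \<longlonglongrightarrow> l" for N \<kappa>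
  proof -
    obtain l where "(\<lambda>n. F (k n) (N, \<kappa>)) \<longlonglongrightarrow> l" using k(2)[OF UNIV_I] by blast
    then have "(\<lambda>n. F (k n) (N, \<kappa>) * ?s N) \<longlonglongrightarrow> l * ?s N" by (intro tendsto_intros)
    then show ?thesis by (auto simp: F_def)
  qed
  then obtain a where a: "\<And>N \<kappa>. (\<lambda>n. cell_average (Suc N) (\<phi> (k n)) \<kappa>) \<longlonglongrightarrow> a N \<kappa>" by metis
  have "\<exists>P. \<forall>m\<ge>P. \<forall>n\<ge>P. L2_norm \<Omega> (\<lambda>x. \<phi> (k m) x - \<phi> (k n) x) < e" if e: "e > 0" for e
  proof -
    \<comment> \<open>On the grid of width \<open>1 / Suc N\<close> averaging costs at most
      \<open>K / Suc N\<close> for all members of the sequence at once, so a single grid serves the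
      whole sequence.\<close>
    define K where "K = sqrt (2 ^ CARD('d)) * real CARD('d) * M"
    have "(\<lambda>N. K * (1 / real (Suc N))) \<longlonglongrightarrow> K * 0"
      by (intro tendsto_intros LIMSEQ_Suc[OF lim_1_over_n])
    then have "\<forall>\<^sub>F N in sequentially. K * (1 / real (Suc N)) < e / 4"
      using that by (intro order_tendstoD(2)) auto
    then obtain N where N: "K / real (Suc N) < e / 4" by (auto simp: eventually_sequentially)
    define A where "A n x = cell_average (Suc N) (\<phi> (k n)) (cell_index (Suc N) x)" for n x
    define b where "b x = a N (cell_index (Suc N) x)" for x
    have Am: "A n \<in> borel_measurable (lebesgue_on \<Omega>)" for n
      unfolding A_def
      by (rule measurable_restrict_space1[OF measurable_completion]) (use measurable_cell_index in simp)
    have Ab: "\<bar>A n x\<bar> \<le> ?s N * M" for n x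
      unfolding A_def by (rule cell_average_bound[OF _ op \<phi> M(1)]) simp
    have Alim: "(\<lambda>n. A n x) \<longlonglongrightarrow> b x" for x unfolding A_def b_def by (rule a)
    note A = L2_bounded_convergence[OF lm Am Ab Alim]
    have err: "L2_norm \<Omega> (\<lambda>x. A n x - \<phi> (k n) x) < e / 4" for n
    proof -
      have "L2_norm \<Omega> (\<lambda>x. A n x - \<phi> (k n) x)
          \<le> sqrt (2 ^ CARD('d)) * real CARD('d) / real (Suc N) * L2_norm \<Omega> (test_grad (\<phi> (k n)))"
        unfolding A_def by (rule cell_average_error_L2(2)[OF _ op \<phi>]) simp
      also have "\<dots> \<le> sqrt (2 ^ CARD('d)) * real CARD('d) / real (Suc N) * M"
        by (intro mult_left_mono M(2)) simp
      also have "\<dots> = K / real (Suc N)" by (simp add: K_def)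
      finally show ?thesis using N by (rule le_less_trans)
    qed
    note L = test_function_L2(1)[OF \<phi> \<Omega>]
    obtain P where P: "\<And>n. n \<ge> P \<Longrightarrow> L2_norm \<Omega> (\<lambda>x. A n x - b x) < e / 4"
      using LIMSEQ_D[OF A(3), of "e / 4"] e by auto
    have near: "L2_norm \<Omega> (\<lambda>x. \<phi> (k n) x - b x) < e / 2" if "n \<ge> P" for n
    proof -
      have "L2_norm \<Omega> (\<lambda>x. \<phi> (k n) x - b x)
          \<le> L2_norm \<Omega> (\<lambda>x. \<phi> (k n) x - A n x) + L2_norm \<Omega> (\<lambda>x. A n x - b x)"
        by (rule L2_triangle_diff[OF L A(1) A(2)])
      then show ?thesis using err[of n] P[OF that]
        by (simp add: L2_norm_minus_commute[of \<Omega> "\<phi> (k n)"])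
    qed
    have "L2_norm \<Omega> (\<lambda>x. \<phi> (k m) x - \<phi> (k n) x) < e" if "m \<ge> P" "n \<ge> P" for m n
      using L2_triangle_diff[OF L A(2) L, of "k m" "k n"] near[OF that(1)] near[OF that(2)]
      by (simp add: L2_norm_minus_commute[of \<Omega> b])
    then show ?thesis by blast
  qed
  then show ?thesis using that k(1) by blast
qed

text \<open>Each \<open>u n\<close> is replaced by a test function at H1 distance below
  \<open>1 / Suc n\<close>. These stay bounded by \<open>M + 1\<close>, and the replacement error
  vanishes along every subsequence, so the Cauchy property transfers back.\<close>

theorem Rellich_H10:
  fixes u :: "nat \<Rightarrow> real ^ 'd \<Rightarrow> real"
  assumes op: "open \<Omega>" and bd: "bounded \<Omega>" and u: "\<And>n. u n \<in> H10 \<Omega>"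
    and M: "\<And>n. H1_norm \<Omega> (u n) \<le> M"
  obtains k :: "nat \<Rightarrow> nat" where "strict_mono k"
    "\<And>e. e > 0 \<Longrightarrow> \<exists>P. \<forall>m\<ge>P. \<forall>n\<ge>P. L2_norm \<Omega> (\<lambda>x. u (k m) x - u (k n) x) < e"
proof -
  have \<Omega>: "\<Omega> \<in> sets lebesgue" using op by simp
  note H = H10_H1[OF u]
  have "\<forall>n. \<exists>\<phi>. test_function \<Omega> \<phi> \<and> H1_norm \<Omega> (\<lambda>x. u n x - \<phi> x) < 1 / real (Suc n)"
    using H10_approx[OF u] by (metis zero_less_divide_1_iff of_nat_0_less_iff zero_less_Suc)
  then obtain \<phi> where \<phi>: "\<And>n. test_function \<Omega> (\<phi> n)"
    and close: "\<And>n. H1_norm \<Omega> (\<lambda>x. u n x - \<phi> n x) < 1 / real (Suc n)" by metis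
  note T = test_function_H1[OF op \<phi>]
  have nb: "H1_norm \<Omega> (\<phi> n) \<le> M + 1" for n
  proof -
    have "L2_norm \<Omega> (\<lambda>x. jet \<Omega> (u n) x - (jet \<Omega> (u n) x - jet \<Omega> (\<phi> n) x))
        \<le> L2_norm \<Omega> (jet \<Omega> (u n)) + L2_norm \<Omega> (\<lambda>x. jet \<Omega> (u n) x - jet \<Omega> (\<phi> n) x)"
      using L2_triangle[OF jet_L2[OF H] L2_diff[OF jet_L2[OF T(1)] jet_L2[OF H]], of n n n]
      by (simp add: L2_norm_minus_commute[of \<Omega> "jet \<Omega> (\<phi> n)"])
    then have "H1_norm \<Omega> (\<phi> n) \<le> H1_norm \<Omega> (u n) + H1_norm \<Omega> (\<lambda>x. u n x - \<phi> n x)"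
      by (simp add: H1_norm_jet[OF H] H1_norm_jet[OF T(1)] H1_norm_diff_jet[OF op H T(1)])
    moreover have "1 / real (Suc n) \<le> 1" by simp
    ultimately show ?thesis using M[of n] close[of n] by linarith
  qed
  have b1: "L2_norm \<Omega> (\<phi> n) \<le> M + 1" for n using L2_norm_le_H1_norm(1)[of \<Omega> "\<phi> n"] nb[of n] by linarith
  have b2: "L2_norm \<Omega> (test_grad (\<phi> n)) \<le> M + 1" for n
  proof -
    have "L2_norm \<Omega> (test_grad (\<phi> n)) = L2_norm \<Omega> (wgrad \<Omega> (\<phi> n))"
      by (rule L2_norm_cong_AE[symmetric, OF T(2)])
        (intro L2_measurable H1_D(2)[OF T(1)] test_grad_L2[OF \<phi> \<Omega>])+
    then show ?thesis using L2_norm_le_H1_norm(2)[of \<Omega> "\<phi> n"] nb[of n] by linarith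
  qed
  obtain k :: "nat \<Rightarrow> nat" where k: "strict_mono k"
    "\<And>e. e > 0 \<Longrightarrow> \<exists>P. \<forall>m\<ge>P. \<forall>n\<ge>P. L2_norm \<Omega> (\<lambda>x. \<phi> (k m) x - \<phi> (k n) x) < e"
  proof (rule Rellich_test_functions[where \<phi> = \<phi>, OF op bd \<phi> b1 b2])
    fix k :: "nat \<Rightarrow> nat"
    assume k: "strict_mono k" "\<And>e. e > 0 \<Longrightarrow> \<exists>P. \<forall>m\<ge>P. \<forall>n\<ge>P. L2_norm \<Omega> (\<lambda>x. \<phi> (k m) x - \<phi> (k n) x) < e"
    show thesis by (rule that[of k, OF k])
  qed
  have "\<exists>P. \<forall>m\<ge>P. \<forall>n\<ge>P. L2_norm \<Omega> (\<lambda>x. u (k m) x - u (k n) x) < e" if e: "e > 0" for e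
  proof -
    obtain P where P: "\<And>m n. m \<ge> P \<Longrightarrow> n \<ge> P \<Longrightarrow> L2_norm \<Omega> (\<lambda>x. \<phi> (k m) x - \<phi> (k n) x) < e / 3"
      using k(2)[of "e / 3"] e by auto
    obtain Q where Q: "1 / real (Suc Q) < e / 3"
      using nat_approx_posE[of "e / 3"] e by auto
    have near: "L2_norm \<Omega> (\<lambda>x. u (k n) x - \<phi> (k n) x) < e / 3" if "n \<ge> Q" for n
    proof -
      have "Q \<le> k n" using that seq_suble[OF k(1), of n] by simp
      then have "1 / real (Suc (k n)) \<le> 1 / real (Suc Q)" by (simp add: frac_le)
      then show ?thesis
        using close[of "k n"] L2_norm_le_H1_norm(1)[of \<Omega> "\<lambda>x. u (k n) x - \<phi> (k n) x"] Q by linarith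
    qed
    note L = H1_D(1)[OF H] H1_D(1)[OF T(1)]
    have "L2_norm \<Omega> (\<lambda>x. u (k m) x - u (k n) x) < e" if "m \<ge> max P Q" "n \<ge> max P Q" for m n
    proof -
      have "L2_norm \<Omega> (\<lambda>x. u (k m) x - u (k n) x)
          \<le> L2_norm \<Omega> (\<lambda>x. u (k m) x - \<phi> (k m) x) + L2_norm \<Omega> (\<lambda>x. \<phi> (k m) x - u (k n) x)"
        by (rule L2_triangle_diff[OF L(1) L(2) L(1)])
      also have "L2_norm \<Omega> (\<lambda>x. \<phi> (k m) x - u (k n) x)
          \<le> L2_norm \<Omega> (\<lambda>x. \<phi> (k m) x - \<phi> (k n) x) + L2_norm \<Omega> (\<lambda>x. \<phi> (k n) x - u (k n) x)"
        by (rule L2_triangle_diff[OF L(2) L(2) L(1)])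
      also have "L2_norm \<Omega> (\<lambda>x. \<phi> (k n) x - u (k n) x) = L2_norm \<Omega> (\<lambda>x. u (k n) x - \<phi> (k n) x)"
        by (rule L2_norm_minus_commute)
      finally show ?thesis using near[of m] near[of n] P[of m n] that by simp
    qed
    then show ?thesis by blast
  qed
  then show ?thesis using that k(1) by blast
qed

section \<open>The reaction function and the energy\<close>

text \<open>Joint continuity makes \<open>h\<close> Borel on the product, and the graph map
  \<open>x \<mapsto> (x, u x)\<close> is measurable into it.\<close>

lemma measurable_continuous_compose:
  fixes h :: "real ^ 'd \<Rightarrow> real \<Rightarrow> real"
  assumes h: "continuous_on (\<Omega> \<times> UNIV) (\<lambda>(x, s). h x s)"
    and u: "u \<in> borel_measurable (lebesgue_on \<Omega>)"
  shows "(\<lambda>x. h x (u x)) \<in> borel_measurable (lebesgue_on \<Omega>)"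
proof -
  have id: "(\<lambda>x. x) \<in> borel_measurable (lebesgue_on \<Omega>)"
    by (rule measurable_restrict_space1[OF measurable_completion]) simp
  have "(\<lambda>x. (x, u x)) \<in> borel_measurable (lebesgue_on \<Omega>)"
    by (rule borel_measurable_Pair[OF id u])
  then have "(\<lambda>x. (x, u x)) \<in> lebesgue_on \<Omega> \<rightarrow>\<^sub>M restrict_space borel (\<Omega> \<times> UNIV)"
    by (intro measurable_restrict_space2) auto
  from measurable_compose[OF this borel_measurable_continuous_on_restrict[OF h]]
  show ?thesis by simp
qed

section \<open>Lipschitz constants from the structural assumption\<close>

text \<open>Removing the shift inside the absolute value costs a second \<open>1 / \<tau>\<close>.
  The supremum over the second variable stands inside the essential supremum, so one null set works
  for all \<open>s\<close>.\<close>

lemma Lambda_f_deriv_bounds: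
  assumes "\<tau> \<in> Lambda_f \<Omega> f \<rho>"
  shows "AE x in lebesgue_on \<Omega>. \<forall>s. \<bar>deriv (f x) s\<bar> \<le> \<rho> + 2 / \<tau>"
proof -
  have \<tau>: "\<tau> > 0" "sigma_f \<Omega> f \<tau> < ereal (\<rho> + 1 / \<tau>)" using assms by (auto simp: Lambda_f_def)
  have "AE x in lebesgue_on \<Omega>. (SUP s. ereal \<bar>deriv (f x) s + 1 / \<tau>\<bar>) \<le> sigma_f \<Omega> f \<tau>"
    unfolding sigma_f_def by (rule esssup_AE)
  then show ?thesis
  proof (rule eventually_mono)
    fix x assume x: "(SUP s. ereal \<bar>deriv (f x) s + 1 / \<tau>\<bar>) \<le> sigma_f \<Omega> f \<tau>"
    show "\<forall>s. \<bar>deriv (f x) s\<bar> \<le> \<rho> + 2 / \<tau>"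
    proof
      fix s
      have "ereal \<bar>deriv (f x) s + 1 / \<tau>\<bar> \<le> (SUP s. ereal \<bar>deriv (f x) s + 1 / \<tau>\<bar>)"
        by (rule SUP_upper) simp
      then have "ereal \<bar>deriv (f x) s + 1 / \<tau>\<bar> < ereal (\<rho> + 1 / \<tau>)"
        using x \<tau>(2) by (meson order.trans order.strict_trans1)
      then have "\<bar>deriv (f x) s + 1 / \<tau>\<bar> < \<rho> + 1 / \<tau>" by simp
      moreover have "0 < 1 / \<tau>" "2 / \<tau> = 1 / \<tau> + 1 / \<tau>" using \<tau>(1) by (auto simp: field_simps)
      ultimately show "\<bar>deriv (f x) s\<bar> \<le> \<rho> + 2 / \<tau>" by linarith
    qed
  qed
qed

lemma lipschitz_of_deriv_bound:
  fixes g :: "real \<Rightarrow> real"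
  assumes d: "\<And>s. g differentiable (at s)" and b: "\<And>s. \<bar>deriv g s\<bar> \<le> K"
  shows "\<bar>g s - g t\<bar> \<le> K * \<bar>s - t\<bar>"
proof -
  have "norm (g s - g t) \<le> K * norm (s - t)"
  proof (rule field_differentiable_bound[of UNIV g "deriv g"])
    show "(g has_field_derivative deriv g z) (at z within UNIV)" for z
      using d[of z] by (simp add: DERIV_deriv_iff_real_differentiable)
  qed (use b in auto)
  then show ?thesis by simp
qed

text \<open>The supremum in \<open>mu_f\<close> need not be attained, so its reciprocal is only
  approached; if the set is unbounded, \<open>1 / \<tau>\<close> becomes arbitrarily small.\<close>

lemma Lambda_f_near_mu_f:
  assumes "Lambda_f \<Omega> f \<rho> \<noteq> {}" "e > 0"
  obtains \<tau> where "\<tau> \<in> Lambda_f \<Omega> f \<rho>" "1 / \<tau> < mu_f \<Omega> f \<rho> + e"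
proof (cases "bdd_above (Lambda_f \<Omega> f \<rho>)")
  case True
  let ?S = "Sup (Lambda_f \<Omega> f \<rho>)"
  obtain \<tau>0 where "\<tau>0 \<in> Lambda_f \<Omega> f \<rho>" using assms(1) by blast
  then have "\<tau>0 \<le> ?S" "\<tau>0 > 0" using cSup_upper[OF _ True] by (auto simp: Lambda_f_def)
  then have S: "?S > 0" by linarith
  have "0 < e * ?S" using S assms(2) by simp
  moreover from this have "0 < 1 + e * ?S" by linarith
  \<comment> \<open>The left side is the value of \<open>\<tau>\<close> at which
    \<open>1 / \<tau>\<close> equals \<open>mu_f + e\<close>.\<close>
  ultimately have "1 / (1 / ?S + e) < ?S" using S assms(2) by (simp add: field_simps mult_pos_pos)
  then obtain \<tau> where \<tau>: "\<tau> \<in> Lambda_f \<Omega> f \<rho>" "1 / (1 / ?S + e) < \<tau>"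
    using less_cSupE[OF _ assms(1)] by blast
  have "\<tau> > 0" using \<tau>(1) by (simp add: Lambda_f_def)
  moreover have "1 / ?S + e > 0" using S assms(2) by (simp add: add_pos_pos)
  ultimately have "1 / \<tau> < 1 / ?S + e" using \<tau>(2) by (simp add: field_simps)
  then show ?thesis using that \<tau>(1) True by (simp add: mu_f_def)
next
  case False
  then obtain \<tau> where \<tau>: "\<tau> \<in> Lambda_f \<Omega> f \<rho>" "1 / e < \<tau>"
    unfolding bdd_above_def by (meson not_less)
  have "\<tau> > 0" using \<tau>(1) by (simp add: Lambda_f_def)
  then have "1 / \<tau> < e" using \<tau>(2) assms(2) by (simp add: field_simps)
  then show ?thesis using that \<tau>(1) False by (simp add: mu_f_def)
qed

section \<open>Primitives in the second variable\<close>

lemma primitive_has_derivative: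
  fixes g :: "real \<Rightarrow> real"
  assumes "continuous_on UNIV g"
  shows "((\<lambda>t. LBINT s=ereal 0..ereal t. g s) has_real_derivative g t) (at t)"
proof -
  \<comment> \<open>The fundamental theorem differentiates within an interval; the margin 1 places
    \<open>t\<close> in the interior, and 0 lies inside as well.\<close>
  define a b where "a = min 0 t - 1" and "b = max 0 t + 1"
  have "((\<lambda>t. LBINT s=ereal 0..ereal t. g s) has_vector_derivative g t) (at t within {a..b})"
    by (rule interval_integral_FTC2) (auto simp: a_def b_def intro: continuous_on_subset[OF assms])
  moreover have "at t within {a..b} = at t"
    by (rule at_within_interior) (auto simp: a_def b_def)
  ultimately show ?thesis by (simp add: has_real_derivative_iff_has_vector_derivative)
qed

text \<open>A Taylor bound for a derivative that is merely Lipschitz: the derivative of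
  \<open>G\<close> at \<open>t\<close> has the sign of \<open>t - a\<close>, so \<open>G\<close> is
  minimal at \<open>a\<close>, whichever of \<open>a\<close> and \<open>b\<close> is larger.\<close>

lemma primitive_lower_bound:
  fixes g :: "real \<Rightarrow> real"
  assumes c: "continuous_on UNIV g" and L: "\<And>s t. \<bar>g s - g t\<bar> \<le> K * \<bar>s - t\<bar>"
  shows "g a * (b - a) - K / 2 * (b - a)\<^sup>2
    \<le> (LBINT s=ereal 0..ereal b. g s) - (LBINT s=ereal 0..ereal a. g s)"
proof -
  define G where "G t = (LBINT s=ereal 0..ereal t. g s) - g a * (t - a) + K / 2 * (t - a)\<^sup>2" for t
  have D: "(G has_real_derivative g t - g a + K * (t - a)) (at t)" for t
    unfolding G_def[abs_def]
    by (rule derivative_eq_intros primitive_has_derivative[OF c] refl | simp)+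
  have "G a \<le> G b"
  proof (cases "a \<le> b")
    case True
    then show ?thesis
    proof (rule DERIV_nonneg_imp_nondecreasing)
      fix t assume t: "a \<le> t" "t \<le> b"
      have "0 \<le> g t - g a + K * (t - a)" using L[of t a] t by simp
      then show "\<exists>y. DERIV G t :> y \<and> 0 \<le> y" using D by blast
    qed
  next
    case False
    then have "b \<le> a" by simp
    then show ?thesis
    proof (rule DERIV_nonpos_imp_nonincreasing)
      fix t assume t: "b \<le> t" "t \<le> a"
      have "g t - g a + K * (t - a) \<le> 0" using L[of t a] t by (simp add: abs_if algebra_simps split: if_splits)
      then show "\<exists>y. DERIV G t :> y \<and> y \<le> 0" using D by blast
    qed
  qed
  then show ?thesis by (simp add: G_def)
qed

text \<open>Between 0 and \<open>t\<close> the derivative of the primitive is at most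
  \<open>\<bar>g 0\<bar> + K * \<bar>t\<bar>\<close> in absolute value. This growth bound gives
  integrability and the lower bound on the energies.\<close>

lemma primitive_abs_bound:
  fixes g :: "real \<Rightarrow> real"
  assumes c: "continuous_on UNIV g" and L: "\<And>s t. \<bar>g s - g t\<bar> \<le> K * \<bar>s - t\<bar>"
  shows "\<bar>LBINT s=ereal 0..ereal t. g s\<bar> \<le> \<bar>g 0\<bar> * \<bar>t\<bar> + K * t\<^sup>2"
proof -
  have K: "0 \<le> K" using L[of 0 1] by simp
  have "norm ((LBINT s=ereal 0..ereal t. g s) - (LBINT s=ereal 0..ereal 0. g s))
      \<le> (\<bar>g 0\<bar> + K * \<bar>t\<bar>) * norm (t - 0)"
  proof (rule field_differentiable_bound[of "cball 0 \<bar>t\<bar>" _ g])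
    show "((\<lambda>t. LBINT s=ereal 0..ereal t. g s) has_field_derivative g z) (at z within cball 0 \<bar>t\<bar>)" for z
      by (rule has_field_derivative_at_within[OF primitive_has_derivative[OF c]])
    show "norm (g z) \<le> \<bar>g 0\<bar> + K * \<bar>t\<bar>" if "z \<in> cball 0 \<bar>t\<bar>" for z
    proof -
      have "K * \<bar>z\<bar> \<le> K * \<bar>t\<bar>" using that K by (intro mult_left_mono) auto
      then show ?thesis using L[of z 0] by simp
    qed
  qed auto
  then show ?thesis
    by (simp add: interval_integral_endpoints_same distrib_right power2_eq_square abs_mult_self_eq mult.assoc)
qed

text \<open>The substitution \<open>s = t * r\<close> moves the variable endpoint into the
  integrand. An integral over a fixed interval depends continuously on its parameters, which yields
  measurability of the composed primitive.\<close>

lemma primitive_eq_integral: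
  fixes g :: "real \<Rightarrow> real"
  assumes "continuous_on UNIV g"
  shows "(LBINT s=ereal 0..ereal t. g s) = integral (cbox 0 1) (\<lambda>r. t * g (t * r))"
proof -
  have "((\<lambda>r. t * g (t * r)) has_integral
      (LBINT s=ereal 0..ereal (t * 1). g s) - (LBINT s=ereal 0..ereal (t * 0). g s)) {0..1}"
  proof (rule fundamental_theorem_of_calculus)
    fix r :: real
    have "((\<lambda>r. t * r) has_real_derivative t) (at r)" by (auto intro!: derivative_eq_intros)
    from DERIV_chain2[OF primitive_has_derivative[OF assms] this]
    show "((\<lambda>r. LBINT s=ereal 0..ereal (t * r). g s) has_vector_derivative t * g (t * r)) (at r within {0..1})"
      by (simp add: has_real_derivative_iff_has_vector_derivative has_vector_derivative_at_within mult.commute)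
  qed simp
  from integral_unique[OF this, symmetric] show ?thesis
    by (simp only: mult_1_right mult_zero_right interval_integral_endpoints_same diff_zero cbox_interval)
qed

lemma continuous_on_slice:
  assumes f: "continuous_on (A \<times> UNIV) (\<lambda>(x, s). f x s)" and "x \<in> A"
  shows "continuous_on UNIV (f x)"
proof -
  have "continuous_on UNIV (\<lambda>s. (x, s))" by (intro continuous_intros)
  from continuous_on_compose2[OF f this] show ?thesis using assms(2) by auto
qed

lemma measurable_primitive_compose:
  fixes f :: "real ^ 'd \<Rightarrow> real \<Rightarrow> real"
  assumes f: "continuous_on (\<Omega> \<times> UNIV) (\<lambda>(x, s). f x s)"
    and u: "u \<in> borel_measurable (lebesgue_on \<Omega>)"
  shows "(\<lambda>x. LBINT s=ereal 0..ereal (u x). f x s) \<in> borel_measurable (lebesgue_on \<Omega>)"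
proof -
  have "continuous_on ((\<Omega> \<times> UNIV) \<times> cbox 0 1) (\<lambda>(p, r). snd p * f (fst p) (snd p * r))"
  proof -
    have q: "continuous_on ((\<Omega> \<times> UNIV) \<times> cbox 0 1) (\<lambda>q::((real ^ 'd) \<times> real) \<times> real. (fst (fst q), snd (fst q) * snd q))"
      by (intro continuous_intros)
    have "continuous_on ((\<Omega> \<times> UNIV) \<times> cbox 0 1) (\<lambda>q. f (fst (fst q)) (snd (fst q) * snd q))"
    proof -
      have "(\<lambda>q::((real ^ 'd) \<times> real) \<times> real. (fst (fst q), snd (fst q) * snd q)) ` ((\<Omega> \<times> UNIV) \<times> cbox 0 1) \<subseteq> \<Omega> \<times> UNIV"
        by auto
      from continuous_on_compose2[OF f q this] show ?thesis by simp
    qed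
    then show ?thesis by (auto simp: case_prod_unfold intro!: continuous_intros)
  qed
  then have "continuous_on (\<Omega> \<times> UNIV) (\<lambda>p. integral (cbox 0 1) (\<lambda>r. snd p * f (fst p) (snd p * r)))"
    by (rule integral_continuous_on_param)
  then have "continuous_on (\<Omega> \<times> UNIV) (\<lambda>(x, t). integral (cbox 0 1) (\<lambda>r. t * f x (t * r)))"
    by (simp add: case_prod_unfold)
  from measurable_continuous_compose[OF this u]
  show ?thesis
    by (rule measurable_cong[THEN iffD1, rotated]) (simp add: primitive_eq_integral[OF continuous_on_slice[OF f]])
qed

section \<open>Energy and scheme for a Lipschitz reaction\<close>

definition primitive :: "(real ^ 'd \<Rightarrow> real \<Rightarrow> real) \<Rightarrow> (real ^ 'd \<Rightarrow> real) \<Rightarrow> real ^ 'd \<Rightarrow> real" where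
  "primitive f u x = (LBINT s=ereal 0..ereal (u x). f x s)"

text \<open>In the application \<open>K\<close> is \<open>\<rho> + 2 / \<tau>\<close> with \<open>\<tau>\<close> in \<open>Lambda_f \<Omega> f \<rho>\<close>.\<close>

locale lipschitz_reaction =
  fixes \<Omega> :: "(real ^ 'd) set" and f :: "real ^ 'd \<Rightarrow> real \<Rightarrow> real" and K :: real
  assumes open_domain: "open \<Omega>"
    and K_nonneg: "0 \<le> K"
    and f_continuous: "continuous_on (\<Omega> \<times> UNIV) (\<lambda>(x, s). f x s)"
    and f_0: "(\<lambda>x. f x 0) \<in> L2 \<Omega>"
    and f_lipschitz: "AE x in lebesgue_on \<Omega>. \<forall>s t. \<bar>f x s - f x t\<bar> \<le> K * \<bar>s - t\<bar>"
begin

lemma AE_f: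
  "AE x in lebesgue_on \<Omega>. continuous_on UNIV (f x) \<and> (\<forall>s t. \<bar>f x s - f x t\<bar> \<le> K * \<bar>s - t\<bar>)"
  using f_lipschitz AE_space by eventually_elim (use continuous_on_slice[OF f_continuous] in auto)

text \<open>Lipschitz continuity gives linear growth: \<open>\<bar>f x s\<bar>\<close> is at most
  \<open>\<bar>f x 0\<bar> + K * \<bar>s\<bar>\<close> for almost every \<open>x\<close>.\<close>

lemma f_L2:
  assumes u: "u \<in> L2 \<Omega>"
  shows "(\<lambda>x. f x (u x)) \<in> L2 \<Omega>"
proof (rule L2_dominated)
  show "(\<lambda>x. f x (u x)) \<in> borel_measurable (lebesgue_on \<Omega>)"
    by (rule measurable_continuous_compose[OF f_continuous L2_measurable[OF u]])
  show "integrable (lebesgue_on \<Omega>) (\<lambda>x. 2 * (norm (f x 0))\<^sup>2 + 2 * (norm (K * u x))\<^sup>2)"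
    using L2_integrable[OF f_0] L2_integrable[OF L2_mult[OF u, of K]] by simp
  show "AE x in lebesgue_on \<Omega>. (norm (f x (u x)))\<^sup>2 \<le> 2 * (norm (f x 0))\<^sup>2 + 2 * (norm (K * u x))\<^sup>2"
    using f_lipschitz
  proof (rule eventually_mono)
    fix x assume "\<forall>s t. \<bar>f x s - f x t\<bar> \<le> K * \<bar>s - t\<bar>"
    then have "\<bar>f x (u x) - f x 0\<bar> \<le> \<bar>K * u x\<bar>" using K_nonneg by (simp add: abs_mult) (metis diff_0_right)
    then have "(f x (u x) - f x 0)\<^sup>2 \<le> (K * u x)\<^sup>2" by (simp add: abs_le_square_iff)
    then show "(norm (f x (u x)))\<^sup>2 \<le> 2 * (norm (f x 0))\<^sup>2 + 2 * (norm (K * u x))\<^sup>2"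
      using norm_add_sq_le[of "f x 0" "f x (u x) - f x 0"] by simp
  qed
qed

lemma f_lipschitz_L2:
  assumes u: "u \<in> L2 \<Omega>" and v: "v \<in> L2 \<Omega>"
  shows "L2_norm \<Omega> (\<lambda>x. f x (u x) - f x (v x)) \<le> K * L2_norm \<Omega> (\<lambda>x. u x - v x)"
proof -
  have "L2_norm \<Omega> (\<lambda>x. f x (u x) - f x (v x)) \<le> L2_norm \<Omega> (\<lambda>x. K *\<^sub>R (u x - v x))"
  proof (rule L2_norm_mono(2))
    show "(\<lambda>x. f x (u x) - f x (v x)) \<in> borel_measurable (lebesgue_on \<Omega>)"
      by (intro L2_measurable L2_diff f_L2 u v)
    show "(\<lambda>x. K *\<^sub>R (u x - v x)) \<in> L2 \<Omega>" by (intro L2_scaleR L2_diff u v)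
    show "AE x in lebesgue_on \<Omega>. norm (f x (u x) - f x (v x)) \<le> norm (K *\<^sub>R (u x - v x))"
      using f_lipschitz by (rule eventually_mono) (simp add: abs_mult K_nonneg)
  qed
  then show ?thesis using K_nonneg by (simp only: L2_norm_scaleR abs_of_nonneg)
qed

lemma primitive_measurable: "u \<in> L2 \<Omega> \<Longrightarrow> primitive f u \<in> borel_measurable (lebesgue_on \<Omega>)"
  unfolding primitive_def[abs_def] by (rule measurable_primitive_compose[OF f_continuous L2_measurable])

lemma primitive_bounds:
  assumes u: "u \<in> L2 \<Omega>"
  shows "integrable (lebesgue_on \<Omega>) (primitive f u)"
    "\<bar>LINT x|lebesgue_on \<Omega>. primitive f u x\<bar>
      \<le> (L2_norm \<Omega> (\<lambda>x. f x 0))\<^sup>2 + (1 + K) * (L2_norm \<Omega> u)\<^sup>2"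
proof -
  let ?h = "\<lambda>x. (norm (f x 0))\<^sup>2 + (1 + K) * (norm (u x))\<^sup>2"
  have h: "integrable (lebesgue_on \<Omega>) ?h"
    using L2_integrable[OF f_0] L2_integrable[OF u] by simp
  have le: "AE x in lebesgue_on \<Omega>. norm (primitive f u x) \<le> ?h x"
    using AE_f
  proof (rule eventually_mono)
    fix x assume "continuous_on UNIV (f x) \<and> (\<forall>s t. \<bar>f x s - f x t\<bar> \<le> K * \<bar>s - t\<bar>)"
    then have "\<bar>primitive f u x\<bar> \<le> \<bar>f x 0\<bar> * \<bar>u x\<bar> + K * (u x)\<^sup>2"
      unfolding primitive_def by (intro primitive_abs_bound) auto
    moreover have "\<bar>f x 0\<bar> * \<bar>u x\<bar> \<le> (f x 0)\<^sup>2 + (u x)\<^sup>2"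
      using sum_squares_bound[of "\<bar>f x 0\<bar>" "\<bar>u x\<bar>"] mult_nonneg_nonneg[OF abs_ge_zero[of "f x 0"] abs_ge_zero[of "u x"]]
      unfolding mult.assoc power2_abs by linarith
    ultimately show "norm (primitive f u x) \<le> ?h x" by (simp add: distrib_right)
  qed
  show int: "integrable (lebesgue_on \<Omega>) (primitive f u)"
    by (rule Bochner_Integration.integrable_bound[OF h primitive_measurable[OF u]])
      (use le in \<open>auto elim!: eventually_mono\<close>)
  have "\<bar>LINT x|lebesgue_on \<Omega>. primitive f u x\<bar> \<le> (LINT x|lebesgue_on \<Omega>. norm (primitive f u x))"
    using integral_norm_bound[of "lebesgue_on \<Omega>" "primitive f u"] by simp
  also have "\<dots> \<le> (LINT x|lebesgue_on \<Omega>. ?h x)"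
    by (rule integral_mono_AE[OF integrable_norm[OF int] h le])
  also have "\<dots> = (L2_norm \<Omega> (\<lambda>x. f x 0))\<^sup>2 + (1 + K) * (L2_norm \<Omega> u)\<^sup>2"
    using L2_integrable[OF f_0] L2_integrable[OF u] by (simp add: L2_norm_power2)
  finally show "\<bar>LINT x|lebesgue_on \<Omega>. primitive f u x\<bar>
      \<le> (L2_norm \<Omega> (\<lambda>x. f x 0))\<^sup>2 + (1 + K) * (L2_norm \<Omega> u)\<^sup>2" .
qed

text \<open>The linear term is what the reaction contributes in the tested scheme; the quadratic
  term is the price of evaluating \<open>f\<close> at the old iterate.\<close>

lemma primitive_increment:
  assumes u: "u \<in> L2 \<Omega>" and v: "v \<in> L2 \<Omega>"
  shows "(LINT x|lebesgue_on \<Omega>. f x (u x) \<bullet> (v x - u x)) - K / 2 * (L2_norm \<Omega> (\<lambda>x. v x - u x))\<^sup>2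
    \<le> (LINT x|lebesgue_on \<Omega>. primitive f v x) - (LINT x|lebesgue_on \<Omega>. primitive f u x)"
proof -
  note i1 = L2_inner_integrable[OF f_L2[OF u] L2_diff[OF v u]]
  note i2 = L2_integrable[OF L2_diff[OF v u]]
  have "(LINT x|lebesgue_on \<Omega>. f x (u x) \<bullet> (v x - u x)) - K / 2 * (L2_norm \<Omega> (\<lambda>x. v x - u x))\<^sup>2
      = (LINT x|lebesgue_on \<Omega>. f x (u x) \<bullet> (v x - u x) - K / 2 * (norm (v x - u x))\<^sup>2)"
    using i1 i2 by (simp add: L2_norm_power2)
  also have "\<dots> \<le> (LINT x|lebesgue_on \<Omega>. primitive f v x - primitive f u x)"
  proof (rule integral_mono_AE)
    show "AE x in lebesgue_on \<Omega>. f x (u x) \<bullet> (v x - u x) - K / 2 * (norm (v x - u x))\<^sup>2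
        \<le> primitive f v x - primitive f u x"
      using AE_f
    proof (rule eventually_mono)
      fix x assume "continuous_on UNIV (f x) \<and> (\<forall>s t. \<bar>f x s - f x t\<bar> \<le> K * \<bar>s - t\<bar>)"
      then show "f x (u x) \<bullet> (v x - u x) - K / 2 * (norm (v x - u x))\<^sup>2 \<le> primitive f v x - primitive f u x"
        unfolding primitive_def using primitive_lower_bound[of "f x" K "u x" "v x"] by simp
    qed
    show "integrable (lebesgue_on \<Omega>) (\<lambda>x. f x (u x) \<bullet> (v x - u x) - K / 2 * (norm (v x - u x))\<^sup>2)"
      using i1 i2 by simp
  qed (intro Bochner_Integration.integrable_diff primitive_bounds u v)
  also have "\<dots> = (LINT x|lebesgue_on \<Omega>. primitive f v x) - (LINT x|lebesgue_on \<Omega>. primitive f u x)"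
    by (intro Bochner_Integration.integral_diff primitive_bounds u v)
  finally show ?thesis .
qed

lemma energy_eq:
  "energy \<Omega> f u = 1 / 2 * (L2_norm \<Omega> (wgrad \<Omega> u))\<^sup>2 - (LINT x|lebesgue_on \<Omega>. primitive f u x)"
  by (simp add: energy_def primitive_def L2_norm_power2)

lemma B_form_eq:
  assumes "u \<in> H1 \<Omega>" "v \<in> H1 \<Omega>"
  shows "B_form \<Omega> c u v = c * (LINT x|lebesgue_on \<Omega>. wgrad \<Omega> u x \<bullet> wgrad \<Omega> v x)
    + (LINT x|lebesgue_on \<Omega>. u x \<bullet> v x)"
  unfolding B_form_def
  using L2_inner_integrable[OF H1_D(2)[OF assms(1)] H1_D(2)[OF assms(2)]]
    L2_mult_integrable[OF H1_D(1)[OF assms(1)] H1_D(1)[OF assms(2)]]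
  by simp

lemma ell_form_eq:
  assumes "u \<in> L2 \<Omega>" "v \<in> L2 \<Omega>"
  shows "ell_form \<Omega> f c u v = (LINT x|lebesgue_on \<Omega>. u x \<bullet> v x)
    + c * (LINT x|lebesgue_on \<Omega>. f x (u x) \<bullet> v x)"
  unfolding ell_form_def
  using L2_mult_integrable[OF assms] L2_mult_integrable[OF f_L2[OF assms(1)] assms(2)]
  by (simp add: distrib_right mult.assoc)

text \<open>Testing with \<open>v - u\<close> produces the increment term with factor
  \<open>1 / c\<close>. Expanding the squared gradient leaves half the square of the gradient
  increment, which the Poincare inequality turns into \<open>1 / (2 * C\<^sub>P)\<close>;
  \<open>primitive_increment\<close> subtracts \<open>K / 2\<close>.\<close>

lemma energy_descent:
  assumes u: "u \<in> H10 \<Omega>" and v: "v \<in> H10 \<Omega>" and "c > 0"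
    and scheme: "\<And>w. w \<in> H10 \<Omega> \<Longrightarrow> B_form \<Omega> c v w = ell_form \<Omega> f c u w"
    and P: "poincare_constant \<Omega> C\<^sub>P"
  shows "energy \<Omega> f v + (1 / c + 1 / (2 * C\<^sub>P) - K / 2) * (L2_norm \<Omega> (\<lambda>x. v x - u x))\<^sup>2 \<le> energy \<Omega> f u"
proof -
  let ?M = "lebesgue_on \<Omega>"
  note uH = H10_H1[OF u] and vH = H10_H1[OF v]
  note uL = H1_D(1,2)[OF uH] and vL = H1_D(1,2)[OF vH]
  let ?d = "\<lambda>x. v x - u x" and ?D = "\<lambda>x. wgrad \<Omega> v x - wgrad \<Omega> u x"
  have d: "?d \<in> H10 \<Omega>" by (rule H10_diff[OF open_domain v u])
  have dL: "?d \<in> L2 \<Omega>" "?D \<in> L2 \<Omega>" using uL vL by (auto intro: L2_diff)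
  have wd: "AE x in ?M. wgrad \<Omega> ?d x = ?D x" by (rule H1_diff(2)[OF open_domain vH uH])
  have wdL: "wgrad \<Omega> ?d \<in> L2 \<Omega>" by (rule H1_D(2)[OF H10_H1[OF d]])
  \<comment> \<open>The scheme sees the gradient of the difference, the expansion the difference of
    the gradients.\<close>
  have eq1: "(LINT x|?M. wgrad \<Omega> v x \<bullet> wgrad \<Omega> ?d x) = (LINT x|?M. wgrad \<Omega> v x \<bullet> ?D x)"
  proof (rule integral_cong_AE)
    show "AE x in ?M. wgrad \<Omega> v x \<bullet> wgrad \<Omega> ?d x = wgrad \<Omega> v x \<bullet> ?D x"
      using wd by (rule eventually_mono) simp
  qed (rule borel_measurable_inner[OF L2_measurable[OF vL(2)] L2_measurable], fact)+
  have eq2: "L2_norm \<Omega> (wgrad \<Omega> ?d) = L2_norm \<Omega> ?D"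
    by (rule L2_norm_cong_AE[OF wd]) (intro L2_measurable wdL dL)+
  have s: "c * (LINT x|?M. wgrad \<Omega> v x \<bullet> ?D x) + (LINT x|?M. v x \<bullet> ?d x)
      = (LINT x|?M. u x \<bullet> ?d x) + c * (LINT x|?M. f x (u x) \<bullet> ?d x)"
    using scheme[OF d] by (simp only: B_form_eq[OF vH H10_H1[OF d]] ell_form_eq[OF uL(1) dL(1)] eq1)
  have "(LINT x|?M. v x \<bullet> ?d x) - (LINT x|?M. u x \<bullet> ?d x) = (LINT x|?M. v x \<bullet> ?d x - u x \<bullet> ?d x)"
    by (rule Bochner_Integration.integral_diff[symmetric]) (intro L2_inner_integrable uL vL dL)+
  also have "\<dots> = (L2_norm \<Omega> ?d)\<^sup>2"
    unfolding L2_norm_power2 by (simp add: power2_eq_square left_diff_distrib)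
  finally have "c * ((LINT x|?M. wgrad \<Omega> v x \<bullet> ?D x) - (LINT x|?M. f x (u x) \<bullet> ?d x)) = - (L2_norm \<Omega> ?d)\<^sup>2"
    using s by (simp add: right_diff_distrib)
  then have t: "(LINT x|?M. wgrad \<Omega> v x \<bullet> ?D x) - (LINT x|?M. f x (u x) \<bullet> ?d x) = - (1 / c * (L2_norm \<Omega> ?d)\<^sup>2)"
    using \<open>c > 0\<close> by (simp add: field_simps)
  \<comment> \<open>Expanding around the new iterate \<open>v\<close> gives the cross term that the
    implicit part of the scheme controls, and the square of \<open>?D\<close> enters with the
    favourable sign.\<close>
  have "(L2_norm \<Omega> (wgrad \<Omega> u))\<^sup>2 = (L2_norm \<Omega> (\<lambda>x. wgrad \<Omega> v x + - ?D x))\<^sup>2" by simp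
  also have "\<dots> = (L2_norm \<Omega> (wgrad \<Omega> v))\<^sup>2 - 2 * (LINT x|?M. wgrad \<Omega> v x \<bullet> ?D x) + (L2_norm \<Omega> ?D)\<^sup>2"
    unfolding L2_norm_add_power2[OF vL(2) L2_uminus[OF dL(2)]]
    by (simp only: inner_minus_right Bochner_Integration.integral_minus) (simp add: L2_norm_def norm_minus_commute)
  finally have g: "(L2_norm \<Omega> (wgrad \<Omega> u))\<^sup>2
      = (L2_norm \<Omega> (wgrad \<Omega> v))\<^sup>2 - 2 * (LINT x|?M. wgrad \<Omega> v x \<bullet> ?D x) + (L2_norm \<Omega> ?D)\<^sup>2" .
  have "(L2_norm \<Omega> ?d)\<^sup>2 \<le> C\<^sub>P * (L2_norm \<Omega> ?D)\<^sup>2" "C\<^sub>P > 0"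
    using P d unfolding poincare_constant_def eq2[symmetric] by auto
  then have "1 / (2 * C\<^sub>P) * (L2_norm \<Omega> ?d)\<^sup>2 \<le> 1 / 2 * (L2_norm \<Omega> ?D)\<^sup>2"
    by (simp add: field_simps)
  note y = this
  have s: "(1 / c + 1 / (2 * C\<^sub>P) - K / 2) * (L2_norm \<Omega> ?d)\<^sup>2
      = 1 / c * (L2_norm \<Omega> ?d)\<^sup>2 + 1 / (2 * C\<^sub>P) * (L2_norm \<Omega> ?d)\<^sup>2 - K / 2 * (L2_norm \<Omega> ?d)\<^sup>2"
    by (simp add: algebra_simps)
  \<comment> \<open>With norms and integrals abstracted to variables only linear arithmetic remains.
    \<open>x\<close>, \<open>y\<close> and \<open>z\<close> are the contributions of the time step,
    the Poincare inequality and the Lipschitz error.\<close>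
  have arith: "1 / 2 * a - p + s \<le> 1 / 2 * (a - 2 * b + e) - q"
    if "y \<le> 1 / 2 * e" "h - z \<le> p - q" "b - h = - x" "s = x + y - z"
    for a b e h p q s x y z :: real
    using that by (simp add: field_simps)
  show ?thesis
    unfolding energy_eq g by (rule arith[OF y primitive_increment[OF uL(1) vL(1)] t s])
qed

text \<open>The difference of two outputs, used as test function, is controlled by coercivity on the
  left and by Cauchy-Schwarz and the Lipschitz bound on the right. The resulting constant is at
  least 1: what is gained is the passage from the L2 norm of the inputs to the H1 norm of the
  outputs.\<close>

lemma scheme_contraction:
  assumes c: "c > 0" and u: "u \<in> H10 \<Omega>" "u' \<in> H10 \<Omega>" and v: "v \<in> H10 \<Omega>" "v' \<in> H10 \<Omega>"
    and scheme: "\<And>w. w \<in> H10 \<Omega> \<Longrightarrow> B_form \<Omega> c v w = ell_form \<Omega> f c u w"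
    and scheme': "\<And>w. w \<in> H10 \<Omega> \<Longrightarrow> B_form \<Omega> c v' w = ell_form \<Omega> f c u' w"
  shows "min c 1 * H1_norm \<Omega> (\<lambda>x. v x - v' x) \<le> (1 + c * K) * L2_norm \<Omega> (\<lambda>x. u x - u' x)"
proof -
  let ?M = "lebesgue_on \<Omega>"
  note vH = H10_H1[OF v(1)] H10_H1[OF v(2)]
  note uL = H1_D(1)[OF H10_H1[OF u(1)]] H1_D(1)[OF H10_H1[OF u(2)]]
  note vL = H1_D(1,2)[OF vH(1)] H1_D(1,2)[OF vH(2)]
  let ?d = "\<lambda>x. v x - v' x"
  have d: "?d \<in> H10 \<Omega>" by (rule H10_diff[OF open_domain v])
  note dL = H1_D(1,2)[OF H10_H1[OF d]]
  have wd: "AE x in ?M. wgrad \<Omega> ?d x = wgrad \<Omega> v x - wgrad \<Omega> v' x"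
    by (rule H1_diff(2)[OF open_domain vH])
  have "(LINT x|?M. wgrad \<Omega> ?d x \<bullet> wgrad \<Omega> ?d x) = (LINT x|?M. (wgrad \<Omega> v x - wgrad \<Omega> v' x) \<bullet> wgrad \<Omega> ?d x)"
  proof (rule integral_cong_AE)
    show "AE x in ?M. wgrad \<Omega> ?d x \<bullet> wgrad \<Omega> ?d x = (wgrad \<Omega> v x - wgrad \<Omega> v' x) \<bullet> wgrad \<Omega> ?d x"
      using wd by (rule eventually_mono) simp
  qed (intro borel_measurable_inner L2_measurable[OF dL(2)] L2_measurable[OF L2_diff[OF vL(2) vL(4)]])+
  also have "\<dots> = (LINT x|?M. wgrad \<Omega> v x \<bullet> wgrad \<Omega> ?d x) - (LINT x|?M. wgrad \<Omega> v' x \<bullet> wgrad \<Omega> ?d x)"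
    by (simp add: inner_diff_left L2_inner_integrable[OF vL(2) dL(2)] L2_inner_integrable[OF vL(4) dL(2)])
  finally have G: "(L2_norm \<Omega> (wgrad \<Omega> ?d))\<^sup>2
      = (LINT x|?M. wgrad \<Omega> v x \<bullet> wgrad \<Omega> ?d x) - (LINT x|?M. wgrad \<Omega> v' x \<bullet> wgrad \<Omega> ?d x)"
    by (simp add: L2_norm_power2 power2_norm_eq_inner)
  have split: "(LINT x|?M. (a x - b x) \<bullet> ?d x) = (LINT x|?M. a x \<bullet> ?d x) - (LINT x|?M. b x \<bullet> ?d x)"
    if "a \<in> L2 \<Omega>" "b \<in> L2 \<Omega>" for a b :: "real ^ 'd \<Rightarrow> real"
    unfolding inner_diff_left
    by (rule Bochner_Integration.integral_diff[OF L2_inner_integrable[OF that(1) dL(1)] L2_inner_integrable[OF that(2) dL(1)]])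
  have U: "(L2_norm \<Omega> ?d)\<^sup>2 = (LINT x|?M. v x \<bullet> ?d x) - (LINT x|?M. v' x \<bullet> ?d x)"
    unfolding split[OF vL(1,3), symmetric] L2_norm_power2 by (simp add: power2_eq_square)
  have "c * (L2_norm \<Omega> (wgrad \<Omega> ?d))\<^sup>2 + (L2_norm \<Omega> ?d)\<^sup>2 = B_form \<Omega> c v ?d - B_form \<Omega> c v' ?d"
    unfolding G U B_form_eq[OF vH(1) H10_H1[OF d]] B_form_eq[OF vH(2) H10_H1[OF d]]
    by (simp add: algebra_simps)
  also have "\<dots> = (LINT x|?M. (u x - u' x) \<bullet> ?d x) + c * (LINT x|?M. (f x (u x) - f x (u' x)) \<bullet> ?d x)"
    unfolding scheme[OF d] scheme'[OF d] ell_form_eq[OF uL(1) dL(1)] ell_form_eq[OF uL(2) dL(1)]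
      split[OF uL] split[OF f_L2[OF uL(1)] f_L2[OF uL(2)]]
    by (simp add: algebra_simps)
  also have "\<dots> \<le> L2_norm \<Omega> (\<lambda>x. u x - u' x) * L2_norm \<Omega> ?d
      + c * (L2_norm \<Omega> (\<lambda>x. f x (u x) - f x (u' x)) * L2_norm \<Omega> ?d)"
    using L2_Cauchy_Schwarz[OF L2_diff[OF uL] dL(1)]
      L2_Cauchy_Schwarz[OF L2_diff[OF f_L2[OF uL(1)] f_L2[OF uL(2)]] dL(1)] c
    by (intro add_mono mult_left_mono) linarith+
  also have "\<dots> \<le> L2_norm \<Omega> (\<lambda>x. u x - u' x) * L2_norm \<Omega> ?d
      + c * ((K * L2_norm \<Omega> (\<lambda>x. u x - u' x)) * L2_norm \<Omega> ?d)"
    using c by (intro add_left_mono mult_left_mono mult_right_mono f_lipschitz_L2 uL) auto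
  also have "\<dots> = (1 + c * K) * L2_norm \<Omega> (\<lambda>x. u x - u' x) * L2_norm \<Omega> ?d"
    by (simp add: algebra_simps)
  also have "\<dots> \<le> (1 + c * K) * L2_norm \<Omega> (\<lambda>x. u x - u' x) * H1_norm \<Omega> ?d"
    using c K_nonneg by (intro mult_left_mono L2_norm_le_H1_norm mult_nonneg_nonneg add_nonneg_nonneg) auto
  finally have le: "c * (L2_norm \<Omega> (wgrad \<Omega> ?d))\<^sup>2 + (L2_norm \<Omega> ?d)\<^sup>2
      \<le> (1 + c * K) * L2_norm \<Omega> (\<lambda>x. u x - u' x) * H1_norm \<Omega> ?d" .
  \<comment> \<open>Coercivity: \<open>min c 1\<close> lies below both weights \<open>c\<close> and
    1 of the bilinear form.\<close>
  have "min c 1 * (H1_norm \<Omega> ?d)\<^sup>2 = min c 1 * (L2_norm \<Omega> (wgrad \<Omega> ?d))\<^sup>2 + min c 1 * (L2_norm \<Omega> ?d)\<^sup>2"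
    by (simp add: H1_norm_power2 distrib_left)
  also have "\<dots> \<le> c * (L2_norm \<Omega> (wgrad \<Omega> ?d))\<^sup>2 + 1 * (L2_norm \<Omega> ?d)\<^sup>2"
    by (intro add_mono mult_right_mono) auto
  finally have *: "(min c 1 * H1_norm \<Omega> ?d) * H1_norm \<Omega> ?d
      \<le> ((1 + c * K) * L2_norm \<Omega> (\<lambda>x. u x - u' x)) * H1_norm \<Omega> ?d"
    using le by (simp add: power2_eq_square mult.assoc)
  show ?thesis
  proof (cases "H1_norm \<Omega> ?d = 0")
    case True
    then show ?thesis using c K_nonneg by simp
  next
    case False
    then have "0 < H1_norm \<Omega> ?d" using H1_norm_nonneg[of \<Omega> ?d] by linarith
    with * show ?thesis by (rule mult_right_le_imp_le)
  qed
qed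

text \<open>Only the outputs \<open>w n\<close> occur with gradients, so L2 convergence of the
  inputs is enough. As inputs and outputs share the limit \<open>v\<close>, the zero order terms
  cancel and the stationary equation remains.\<close>

lemma scheme_limit_weak_solution:
  assumes c: "c > 0" and u: "\<And>n. u n \<in> H10 \<Omega>" and w: "\<And>n. w n \<in> H10 \<Omega>" and v: "v \<in> H10 \<Omega>"
    and scheme: "\<And>n z. z \<in> H10 \<Omega> \<Longrightarrow> B_form \<Omega> c (w n) z = ell_form \<Omega> f c (u n) z"
    and limw: "(\<lambda>n. H1_norm \<Omega> (\<lambda>x. w n x - v x)) \<longlonglongrightarrow> 0"
    and limu: "(\<lambda>n. L2_norm \<Omega> (\<lambda>x. u n x - v x)) \<longlonglongrightarrow> 0"
  shows "weak_solution \<Omega> f v"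
  unfolding weak_solution_def
proof (intro conjI ballI)
  let ?M = "lebesgue_on \<Omega>"
  show "v \<in> H10 \<Omega>" by fact
  fix z assume z: "z \<in> H10 \<Omega>"
  note uL = H1_D(1)[OF H10_H1[OF u]]
  note wL = H1_D(1,2)[OF H10_H1[OF w]]
  note vL = H1_D(1,2)[OF H10_H1[OF v]]
  note zL = H1_D(1,2)[OF H10_H1[OF z]]
  have "L2_norm \<Omega> (\<lambda>x. wgrad \<Omega> (w n) x - wgrad \<Omega> v x) \<le> H1_norm \<Omega> (\<lambda>x. w n x - v x)" for n
  proof -
    have H: "w n \<in> H1 \<Omega>" "v \<in> H1 \<Omega>" by (intro H10_H1 w v)+
    have "L2_norm \<Omega> (\<lambda>x. wgrad \<Omega> (w n) x - wgrad \<Omega> v x) = L2_norm \<Omega> (wgrad \<Omega> (\<lambda>x. w n x - v x))"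
      by (rule L2_norm_cong_AE[symmetric, OF H1_diff(2)[OF open_domain H]])
        (intro L2_measurable H1_D(2)[OF H1_diff(1)[OF open_domain H]] L2_diff wL vL)+
    then show ?thesis using L2_norm_le_H1_norm(2) by metis
  qed
  then have 1: "(\<lambda>n. L2_norm \<Omega> (\<lambda>x. wgrad \<Omega> (w n) x - wgrad \<Omega> v x)) \<longlonglongrightarrow> 0"
    by (intro Lim_null_comparison[OF _ limw] always_eventually allI) simp
  have 2: "(\<lambda>n. L2_norm \<Omega> (\<lambda>x. w n x - v x)) \<longlonglongrightarrow> 0"
    by (intro Lim_null_comparison[OF _ limw] always_eventually allI) (simp add: L2_norm_le_H1_norm)
  have "(\<lambda>n. K * L2_norm \<Omega> (\<lambda>x. u n x - v x)) \<longlonglongrightarrow> 0"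
    using tendsto_mult_left[OF limu, of K] by simp
  then have 3: "(\<lambda>n. L2_norm \<Omega> (\<lambda>x. f x (u n x) - f x (v x))) \<longlonglongrightarrow> 0"
    by (rule Lim_null_comparison[rotated]) (intro always_eventually allI, simp add: f_lipschitz_L2[OF uL vL(1)])
  have "(\<lambda>n. c * (LINT x|?M. wgrad \<Omega> (w n) x \<bullet> wgrad \<Omega> z x) + (LINT x|?M. w n x \<bullet> z x))
      \<longlonglongrightarrow> c * (LINT x|?M. wgrad \<Omega> v x \<bullet> wgrad \<Omega> z x) + (LINT x|?M. v x \<bullet> z x)"
    by (intro tendsto_intros L2_inner_tendsto wL vL zL 1 2)
  moreover have "c * (LINT x|?M. wgrad \<Omega> (w n) x \<bullet> wgrad \<Omega> z x) + (LINT x|?M. w n x \<bullet> z x)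
      = (LINT x|?M. u n x \<bullet> z x) + c * (LINT x|?M. f x (u n x) \<bullet> z x)" for n
    using scheme[OF z, of n] unfolding B_form_eq[OF H10_H1[OF w] H10_H1[OF z]] ell_form_eq[OF uL zL(1)] .
  moreover have "(\<lambda>n. (LINT x|?M. u n x \<bullet> z x) + c * (LINT x|?M. f x (u n x) \<bullet> z x))
      \<longlonglongrightarrow> (LINT x|?M. v x \<bullet> z x) + c * (LINT x|?M. f x (v x) \<bullet> z x)"
    by (intro tendsto_intros L2_inner_tendsto uL vL zL f_L2 limu 3)
  ultimately have "c * (LINT x|?M. wgrad \<Omega> v x \<bullet> wgrad \<Omega> z x) + (LINT x|?M. v x \<bullet> z x)
      = (LINT x|?M. v x \<bullet> z x) + c * (LINT x|?M. f x (v x) \<bullet> z x)"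
    using LIMSEQ_unique by (simp only:) blast
  then have "(LINT x|?M. wgrad \<Omega> v x \<bullet> wgrad \<Omega> z x) = (LINT x|?M. f x (v x) * z x)"
    using c by simp
  then show "(LINT x|?M. wgrad \<Omega> v x \<bullet> wgrad \<Omega> z x - f x (v x) * z x) = 0"
    using L2_inner_integrable[OF vL(2) zL(2)] L2_mult_integrable[OF f_L2[OF vL(1)] zL(1)] by simp
qed

end

section \<open>Coercivity and convergence of a subsequence\<close>

text \<open>Beyond some radius \<open>R\<close> the functional exceeds \<open>e\<close>, so the
  sublevel set lies in a ball. The factor \<open>sqrt (1 / min \<tau> 1)\<close> comes from
  comparing \<open>lam_norm\<close> with the H1 norm, and \<open>max R 0\<close> covers a negative
  \<open>R\<close>.\<close>

lemma weakly_coercive_bounded: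
  assumes "weakly_coercive \<Omega> \<tau> E" "\<tau> > 0"
  obtains M where "\<And>v. v \<in> H10 \<Omega> \<Longrightarrow> E v \<le> e \<Longrightarrow> H1_norm \<Omega> v \<le> M"
proof -
  have "\<forall>\<^sub>F v in inf (filtercomap (lam_norm \<Omega> \<tau>) at_top) (principal (H10 \<Omega>)). e < E v"
    using assms(1) unfolding weakly_coercive_def by (rule filterlim_at_top_dense[THEN iffD1, rule_format])
  then obtain R where R: "\<And>v. v \<in> H10 \<Omega> \<Longrightarrow> lam_norm \<Omega> \<tau> v \<ge> R \<Longrightarrow> e < E v"
    unfolding eventually_inf_principal eventually_filtercomap eventually_at_top_linorder by blast
  have "H1_norm \<Omega> v \<le> sqrt (1 / min \<tau> 1) * max R 0" if v: "v \<in> H10 \<Omega>" "E v \<le> e" for v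
  proof (rule power2_le_imp_le)
    have "lam_norm \<Omega> \<tau> v \<le> max R 0" using R[OF v(1)] v(2) by force
    moreover have "0 \<le> lam_norm \<Omega> \<tau> v" using assms(2) by (simp add: lam_norm_def)
    ultimately have "(lam_norm \<Omega> \<tau> v)\<^sup>2 \<le> (max R 0)\<^sup>2" by (rule power_mono)
    then have "\<tau> * (L2_norm \<Omega> (wgrad \<Omega> v))\<^sup>2 + (L2_norm \<Omega> v)\<^sup>2 \<le> (max R 0)\<^sup>2"
      using assms(2) by (simp add: lam_norm_def)
    moreover have "min \<tau> 1 * (L2_norm \<Omega> (wgrad \<Omega> v))\<^sup>2 \<le> \<tau> * (L2_norm \<Omega> (wgrad \<Omega> v))\<^sup>2"
      "min \<tau> 1 * (L2_norm \<Omega> v)\<^sup>2 \<le> 1 * (L2_norm \<Omega> v)\<^sup>2"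
      by (intro mult_right_mono; simp)+
    ultimately have "min \<tau> 1 * (H1_norm \<Omega> v)\<^sup>2 \<le> (max R 0)\<^sup>2"
      by (simp add: H1_norm_power2 distrib_left)
    moreover have "min \<tau> 1 > 0" using assms(2) by simp
    ultimately have "(H1_norm \<Omega> v)\<^sup>2 \<le> (1 / min \<tau> 1) * (max R 0)\<^sup>2"
      by (simp add: field_simps)
    then show "(H1_norm \<Omega> v)\<^sup>2 \<le> (sqrt (1 / min \<tau> 1) * max R 0)\<^sup>2"
      using \<open>min \<tau> 1 > 0\<close> by (simp add: power_mult_distrib)
  qed (use assms(2) in simp)
  then show ?thesis using that by blast
qed

text \<open>The inequality telescopes, so the squares of \<open>d\<close> are summable and tend to
  0.\<close>

lemma decreasing_energy_tendsto_0:
  fixes a d :: "nat \<Rightarrow> real"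
  assumes "c > 0" "\<And>n. a (Suc n) + c * (d n)\<^sup>2 \<le> a n" "\<And>n. B \<le> a n"
  shows "d \<longlonglongrightarrow> 0"
proof -
  have "c * (\<Sum>k<n. (d k)\<^sup>2) \<le> a 0 - a n" for n
  proof (induction n)
    case (Suc n)
    then show ?case using assms(2)[of n] by (simp add: distrib_left)
  qed simp
  then have le: "c * (\<Sum>k<n. (d k)\<^sup>2) \<le> a 0 - a n" for n .
  have "(\<Sum>k<n. (d k)\<^sup>2) \<le> (a 0 - B) / c" for n
  proof -
    have "c * (\<Sum>k<n. (d k)\<^sup>2) \<le> a 0 - B" using le[of n] assms(3)[of n] by linarith
    then show ?thesis using assms(1) by (simp add: pos_le_divide_eq mult.commute)
  qed
  then have "summable (\<lambda>k. (d k)\<^sup>2)" by (intro summableI_nonneg_bounded) auto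
  then have "(\<lambda>k. (d k)\<^sup>2) \<longlonglongrightarrow> 0" by (rule summable_LIMSEQ_zero)
  from tendsto_real_sqrt[OF this] show ?thesis by (simp add: tendsto_rabs_zero_iff)
qed

theorem theorem3p8:
  fixes \<Omega> :: "(real ^ 'd) set"
    and f :: "real ^ 'd \<Rightarrow> real \<Rightarrow> real"
    and C\<^sub>P \<rho> \<Delta>t \<tau> :: real
    and u :: "nat \<Rightarrow> real ^ 'd \<Rightarrow> real"
  assumes "CARD('d) \<in> {1, 2, 3}"
    and "polytopal_domain \<Omega>"
    and "poincare_constant \<Omega> C\<^sub>P"
    and "\<rho> > 0"
    and "assumption_A \<Omega> f \<rho>"
    and "\<Delta>t > 0"
    and "1 / \<Delta>t > kappa_f \<Omega> C\<^sub>P f \<rho>"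
    and "continuous_on (closure \<Omega> \<times> UNIV) (\<lambda>(x, s). f x s)"
    and "\<tau> > 0"
    and "weakly_coercive \<Omega> \<tau> (energy \<Omega> f)"
    and "\<And>n. u n \<in> H10 \<Omega>"
    and "\<And>n v. v \<in> H10 \<Omega> \<Longrightarrow> B_form \<Omega> \<Delta>t (u (Suc n)) v = ell_form \<Omega> f \<Delta>t (u n) v"
  shows "\<exists>r ustar. strict_mono (r :: nat \<Rightarrow> nat) \<and> weak_solution \<Omega> f ustar \<and>
           (\<lambda>k. H1_norm \<Omega> (\<lambda>x. u (r k) x - ustar x)) \<longlonglongrightarrow> 0"
proof -
  have op: "open \<Omega>" and bd: "bounded \<Omega>" using assms(2) by (auto simp: polytopal_domain_def)
  note u = assms(11) and scheme = assms(12)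
  have A: "(\<lambda>x. f x 0) \<in> L2 \<Omega>" "\<And>x s. x \<in> \<Omega> \<Longrightarrow> f x differentiable (at s)" "Lambda_f \<Omega> f \<rho> \<noteq> {}"
    using assms(5) by (auto simp: assumption_A_def)
  have "mu_f \<Omega> f \<rho> + \<rho> / 2 - 1 / (2 * C\<^sub>P) < 1 / \<Delta>t" using assms(7) by (simp add: kappa_f_def)
  \<comment> \<open>The strict step size condition leaves this slack above \<open>mu_f\<close>, just
    enough to choose \<open>\<nu>\<close> with \<open>K / 2\<close> below the sum of the other two
    terms of \<open>\<gamma>\<close>.\<close>
  then have "0 < 1 / \<Delta>t + 1 / (2 * C\<^sub>P) - \<rho> / 2 - mu_f \<Omega> f \<rho>" by linarith
  then obtain \<nu> where \<nu>0: "\<nu> \<in> Lambda_f \<Omega> f \<rho>"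
    "1 / \<nu> < mu_f \<Omega> f \<rho> + (1 / \<Delta>t + 1 / (2 * C\<^sub>P) - \<rho> / 2 - mu_f \<Omega> f \<rho>)"
    by (rule Lambda_f_near_mu_f[OF A(3)])
  then have \<nu>: "\<nu> \<in> Lambda_f \<Omega> f \<rho>" "1 / \<nu> < 1 / \<Delta>t + 1 / (2 * C\<^sub>P) - \<rho> / 2" by simp_all
  define K where "K = \<rho> + 2 / \<nu>"
  have "\<nu> > 0" using \<nu>(1) by (simp add: Lambda_f_def)
  interpret lipschitz_reaction \<Omega> f K
  proof
    show "0 \<le> K" using \<open>\<nu> > 0\<close> assms(4) by (simp add: K_def)
    show "continuous_on (\<Omega> \<times> UNIV) (\<lambda>(x, s). f x s)"
      by (rule continuous_on_subset[OF assms(8)]) (use closure_subset in blast)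
    show "AE x in lebesgue_on \<Omega>. \<forall>s t. \<bar>f x s - f x t\<bar> \<le> K * \<bar>s - t\<bar>"
      using Lambda_f_deriv_bounds[OF \<nu>(1)] AE_space
    proof eventually_elim
      case (elim x)
      then have "x \<in> \<Omega>" by simp
      then show ?case
        using lipschitz_of_deriv_bound[OF A(2)] elim(1) unfolding K_def by blast
    qed
  qed (use op A(1) in auto)
  define \<gamma> where "\<gamma> = 1 / \<Delta>t + 1 / (2 * C\<^sub>P) - K / 2"
  have "K / 2 = \<rho> / 2 + 1 / \<nu>" by (simp add: K_def)
  then have \<gamma>: "\<gamma> > 0" using \<nu>(2) by (simp add: \<gamma>_def)
  have descent: "energy \<Omega> f (u (Suc n)) + \<gamma> * (L2_norm \<Omega> (\<lambda>x. u (Suc n) x - u n x))\<^sup>2 \<le> energy \<Omega> f (u n)" for n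
    unfolding \<gamma>_def by (rule energy_descent[OF u u assms(6) scheme assms(3)])
  have decr: "energy \<Omega> f (u n) \<le> energy \<Omega> f (u 0)" for n
  proof (induction n)
    case (Suc n)
    have "0 \<le> \<gamma> * (L2_norm \<Omega> (\<lambda>x. u (Suc n) x - u n x))\<^sup>2" using \<gamma> by simp
    then show ?case using descent[of n] Suc by linarith
  qed simp
  obtain M where "\<And>v. v \<in> H10 \<Omega> \<Longrightarrow> energy \<Omega> f v \<le> energy \<Omega> f (u 0) \<Longrightarrow> H1_norm \<Omega> v \<le> M"
    by (rule weakly_coercive_bounded[OF assms(10,9)], rule that)
  then have M: "H1_norm \<Omega> (u n) \<le> M" for n using u decr by blast
  \<comment> \<open>Weak coercivity says nothing about moderate norms. There the gradient term is
    nonnegative and the primitive grows at most quadratically, so the H1 bound on the iterates gives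
    a lower bound.\<close>
  have "- ((L2_norm \<Omega> (\<lambda>x. f x 0))\<^sup>2 + (1 + K) * M\<^sup>2) \<le> energy \<Omega> f (u n)" for n
  proof -
    have "(L2_norm \<Omega> (u n))\<^sup>2 \<le> M\<^sup>2"
      using L2_norm_le_H1_norm(1)[of \<Omega> "u n"] M[of n] by (intro power_mono) auto
    then have "(1 + K) * (L2_norm \<Omega> (u n))\<^sup>2 \<le> (1 + K) * M\<^sup>2"
      using K_nonneg by (intro mult_left_mono) auto
    moreover have "0 \<le> 1 / 2 * (L2_norm \<Omega> (wgrad \<Omega> (u n)))\<^sup>2" by simp
    ultimately show ?thesis
      using primitive_bounds(2)[OF H1_D(1)[OF H10_H1[OF u[of n]]]] unfolding energy_eq by linarith
  qed
  then have increments: "(\<lambda>n. L2_norm \<Omega> (\<lambda>x. u (Suc n) x - u n x)) \<longlonglongrightarrow> 0"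
    by (rule decreasing_energy_tendsto_0[where a = "\<lambda>n. energy \<Omega> f (u n)", OF \<gamma> descent])
  obtain k :: "nat \<Rightarrow> nat" where k: "strict_mono k"
    and Cauchy: "\<And>e. e > 0 \<Longrightarrow> \<exists>P. \<forall>m\<ge>P. \<forall>n\<ge>P. L2_norm \<Omega> (\<lambda>x. u (k m) x - u (k n) x) < e"
    by (rule Rellich_H10[where u = u, OF op bd u M], rule that)
  \<comment> \<open>The outputs of the steps that start at the L2 Cauchy subsequence; these are the
    iterates whose gradients are controlled as well.\<close>
  define w where "w n = u (Suc (k n))" for n
  have w: "w n \<in> H10 \<Omega>" for n unfolding w_def by (rule u)
  have scheme_w: "B_form \<Omega> \<Delta>t (w n) z = ell_form \<Omega> f \<Delta>t (u (k n)) z" if "z \<in> H10 \<Omega>" for n z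
    unfolding w_def by (rule scheme[OF that])
  have H1_Cauchy: "\<exists>N. \<forall>m\<ge>N. \<forall>n\<ge>N. H1_norm \<Omega> (\<lambda>x. w m x - w n x) < e" if e: "e > 0" for e
  proof -
    have pos: "min \<Delta>t 1 > 0" "1 + \<Delta>t * K > 0" using assms(6) K_nonneg by (auto simp: add_pos_nonneg)
    \<comment> \<open>The tolerance is chosen so that the constants of
      \<open>scheme_contraction\<close> cancel.\<close>
    then obtain P where P: "\<And>m n. m \<ge> P \<Longrightarrow> n \<ge> P \<Longrightarrow>
        L2_norm \<Omega> (\<lambda>x. u (k m) x - u (k n) x) < e * min \<Delta>t 1 / (1 + \<Delta>t * K)"
      using Cauchy[of "e * min \<Delta>t 1 / (1 + \<Delta>t * K)"] e by auto
    have "H1_norm \<Omega> (\<lambda>x. w m x - w n x) < e" if "m \<ge> P" "n \<ge> P" for m n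
    proof -
      have "min \<Delta>t 1 * H1_norm \<Omega> (\<lambda>x. w m x - w n x) \<le> (1 + \<Delta>t * K) * L2_norm \<Omega> (\<lambda>x. u (k m) x - u (k n) x)"
        by (rule scheme_contraction[OF assms(6) u u w w scheme_w scheme_w])
      also have "\<dots> < e * min \<Delta>t 1"
        using P[OF that] pos(2) by (simp add: pos_less_divide_eq mult.commute)
      finally show ?thesis using pos(1) by (simp add: mult.commute)
    qed
    then show ?thesis by blast
  qed
  obtain v where v: "v \<in> H10 \<Omega>" and lim: "(\<lambda>n. H1_norm \<Omega> (\<lambda>x. w n x - v x)) \<longlonglongrightarrow> 0"
  proof (rule H10_complete[where u = w, OF op w])
    show "\<exists>N. \<forall>m\<ge>N. \<forall>n\<ge>N. H1_norm \<Omega> (\<lambda>x. w m x - w n x) < e" if "e > 0" for e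
      by (rule H1_Cauchy[OF that])
  qed (rule that)
  \<comment> \<open>An input differs from its output by one increment, which tends to 0, so the
    inputs inherit the limit \<open>v\<close> in L2.\<close>
  have "(\<lambda>n. L2_norm \<Omega> (\<lambda>x. u (Suc (k n)) x - u (k n) x) + H1_norm \<Omega> (\<lambda>x. w n x - v x)) \<longlonglongrightarrow> 0 + 0"
    using LIMSEQ_subseq_LIMSEQ[OF increments k] lim by (intro tendsto_add) (simp_all add: comp_def)
  then have sum: "(\<lambda>n. L2_norm \<Omega> (\<lambda>x. u (Suc (k n)) x - u (k n) x) + H1_norm \<Omega> (\<lambda>x. w n x - v x)) \<longlonglongrightarrow> 0"
    by simp
  have "norm (L2_norm \<Omega> (\<lambda>x. u (k n) x - v x))
      \<le> L2_norm \<Omega> (\<lambda>x. u (Suc (k n)) x - u (k n) x) + H1_norm \<Omega> (\<lambda>x. w n x - v x)" for n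
  proof -
    have "L2_norm \<Omega> (\<lambda>x. u (k n) x - v x)
        \<le> L2_norm \<Omega> (\<lambda>x. u (k n) x - w n x) + L2_norm \<Omega> (\<lambda>x. w n x - v x)"
      by (intro L2_triangle_diff H1_D(1) H10_H1 u w v)
    then show ?thesis
      using L2_norm_le_H1_norm(1)[of \<Omega> "\<lambda>x. w n x - v x"]
      by (simp add: w_def L2_norm_minus_commute[of \<Omega> "u (k n)"])
  qed
  then have limu: "(\<lambda>n. L2_norm \<Omega> (\<lambda>x. u (k n) x - v x)) \<longlonglongrightarrow> 0"
    by (intro Lim_null_comparison[OF _ sum] always_eventually allI)
  have "weak_solution \<Omega> f v"
    by (rule scheme_limit_weak_solution[OF assms(6) u w v scheme_w lim limu])
  \<comment> \<open>Strong convergence is known for the outputs, so the required subsequence carries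
    the shift by one.\<close>
  moreover have "strict_mono (\<lambda>n. Suc (k n))" using k by (simp add: strict_mono_def)
  ultimately show ?thesis using lim unfolding w_def by blast
qed

end
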